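(* Let $n\ge 1$ be an integer, let $s\in\mathbb{C}\setminus\{0\}$, and set $\tau_0:=|s|^2$. Let $Z=(T^*\mathbb{CP}^n)_\lambda$ be the twisted cotangent bundle with parameter $s$, with its coordinate patches $\pi_\lambda^{-1}(U_\alpha)$, $\alpha=0,1,\dots,n$, and let $\tau\in C^\infty(Z)$ be the function defined in the context. Let $f\in C^\infty(\mathbb{R})$ be real-valued and such that the $2$-form $\omega_I=\mathrm{d}\big(\tfrac{\sqrt{-1}}{4} f(\tau)(\overline{\partial}\tau-\partial\tau)\big)$ on $Z$ satisfies $\omega_I(v,Iv)>0$ for all nonzero real tangent vectors $v$, where $I$ is the complex structure of $Z$. Let $g(v,w):=\omega_I(v,Iw)$ be the corresponding K\"ahler metric and let $A_\alpha=(g_{i\bar j})_{i,j=1,\dots,2n}$ be the matrix of its components on $\pi_\lambda^{-1}(U_\alpha)$, as defined in the context. Then, for every $\alpha$, one has $\det A_\alpha=1$ on $\pi_\lambda^{-1}(U_\alpha)$ if and only if $f$ satisfies $$2 f'(\tau) f(\tau)^{2n-1}\tau^n(\tau-\tau_0)+f(\tau)^{2n}\tau^{n-1}(2\tau-\tau_0)=1$$ for all real $\tau\ge\tau_0$ (i.e. for all values taken by the function $\tau$ on $Z$).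
   Context: Indices of $\mathbb{C}^{n+1}$ run over $0,1,\dots,n$, and $e_n={}^t(0,\dots,0,1)$. Put $G^c=\mathrm{SL}_{n+1}(\mathbb{C})$, and let $Q\subset G^c$ be the subgroup of block lower triangular matrices $\left[\begin{smallmatrix} a&0\\ c&d\end{smallmatrix}\right]$ ($a\in \mathrm{GL}_n(\mathbb{C})$, $c$ a row vector, $d\in\mathbb{C}^\times$), and $L\subset Q$ the subgroup of block diagonal ones ($c=0$). $G^c/Q\cong\mathbb{CP}^n$ by $gQ\mapsto[g e_n]$. For a column vector $z\in\mathbb{C}^n$ and a row vector $w\in(\mathbb{C}^n)^*$ put $u_z=\left[\begin{smallmatrix}1_n&z\\0&1\end{smallmatrix}\right]$ and $u^-_w=\left[\begin{smallmatrix}1_n&0\\ w&1\end{smallmatrix}\right]$. For $\alpha=0,\dots,n$, let $\sigma_\alpha\in \mathrm{SU}(n+1)$ be a fixed signed permutation matrix of determinant one corresponding to the cyclic permutation $(\alpha,\alpha+1,\dots,n)$ (so $\sigma_\alpha e_n=\pm e_\alpha$), let $U_\alpha=\{[\zeta_0:\dots:\zeta_n]:\zeta_\alpha\ne0\}$, and let $\varphi_\alpha:U_\alpha\to\mathbb{C}^n$ be the holomorphic chart sending $[\sigma_\alpha u_{z}e_n]$ to $z=z_\alpha$. Let $\lambda$ be the linear functional on $\mathfrak{sl}_{n+1}(\mathbb{C})$ given by $\langle\lambda,X\rangle=\operatorname{tr}(\lambda^\vee X)$ with $\lambda^\vee=\frac{s}{n+1}\left[\begin{smallmatrix}1_n&0\\0&-n\end{smallmatrix}\right]$;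 thus $\langle\lambda,\left[\begin{smallmatrix}a&0\\ c&d\end{smallmatrix}\right]\rangle=-sd$. Twisted cotangent bundle: $Z=(T^*\mathbb{CP}^n)_\lambda:=\bigsqcup_{\alpha=0}^n T^*U_\alpha/\sim$, where a point of the holomorphic cotangent bundle $T^*U_\alpha$ is written $\xi_\alpha\,\mathrm{d}z_\alpha=\sum_i\xi_{\alpha,i}\,\mathrm{d}z_{\alpha,i}$ ($z_\alpha$ a column vector, $\xi_\alpha$ a row vector), and over $U_\alpha\cap U_\beta$ the point $\xi_\beta\,\mathrm{d}z_\beta$ is equivalent to $\xi_\alpha\,\mathrm{d}z_\alpha$ iff $z_\beta=(\varphi_\beta\circ\varphi_\alpha^{-1})(z_\alpha)$ and $\xi_\beta\,\mathrm{d}z_\beta=\xi_\alpha\,\mathrm{d}z_\alpha-\langle\lambda,\mathrm{d}t_{\alpha\beta}\,t_{\alpha\beta}^{-1}\rangle$. Here $t_{\alpha\beta}\in L$ is the unique element with $\sigma_\beta u_{z_\beta}u^-_{w_\beta}=\sigma_\alpha u_{z_\alpha}u^-_{w_\alpha}t_{\alpha\beta}$, where $\xi_\alpha=-sw_\alpha$, $\xi_\beta=-sw_\beta$. The projection is $\pi_\lambda:Z\to\mathbb{CP}^n$, so $\pi_\lambda^{-1}(U_\alpha)=T^*U_\alpha$ has holomorphic coordinates $(z,\xi)=(z_1,\dots,z_n,\xi_1,\dots,\xi_n)\in\mathbb{C}^{2n}$ (index $\alpha$ suppressed). $Z$ is a complex manifold of complex dimension $2n$, with complex structure $I$. The map $\mu_+:Z\to\mathfrak{sl}_{n+1}(\mathbb{C})$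 is given on $\pi_\lambda^{-1}(U_\alpha)$ by $\mu_+(z,\xi)=h\lambda^\vee h^{-1}$ with $h=\sigma_\alpha u_zu^-_w$, $\xi=-sw$ (it is well defined on $Z$). The function $\tau:=\operatorname{tr}(\mu_+\mu_+^* )+\frac{|s|^2}{n+1}$ on $Z$ (with $*$ the conjugate transpose) is given on every $\pi_\lambda^{-1}(U_\alpha)$ by $\tau=(\|z\|^2+1)(\|\xi\|^2+|s-\xi z|^2)$, where $\|z\|^2=z^*z$, $\|\xi\|^2=\xi\xi^*$. Convention: $z_{n+i}:=\xi_i$ for $i=1,\dots,n$. The components $g_{i\bar j}$ ($i,j=1,\dots,2n$) on $\pi_\lambda^{-1}(U_\alpha)$ are defined by $\omega_I=\frac{\sqrt{-1}}{2}\sum_{i,j=1}^{2n}g_{i\bar j}\,\mathrm{d}z_i\wedge\mathrm{d}\bar z_j$; equivalently $g_{i\bar j}=f(\tau)\frac{\partial^2\tau}{\partial z_i\partial\bar z_j}+f'(\tau)\frac{\partial\tau}{\partial z_i}\frac{\partial\tau}{\partial\bar z_j}$. *)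

theory Defs
  imports
    "HOL-Analysis.Derivative"
    "Jordan_Normal_Form.Gauss_Jordan_Elimination"
    "Jordan_Normal_Form.Schur_Decomposition"
begin

(* The notations $ and \<bullet> below are those of Jordan_Normal_Form. *)
unbundle no vec_syntax and no inner_syntax

(* Everything lives over C^n, C^(n+1) and C^(2n) for a natural number n, so vectors and matrices are
   those of Jordan_Normal_Form, with explicit dimensions.  A row vector in the dual of C^n is stored
   as a vec; its pairing with a column vector is the bilinear scalar product (no conjugation). *)

section \<open>Matrices\<close>

definition mat_trace :: "'a::comm_ring_1 mat \<Rightarrow> 'a" where
  "mat_trace A = (\<Sum>i<dim_row A. A $$ (i,i))"

definition minv :: "complex mat \<Rightarrow> complex mat" where
  "minv A = the (mat_inverse A)"

definition u_upper :: "nat \<Rightarrow> complex vec \<Rightarrow> complex mat" where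
  "u_upper n z = four_block_mat (1\<^sub>m n) (mat_of_cols n [z]) (0\<^sub>m 1 n) (1\<^sub>m 1)"

definition u_lower :: "nat \<Rightarrow> complex vec \<Rightarrow> complex mat" where
  "u_lower n w = four_block_mat (1\<^sub>m n) (0\<^sub>m n 1) (mat_of_rows n [w]) (1\<^sub>m 1)"

definition L_group :: "nat \<Rightarrow> complex mat set" where
  "L_group n = {four_block_mat a (0\<^sub>m n 1) (0\<^sub>m 1 n) d | a d.
     a \<in> carrier_mat n n \<and> d \<in> carrier_mat 1 1 \<and>
     Determinant.det (four_block_mat a (0\<^sub>m n 1) (0\<^sub>m 1 n) d) = 1}"

definition lam_mat :: "nat \<Rightarrow> complex \<Rightarrow> complex mat" where
  "lam_mat n s = (s / of_nat (n + 1)) \<cdot>\<^sub>m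
     four_block_mat (1\<^sub>m n) (0\<^sub>m n 1) (0\<^sub>m 1 n) ((- of_nat n) \<cdot>\<^sub>m 1\<^sub>m 1)"

definition lam :: "nat \<Rightarrow> complex \<Rightarrow> complex mat \<Rightarrow> complex" where
  "lam n s X = mat_trace (lam_mat n s * X)"

(* The cyclic permutation (a, a+1, ..., n) of {0..n}; in particular n is sent to a. *)
definition cyc :: "nat \<Rightarrow> nat \<Rightarrow> nat \<Rightarrow> nat" where
  "cyc n a j = (if j < a then j else if j < n then j + 1 else a)"

(* The signs are only required to make the determinant one, as the choice of the matrices
   sigma_0, ..., sigma_n is otherwise free. *)
definition cyclic_signed_perms :: "nat \<Rightarrow> (nat \<Rightarrow> complex mat) \<Rightarrow> bool" where
  "cyclic_signed_perms n \<sigma> \<longleftrightarrow> (\<forall>\<alpha>\<le>n.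
     Determinant.det (\<sigma> \<alpha>) = 1 \<and>
     (\<exists>\<epsilon>. (\<forall>j\<le>n. \<epsilon> j \<in> {1, -1}) \<and>
          \<sigma> \<alpha> = mat (n+1) (n+1) (\<lambda>(i,j). if i = cyc n \<alpha> j then \<epsilon> j else 0)))"

section \<open>Projective space and its charts\<close>

definition proj_pt :: "complex vec \<Rightarrow> complex vec set" where
  "proj_pt \<zeta> = {c \<cdot>\<^sub>v \<zeta> | c. c \<noteq> 0}"

definition U_patch :: "nat \<Rightarrow> nat \<Rightarrow> complex vec set set" where
  "U_patch n \<alpha> = {proj_pt \<zeta> | \<zeta>. \<zeta> \<in> carrier_vec (n+1) \<and> \<zeta> $ \<alpha> \<noteq> 0}"

definition chart_pt :: "nat \<Rightarrow> (nat \<Rightarrow> complex mat) \<Rightarrow> nat \<Rightarrow> complex vec \<Rightarrow> complex vec set" where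
  "chart_pt n \<sigma> \<alpha> z = proj_pt (\<sigma> \<alpha> *\<^sub>v (u_upper n z *\<^sub>v unit_vec (n+1) n))"

definition chart :: "nat \<Rightarrow> (nat \<Rightarrow> complex mat) \<Rightarrow> nat \<Rightarrow> complex vec set \<Rightarrow> complex vec" where
  "chart n \<sigma> \<alpha> x = (THE z. z \<in> carrier_vec n \<and> x = chart_pt n \<sigma> \<alpha> z)"

definition transition ::
  "nat \<Rightarrow> (nat \<Rightarrow> complex mat) \<Rightarrow> nat \<Rightarrow> nat \<Rightarrow> complex vec \<Rightarrow> complex vec" where
  "transition n \<sigma> \<alpha> \<beta> z = chart n \<sigma> \<beta> (chart_pt n \<sigma> \<alpha> z)"

definition d_transition ::
  "nat \<Rightarrow> (nat \<Rightarrow> complex mat) \<Rightarrow> nat \<Rightarrow> nat \<Rightarrow> complex vec \<Rightarrow> complex vec \<Rightarrow> complex vec" where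
  "d_transition n \<sigma> \<alpha> \<beta> z v = vec n (\<lambda>i. deriv (\<lambda>h. transition n \<sigma> \<alpha> \<beta> (z + h \<cdot>\<^sub>v v) $ i) 0)"

section \<open>The twisted cotangent bundle\<close>

(* w is determined by xi = - s w. *)
definition w_of :: "complex \<Rightarrow> complex vec \<Rightarrow> complex vec" where
  "w_of s \<xi> = (- 1 / s) \<cdot>\<^sub>v \<xi>"

definition h_mat ::
  "nat \<Rightarrow> complex \<Rightarrow> (nat \<Rightarrow> complex mat) \<Rightarrow> nat \<Rightarrow> complex vec \<Rightarrow> complex vec \<Rightarrow> complex mat" where
  "h_mat n s \<sigma> \<alpha> z \<xi> = \<sigma> \<alpha> * u_upper n z * u_lower n (w_of s \<xi>)"

(* t_{alpha beta}, as a function of the coordinates (z_alpha, xi_alpha) on the overlap. *)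
definition t_mat ::
  "nat \<Rightarrow> complex \<Rightarrow> (nat \<Rightarrow> complex mat) \<Rightarrow> nat \<Rightarrow> nat \<Rightarrow> complex vec \<Rightarrow> complex vec \<Rightarrow> complex mat" where
  "t_mat n s \<sigma> \<alpha> \<beta> z \<xi> = (THE t. t \<in> L_group n \<and>
     (\<exists>z' \<xi>'. z' \<in> carrier_vec n \<and> \<xi>' \<in> carrier_vec n \<and>
        h_mat n s \<sigma> \<beta> z' \<xi>' = h_mat n s \<sigma> \<alpha> z \<xi> * t))"

(* The differential of the holomorphic map t_{alpha beta} in the direction (v, eta). *)
definition dt_mat ::
  "nat \<Rightarrow> complex \<Rightarrow> (nat \<Rightarrow> complex mat) \<Rightarrow> nat \<Rightarrow> nat \<Rightarrow> complex vec \<Rightarrow> complex vec \<Rightarrow>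
   complex vec \<Rightarrow> complex vec \<Rightarrow> complex mat" where
  "dt_mat n s \<sigma> \<alpha> \<beta> z \<xi> v \<eta> = mat (n+1) (n+1)
     (\<lambda>ij. deriv (\<lambda>h. t_mat n s \<sigma> \<alpha> \<beta> (z + h \<cdot>\<^sub>v v) (\<xi> + h \<cdot>\<^sub>v \<eta>) $$ ij) 0)"

definition cotangent_union :: "nat \<Rightarrow> (nat \<times> complex vec \<times> complex vec) set" where
  "cotangent_union n = {0..n} \<times> carrier_vec n \<times> carrier_vec n"

(* The identity  xi' dz' = xi dz - <lambda, dt t^{-1}>  of holomorphic 1-forms is tested on all
   tangent vectors (v, eta) in the (z, xi)-coordinates, t being a function of both z and xi. *)
definition glue ::
  "nat \<Rightarrow> complex \<Rightarrow> (nat \<Rightarrow> complex mat) \<Rightarrow>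
   ((nat \<times> complex vec \<times> complex vec) \<times> (nat \<times> complex vec \<times> complex vec)) set" where
  "glue n s \<sigma> = {((\<alpha>, z, \<xi>), (\<beta>, z', \<xi>')).
     (\<alpha>, z, \<xi>) \<in> cotangent_union n \<and> (\<beta>, z', \<xi>') \<in> cotangent_union n \<and>
     chart_pt n \<sigma> \<alpha> z \<in> U_patch n \<beta> \<and>
     z' = transition n \<sigma> \<alpha> \<beta> z \<and>
     (\<forall>v \<in> carrier_vec n. \<forall>\<eta> \<in> carrier_vec n.
        \<xi>' \<bullet> d_transition n \<sigma> \<alpha> \<beta> z v =
        \<xi> \<bullet> v - lam n s (dt_mat n s \<sigma> \<alpha> \<beta> z \<xi> v \<eta> * minv (t_mat n s \<sigma> \<alpha> \<beta> z \<xi>)))}"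

definition twisted_cotangent ::
  "nat \<Rightarrow> complex \<Rightarrow> (nat \<Rightarrow> complex mat) \<Rightarrow> (nat \<times> complex vec \<times> complex vec) set set" where
  "twisted_cotangent n s \<sigma> = cotangent_union n // glue n s \<sigma>"

(* The point of the patch over U_alpha with coordinates p = (z_1, ..., z_n, xi_1, ..., xi_n);
   in 0-based indexing, coordinate i < n is z and coordinate n + i is xi. *)
definition Z_pt ::
  "nat \<Rightarrow> complex \<Rightarrow> (nat \<Rightarrow> complex mat) \<Rightarrow> nat \<Rightarrow> complex vec \<Rightarrow>
   (nat \<times> complex vec \<times> complex vec) set" where
  "Z_pt n s \<sigma> \<alpha> p = glue n s \<sigma> `` {(\<alpha>, vec_first p n, vec_last p n)}"

lemma twisted_cotangent_eq:
  "twisted_cotangent n s \<sigma> = (\<Union>\<alpha>\<in>{0..n}. Z_pt n s \<sigma> \<alpha> ` carrier_vec (2 * n))"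
proof (intro equalityI subsetI)
  fix X assume "X \<in> twisted_cotangent n s \<sigma>"
  then obtain a where a: "a \<in> cotangent_union n" and X: "X = glue n s \<sigma> `` {a}"
    unfolding twisted_cotangent_def by (rule quotientE)
  obtain \<alpha> z \<xi> where a_eq: "a = (\<alpha>, z, \<xi>)" by (cases a)
  have mem: "\<alpha> \<in> {0..n}" "z \<in> carrier_vec n" "\<xi> \<in> carrier_vec n"
    using a by (simp_all add: a_eq cotangent_union_def)
  have split: "vec_first (z @\<^sub>v \<xi>) n = z" "vec_last (z @\<^sub>v \<xi>) n = \<xi>"
    using mem by (auto simp: vec_first_def vec_last_def)
  have "X = Z_pt n s \<sigma> \<alpha> (z @\<^sub>v \<xi>)"
    unfolding X a_eq Z_pt_def split ..
  moreover have "z @\<^sub>v \<xi> \<in> carrier_vec (2 * n)"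
    unfolding mult_2 using mem(2,3) by (rule append_carrier_vec)
  ultimately show "X \<in> (\<Union>\<alpha>\<in>{0..n}. Z_pt n s \<sigma> \<alpha> ` carrier_vec (2 * n))"
    using mem(1) by blast
next
  fix X assume "X \<in> (\<Union>\<alpha>\<in>{0..n}. Z_pt n s \<sigma> \<alpha> ` carrier_vec (2 * n))"
  then obtain \<alpha> p where \<alpha>: "\<alpha> \<in> {0..n}" and X: "X = Z_pt n s \<sigma> \<alpha> p"
    by blast
  have "(\<alpha>, vec_first p n, vec_last p n) \<in> cotangent_union n"
    using \<alpha> by (simp add: cotangent_union_def)
  then show "X \<in> twisted_cotangent n s \<sigma>"
    unfolding twisted_cotangent_def X Z_pt_def by (rule quotientI)
qed

(* The value does not depend on the representative; the_elem picks the common value. *)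
definition mu_plus ::
  "nat \<Rightarrow> complex \<Rightarrow> (nat \<Rightarrow> complex mat) \<Rightarrow> (nat \<times> complex vec \<times> complex vec) set \<Rightarrow> complex mat" where
  "mu_plus n s \<sigma> X = the_elem
     ((\<lambda>(\<alpha>, z, \<xi>). h_mat n s \<sigma> \<alpha> z \<xi> * lam_mat n s * minv (h_mat n s \<sigma> \<alpha> z \<xi>)) ` X)"

(* tr(M M^* ) is a nonnegative real number; Re only converts it to type real. *)
definition tau ::
  "nat \<Rightarrow> complex \<Rightarrow> (nat \<Rightarrow> complex mat) \<Rightarrow> (nat \<times> complex vec \<times> complex vec) set \<Rightarrow> real" where
  "tau n s \<sigma> X = Re (mat_trace (mu_plus n s \<sigma> X * mat_adjoint (mu_plus n s \<sigma> X)))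
                 + (cmod s)\<^sup>2 / real (n + 1)"

section \<open>Differential forms in complex coordinates\<close>

(* A real tangent vector of C^m at p is an element v of C^m, and the complex structure is
   multiplication by i. *)

definition dir_deriv :: "(complex vec \<Rightarrow> complex) \<Rightarrow> complex vec \<Rightarrow> complex vec \<Rightarrow> complex" where
  "dir_deriv F p v = vector_derivative (\<lambda>t::real. F (p + of_real t \<cdot>\<^sub>v v)) (at 0)"

definition d_z :: "(complex vec \<Rightarrow> complex) \<Rightarrow> nat \<Rightarrow> complex vec \<Rightarrow> complex" where
  "d_z F i p = (dir_deriv F p (unit_vec (dim_vec p) i)
                - \<i> * dir_deriv F p (\<i> \<cdot>\<^sub>v unit_vec (dim_vec p) i)) / 2"

definition d_zbar :: "(complex vec \<Rightarrow> complex) \<Rightarrow> nat \<Rightarrow> complex vec \<Rightarrow> complex" where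
  "d_zbar F i p = (dir_deriv F p (unit_vec (dim_vec p) i)
                   + \<i> * dir_deriv F p (\<i> \<cdot>\<^sub>v unit_vec (dim_vec p) i)) / 2"

definition del :: "(complex vec \<Rightarrow> complex) \<Rightarrow> complex vec \<Rightarrow> complex vec \<Rightarrow> complex" where
  "del F p v = (\<Sum>i<dim_vec p. d_z F i p * v $ i)"

definition delbar :: "(complex vec \<Rightarrow> complex) \<Rightarrow> complex vec \<Rightarrow> complex vec \<Rightarrow> complex" where
  "delbar F p v = (\<Sum>i<dim_vec p. d_zbar F i p * cnj (v $ i))"

(* d theta (v, w) = v(theta(w)) - w(theta(v)) for constant vector fields v, w; correspondingly
   (a \<and> b)(v, w) = a(v) b(w) - a(w) b(v). *)
definition ext_deriv ::
  "(complex vec \<Rightarrow> complex vec \<Rightarrow> complex) \<Rightarrow> complex vec \<Rightarrow> complex vec \<Rightarrow> complex vec \<Rightarrow> complex" where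
  "ext_deriv \<theta> p v w = dir_deriv (\<lambda>q. \<theta> q w) p v - dir_deriv (\<lambda>q. \<theta> q v) p w"

section \<open>The Kaehler form and its components\<close>

definition tau_chart ::
  "nat \<Rightarrow> complex \<Rightarrow> (nat \<Rightarrow> complex mat) \<Rightarrow> nat \<Rightarrow> complex vec \<Rightarrow> real" where
  "tau_chart n s \<sigma> \<alpha> p = tau n s \<sigma> (Z_pt n s \<sigma> \<alpha> p)"

definition theta ::
  "nat \<Rightarrow> complex \<Rightarrow> (nat \<Rightarrow> complex mat) \<Rightarrow> (real \<Rightarrow> real) \<Rightarrow> nat \<Rightarrow>
   complex vec \<Rightarrow> complex vec \<Rightarrow> complex" where
  "theta n s \<sigma> f \<alpha> p v = \<i> / 4 * of_real (f (tau_chart n s \<sigma> \<alpha> p)) *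
     (delbar (\<lambda>q. of_real (tau_chart n s \<sigma> \<alpha> q)) p v - del (\<lambda>q. of_real (tau_chart n s \<sigma> \<alpha> q)) p v)"

(* The form omega_I in the coordinates (z, xi) of the patch over U_alpha. *)
definition omega_I ::
  "nat \<Rightarrow> complex \<Rightarrow> (nat \<Rightarrow> complex mat) \<Rightarrow> (real \<Rightarrow> real) \<Rightarrow> nat \<Rightarrow>
   complex vec \<Rightarrow> complex vec \<Rightarrow> complex vec \<Rightarrow> complex" where
  "omega_I n s \<sigma> f \<alpha> = ext_deriv (theta n s \<sigma> f \<alpha>)"

(* The unique A with omega_I = i/2 sum_{i,j} A_{ij} dz_i \<and> d(cnj z_j). *)
definition g_components ::
  "nat \<Rightarrow> complex \<Rightarrow> (nat \<Rightarrow> complex mat) \<Rightarrow> (real \<Rightarrow> real) \<Rightarrow> nat \<Rightarrow> complex vec \<Rightarrow> complex mat" where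
  "g_components n s \<sigma> f \<alpha> p = (THE A. A \<in> carrier_mat (2*n) (2*n) \<and>
     (\<forall>v \<in> carrier_vec (2*n). \<forall>w \<in> carrier_vec (2*n).
        omega_I n s \<sigma> f \<alpha> p v w =
        \<i> / 2 * (\<Sum>i<2*n. \<Sum>j<2*n. A $$ (i,j) * (v $ i * cnj (w $ j) - w $ i * cnj (v $ j)))))"

definition smooth_real :: "(real \<Rightarrow> real) \<Rightarrow> bool" where
  "smooth_real f \<longleftrightarrow> (\<forall>k x. (deriv ^^ k) f differentiable (at x))"

end

theory Submission
  imports Defs
begin

text \<open>
  Describe the point with coordinates \<open>(z, \<xi>)\<close> of the patch over \<open>U\<^sub>\<alpha>\<close> by the two vectors
  \<open>\<zeta> = \<sigma>\<^sub>\<alpha> (z; 1)\<close> and \<open>\<rho> = \<sigma>\<^sub>\<alpha> (\<xi>; s - \<xi> z)\<close> of length \<open>n + 1\<close>, which pair to \<open>s\<close>.  They are the last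
  column of \<open>h\<close> and \<open>s\<close> times the last row of the inverse of \<open>h\<close>, so the moment map is the scalar
  \<open>s / (n + 1)\<close> minus the dyad of \<open>\<zeta>\<close> and \<open>\<rho>\<close> (\<open>mu_rank_one\<close>).

  A change of patch replaces \<open>(\<zeta>, \<rho>)\<close> by \<open>(\<zeta> / c, c \<rho>)\<close>, where \<open>c\<close> is the last entry of
  \<open>\<sigma>\<^sub>\<beta>\<^sup>T \<zeta>\<close>, and therefore preserves the dyad.  To see that the gluing rule for \<open>\<xi>\<close> says just this, one
  computes \<open>\<langle>\<lambda>, dt t\<^sup>-\<^sup>1\<rangle> = s dc / c\<close>: the corner entry of \<open>t\<close> is \<open>1 / c\<close>, and \<open>dt t\<^sup>-\<^sup>1\<close> has trace zero
  because \<open>t\<close> is a product of unipotent and constant matrices.  The covector \<open>c \<rho>\<close> solves the resulting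
  equation of one-forms, and it is the only solution, the coordinate change having surjective
  differential (\<open>glue_condition_iff\<close>).  Hence \<open>\<tau> = N M\<close> in every patch, where \<open>N = 1 + |z|\<^sup>2\<close> and
  \<open>M = |\<xi>|\<^sup>2 + |s - \<xi> z|\<^sup>2\<close> (\<open>tau_chart_eq\<close>).

  Differentiating along real lines identifies the matrix of components as
  \<open>f(\<tau>) H + f'(\<tau>) a a\<^sup>*\<close>, with \<open>a = \<partial>\<tau>\<close> and \<open>H\<close> the Levi form of \<open>\<tau>\<close> (\<open>g_components_eq\<close>).  Its
  determinant becomes accessible on completing squares.  In the direction \<open>(v, \<kappa>)\<close> put
  \<open>l = \<xi> - (s / N) z\<^sup>*\<close> and \<open>\<kappa>' = \<kappa> + (z\<^sup>* v / N) \<xi> + (l v / N) z\<^sup>*\<close>.  This shear has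
  determinant one, and

    \<open>H = M (|v|\<^sup>2 - |z\<^sup>* v|\<^sup>2 / N) + N (|\<kappa>'|\<^sup>2 + |\<kappa>' z|\<^sup>2) + |l v|\<^sup>2\<close>.

  The first two terms form a block diagonal matrix of determinant \<open>\<tau>\<^sup>n\<close>; the last one, and \<open>a a\<^sup>*\<close>,
  are dyads.  Sylvester's identity thus reduces the determinant to one of size two, whose value,
  with \<open>\<tau>\<^sub>0 = |s|\<^sup>2\<close>, is

    \<open>2 f' f\<^bsup>2n-1\<^esup> \<tau>\<^sup>n (\<tau> - \<tau>\<^sub>0) + f\<^bsup>2n\<^esup> \<tau>\<^bsup>n-1\<^esup> (2 \<tau> - \<tau>\<^sub>0)\<close>   (\<open>det_kaehler_matrix\<close>).

  So the determinant is a function of \<open>\<tau>\<close> alone.  By the Cauchy-Schwarz inequality and the points with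
  \<open>z = 0\<close>, \<open>\<tau>\<close> takes on each patch exactly the values \<open>\<ge> \<tau>\<^sub>0\<close>, whence the equivalence.
\<close>

section \<open>The frame at a point and the moment map\<close>

definition hom_vec :: "nat \<Rightarrow> complex vec \<Rightarrow> complex vec" where
  "hom_vec n z = vec (Suc n) (\<lambda>i. if i < n then z $ i else 1)"

text \<open>
  The last entry makes the pairing with \<open>hom_vec n z\<close> equal to \<open>s\<close>; the vector is \<open>s\<close> times the
  last row of the inverse of \<open>u_upper n z * u_lower n w\<close> for \<open>\<xi> = - s w\<close>, written without a division.
\<close>

definition cov_vec :: "nat \<Rightarrow> complex \<Rightarrow> complex vec \<Rightarrow> complex vec \<Rightarrow> complex vec" where
  "cov_vec n s z \<xi> = vec (Suc n) (\<lambda>i. if i < n then \<xi> $ i else s - (\<Sum>k<n. \<xi> $ k * z $ k))"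

definition real_orthogonal :: "nat \<Rightarrow> complex mat \<Rightarrow> bool" where
  "real_orthogonal m A \<longleftrightarrow> A \<in> carrier_mat m m \<and> A * transpose_mat A = 1\<^sub>m m
     \<and> transpose_mat A * A = 1\<^sub>m m \<and> (\<forall>i<m. \<forall>j<m. cnj (A $$ (i,j)) = A $$ (i,j))"

lemma hom_vec_carrier [simp]: "hom_vec n z \<in> carrier_vec (Suc n)" "dim_vec (hom_vec n z) = Suc n"
  by (simp_all add: hom_vec_def)

lemma cov_vec_carrier [simp]: "cov_vec n s z \<xi> \<in> carrier_vec (Suc n)" "dim_vec (cov_vec n s z \<xi>)
    = Suc n"
  by (simp_all add: cov_vec_def)

lemma mult_mat_index_sum:
  assumes "A \<in> carrier_mat m k" "B \<in> carrier_mat k l" "i < m" "j < l"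
  shows "(A * B) $$ (i,j) = (\<Sum>x<k. A $$ (i,x) * B $$ (x,j))"
  using assms by (simp add: scalar_prod_def lessThan_atLeast0)

lemma mult_mat_vec_index_sum:
  assumes "A \<in> carrier_mat m k" "v \<in> carrier_vec k" "i < m"
  shows "(A *\<^sub>v v) $ i = (\<Sum>x<k. A $$ (i,x) * v $ x)"
  using assms by (simp add: scalar_prod_def lessThan_atLeast0)

lemma cov_vec_hom_vec: "cov_vec n s z \<xi> \<bullet> hom_vec n z = s"
  by (simp add: scalar_prod_def cov_vec_def hom_vec_def lessThan_atLeast0[symmetric])

lemma u_upper_index:
  assumes "z \<in> carrier_vec n" "i < Suc n" "j < Suc n"
  shows "u_upper n z $$ (i,j) = (if i = j then 1 else if j = n then z $ i else 0)"
  using assms by (auto simp: u_upper_def mat_of_cols_def)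

lemma u_lower_index:
  assumes "w \<in> carrier_vec n" "i < Suc n" "j < Suc n"
  shows "u_lower n w $$ (i,j) = (if i = j then 1 else if i = n then w $ j else 0)"
  using assms by (auto simp: u_lower_def mat_of_rows_def)

lemma u_carrier [simp]: "u_upper n z \<in> carrier_mat (Suc n) (Suc n)" "u_lower n z \<in> carrier_mat (Suc
    n) (Suc n)"
  "dim_row (u_upper n z) = Suc n" "dim_col (u_upper n z) = Suc n"
  "dim_row (u_lower n z) = Suc n" "dim_col (u_lower n z) = Suc n"
  by (auto simp: u_upper_def u_lower_def)

lemma u_upper_inverse:
  assumes "z \<in> carrier_vec n" shows "u_upper n z * u_upper n (- z) = 1\<^sub>m (Suc n)"
proof (rule eq_matI, goal_cases)
  case (1 i j)
  then have ij: "i < Suc n" "j < Suc n" by auto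
  have "(u_upper n z * u_upper n (- z)) $$ (i,j)
    = (\<Sum>k<Suc n. (if i = k then 1 else if k = n then z $ i else 0) * (if k = j then 1 else if j
        = n then - z $ k else 0))"
    unfolding mult_mat_index_sum[OF u_carrier(1) u_carrier(1) ij]
    using ij assms by (intro sum.cong) (auto simp: u_upper_index)
  also have "\<dots> = (if i = j then 1 else 0)"
  proof -
    have *: "(\<Sum>k<n. (if i = k then 1 else 0) * (if k = j then 1 else if j = n then - z $ k else 0))
      = (if i < n then (if i = j then 1 else if j = n then - z $ i else 0) else 0)"
      by (simp add: if_distrib[of "\<lambda>x. x * _"] cong: if_cong)
    have "(\<Sum>k<n. (if i = k then 1 else if k = n then z $ i else 0) * (if k = j then 1 else if j
        = n then - z $ k else 0))
      = (\<Sum>k<n. (if i = k then 1 else 0) * (if k = j then 1 else if j = n then - z $ k else 0))"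
      by (intro sum.cong) auto
    then show ?thesis
      using ij * by auto
  qed
  finally show ?case using ij by simp
qed auto

lemma u_lower_inverse:
  assumes "w \<in> carrier_vec n" shows "u_lower n w * u_lower n (- w) = 1\<^sub>m (Suc n)"
proof (rule eq_matI, goal_cases)
  case (1 i j)
  then have ij: "i < Suc n" "j < Suc n" by auto
  have "(u_lower n w * u_lower n (- w)) $$ (i,j)
    = (\<Sum>k<Suc n. (if i = k then 1 else if i = n then w $ k else 0) * (if k = j then 1 else if k
        = n then - w $ j else 0))"
    unfolding mult_mat_index_sum[OF u_carrier(2) u_carrier(2) ij]
    using ij assms by (intro sum.cong) (auto simp: u_lower_index)
  also have "\<dots> = (if i = j then 1 else 0)"
  proof -
    have *: "(\<Sum>k<n. (if i = k then 1 else if i = n then w $ k else 0) * (if k = j then 1 else 0))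
      = (if j < n then (if i = j then 1 else if i = n then w $ j else 0) else 0)"
      by (simp add: if_distrib[of "\<lambda>x. _ * x"] cong: if_cong)
    have "(\<Sum>k<n. (if i = k then 1 else if i = n then w $ k else 0) * (if k = j then 1 else if k
        = n then - w $ j else 0))
      = (\<Sum>k<n. (if i = k then 1 else if i = n then w $ k else 0) * (if k = j then 1 else 0))"
      by (intro sum.cong) auto
    then show ?thesis
      using ij * by auto
  qed
  finally show ?case using ij by simp
qed auto

lemma det_u:
  "Determinant.det (u_upper n z) = 1" "Determinant.det (u_lower n z) = 1"
  unfolding u_upper_def u_lower_def
  by (simp_all add: mat_of_cols_def mat_of_rows_def det_four_block_mat_lower_left_zero[of _ n _ "Suc
      0"] det_four_block_mat_upper_right_zero[of _ n _ "Suc 0"])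

lemma minv_eqI:
  assumes X: "X \<in> carrier_mat m m" and Y: "Y \<in> carrier_mat m m" and XY: "X * Y = 1\<^sub>m m"
  shows "minv X = Y"
proof (cases "mat_inverse X")
  case None
  have "Y * X = 1\<^sub>m m" using mat_mult_left_right_inverse[OF X Y XY] .
  then have "X \<in> Units (ring_mat TYPE(complex) m ())"
    using X Y XY unfolding Units_def ring_mat_def by auto
  then show ?thesis using mat_inverse(1)[OF X None, of "()"] by blast
next
  case (Some B)
  from mat_inverse(2)[OF X Some] have B: "B * X = 1\<^sub>m m" "B \<in> carrier_mat m m" by auto
  have "B = B * (X * Y)" using B XY by simp
  also have "\<dots> = Y" using B X Y by (simp add: assoc_mult_mat[of _ m m _ m _ m, symmetric])
  finally show ?thesis by (simp add: minv_def Some)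
qed

definition h_inv :: "nat \<Rightarrow> complex \<Rightarrow> complex mat \<Rightarrow> complex vec \<Rightarrow> complex vec \<Rightarrow> complex mat" where
  "h_inv n s A z \<xi> = u_lower n (- w_of s \<xi>) * u_upper n (- z) * transpose_mat A"

lemma w_of_carrier [simp]: "w_of s \<xi> \<in> carrier_vec n \<longleftrightarrow> \<xi> \<in> carrier_vec n"
  by (simp add: w_of_def)

lemma u_upper_unit:
  assumes "z \<in> carrier_vec n"
  shows "u_upper n z *\<^sub>v unit_vec (Suc n) n = hom_vec n z"
proof (rule eq_vecI)
  fix i assume "i < dim_vec (hom_vec n z)"
  then have i: "i < Suc n" by simp
  then have "(u_upper n z *\<^sub>v unit_vec (Suc n) n) $ i = u_upper n z $$ (i, n)"
    by simp
  also have "\<dots> = hom_vec n z $ i"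
    using i assms by (auto simp: u_upper_index hom_vec_def)
  finally show "(u_upper n z *\<^sub>v unit_vec (Suc n) n) $ i = hom_vec n z $ i" .
qed simp

lemma lam_mat_index:
  fixes s :: complex
  assumes "i < Suc n" "j < Suc n"
  shows "lam_mat n s $$ (i,j) = (if i = j then s / (1 + of_nat n) else 0) - (if i = n \<and> j
      = n then s else 0)"
proof -
  have "(1 + of_nat n :: complex) \<noteq> 0" by (metis of_nat_Suc of_nat_neq_0)
  then have "s / (1 + of_nat n) * (- of_nat n) = s / (1 + of_nat n) - s"
    by (simp add: divide_simps del: of_nat_Suc) (simp add: algebra_simps)
  then show ?thesis using assms by (auto simp: lam_mat_def)
qed

lemma lam_mat_carrier: "lam_mat n s \<in> carrier_mat (Suc n) (Suc n)"
  unfolding lam_mat_def by (intro smult_carrier_mat) (metis Suc_eq_plus1 four_block_carrier_mat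
      one_carrier_mat smult_carrier_mat)

context
  fixes n :: nat and s :: complex and \<sigma> :: "nat \<Rightarrow> complex mat" and \<alpha> :: nat
  assumes s: "s \<noteq> 0" and ortho: "real_orthogonal (Suc n) (\<sigma> \<alpha>)"
begin

lemma sigma_carrier: "\<sigma> \<alpha> \<in> carrier_mat (Suc n) (Suc n)" "transpose_mat (\<sigma> \<alpha>) \<in> carrier_mat (Suc n)
    (Suc n)"
  using ortho by (simp_all add: real_orthogonal_def)

lemma h_carrier:
  "h_mat n s \<sigma> \<alpha> z \<xi> \<in> carrier_mat (Suc n) (Suc n)" "h_inv n s (\<sigma> \<alpha>) z \<xi> \<in> carrier_mat (Suc n) (Suc n)"
  unfolding h_mat_def h_inv_def
  by (intro mult_carrier_mat[of _ _ "Suc n"] sigma_carrier u_carrier)+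

lemma h_mult_inv:
  assumes "z \<in> carrier_vec n" "\<xi> \<in> carrier_vec n"
  shows "h_mat n s \<sigma> \<alpha> z \<xi> * h_inv n s (\<sigma> \<alpha>) z \<xi> = 1\<^sub>m (Suc n)"
    and "h_inv n s (\<sigma> \<alpha>) z \<xi> * h_mat n s \<sigma> \<alpha> z \<xi> = 1\<^sub>m (Suc n)"
proof -
  let ?S = "\<sigma> \<alpha>" and ?U = "u_upper n z" and ?V = "u_upper n (- z)"
  let ?L = "u_lower n (w_of s \<xi>)" and ?K = "u_lower n (- w_of s \<xi>)"
  note [simp] = sigma_carrier
  note [simp] = mult_carrier_mat[of _ "Suc n" "Suc n" _ "Suc n"]
  note assoc = assoc_mult_mat[of _ "Suc n" "Suc n" _ "Suc n" _ "Suc n"]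
  have "h_mat n s \<sigma> \<alpha> z \<xi> * h_inv n s ?S z \<xi> = ?S * (?U * ((?L * ?K) * ?V)) * transpose_mat ?S"
    unfolding h_mat_def h_inv_def by (simp add: assoc)
  also have "\<dots> = ?S * (?U * ?V) * transpose_mat ?S"
    using assms by (simp add: u_lower_inverse left_mult_one_mat[of _ "Suc n" "Suc n"])
  also have "\<dots> = 1\<^sub>m (Suc n)"
    using assms ortho by (simp add: u_upper_inverse right_mult_one_mat[of _ "Suc n" "Suc n"]
        real_orthogonal_def)
  finally show 1: "h_mat n s \<sigma> \<alpha> z \<xi> * h_inv n s ?S z \<xi> = 1\<^sub>m (Suc n)" .
  show "h_inv n s ?S z \<xi> * h_mat n s \<sigma> \<alpha> z \<xi> = 1\<^sub>m (Suc n)"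
    by (rule mat_mult_left_right_inverse[OF h_carrier 1])
qed

lemma minv_h:
  assumes "z \<in> carrier_vec n" "\<xi> \<in> carrier_vec n"
  shows "minv (h_mat n s \<sigma> \<alpha> z \<xi>) = h_inv n s (\<sigma> \<alpha>) z \<xi>"
  by (rule minv_eqI[OF h_carrier h_mult_inv(1)[OF assms]])

lemma h_last_column:
  assumes "z \<in> carrier_vec n" "\<xi> \<in> carrier_vec n" "i < Suc n"
  shows "h_mat n s \<sigma> \<alpha> z \<xi> $$ (i,n) = (\<sigma> \<alpha> *\<^sub>v hom_vec n z) $ i"
proof -
  note [simp] = sigma_carrier mult_carrier_mat[of _ "Suc n" "Suc n" _ "Suc n"]
  have e: "u_lower n (w_of s \<xi>) *\<^sub>v unit_vec (Suc n) n = unit_vec (Suc n) n"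
  proof (rule eq_vecI)
    fix i assume "i < dim_vec (unit_vec (Suc n) n :: complex vec)"
    then have i: "i < Suc n" by simp
    then have "(u_lower n (w_of s \<xi>) *\<^sub>v unit_vec (Suc n) n) $ i = u_lower n (w_of s \<xi>) $$ (i, n)"
      by simp
    then show "(u_lower n (w_of s \<xi>) *\<^sub>v unit_vec (Suc n) n) $ i = unit_vec (Suc n) n $ i"
      using i assms by (simp add: u_lower_index)
  qed simp
  have "h_mat n s \<sigma> \<alpha> z \<xi> $$ (i,n) = (h_mat n s \<sigma> \<alpha> z \<xi> *\<^sub>v unit_vec (Suc n) n) $ i"
    using assms h_carrier(1)[of z \<xi>] by simp
  also have "h_mat n s \<sigma> \<alpha> z \<xi> *\<^sub>v unit_vec (Suc n) n = \<sigma> \<alpha> *\<^sub>v (u_upper n z *\<^sub>v unit_vec (Suc n) n)"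
    unfolding h_mat_def by (simp add: assoc_mult_mat_vec[of _ "Suc n" "Suc n" _ "Suc n"] e)
  finally show ?thesis using assms by (simp add: u_upper_unit)
qed

lemma h_inv_last_row:
  assumes "z \<in> carrier_vec n" "\<xi> \<in> carrier_vec n" "j < Suc n"
  shows "s * h_inv n s (\<sigma> \<alpha>) z \<xi> $$ (n,j) = (\<sigma> \<alpha> *\<^sub>v cov_vec n s z \<xi>) $ j"
proof -
  note [simp] = sigma_carrier
  let ?M = "u_lower n (- w_of s \<xi>) * u_upper n (- z)"
  have M: "s * ?M $$ (n,k) = cov_vec n s z \<xi> $ k" if k: "k < Suc n" for k
  proof -
    have w: "- w_of s \<xi> \<in> carrier_vec n" "- z \<in> carrier_vec n" using assms by auto
    have "?M $$ (n,k) = (\<Sum>l<Suc n. u_lower n (- w_of s \<xi>) $$ (n,l) * u_upper n (- z) $$ (l,k))"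
      by (rule mult_mat_index_sum[OF u_carrier(2) u_carrier(1)]) (use k in auto)
    also have "\<dots> = (\<Sum>l<n. \<xi> $ l / s * (if l = k then 1 else if k = n then - z $ l else 0)) + (if k
        = n then 1 else 0)"
    proof -
      have "(- w_of s \<xi>) $ l = \<xi> $ l / s" if "l < n" for l
        using that assms by (simp add: w_of_def)
      then show ?thesis
        unfolding sum.lessThan_Suc
        using assms k by (intro arg_cong2[of _ _ _ _ "(+)"] sum.cong)
          (auto simp: u_lower_index[OF w(1)] u_upper_index[OF w(2)])
    qed
    also have "s * \<dots> = cov_vec n s z \<xi> $ k"
    proof (cases "k = n")
      case True
      then show ?thesis using s
        by (simp add: cov_vec_def right_diff_distrib sum_distrib_left sum_negf)
    next
      case False
      then have "(\<Sum>l<n. \<xi> $ l / s * (if l = k then 1 else if k = n then - z $ l else 0)) = \<xi> $ k / s"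
        using k by (simp add: if_distrib[of "\<lambda>x. _ * x"] cong: if_cong)
      then show ?thesis using False k s by (simp add: cov_vec_def)
    qed
    finally show ?thesis .
  qed
  have "h_inv n s (\<sigma> \<alpha>) z \<xi> $$ (n,j) = (\<Sum>k<Suc n. ?M $$ (n,k) * \<sigma> \<alpha> $$ (j,k))"
    unfolding h_inv_def
    unfolding mult_mat_index_sum[OF mult_carrier_mat[OF u_carrier(2) u_carrier(1)] sigma_carrier(2)
        lessI assms(3)]
    by (intro sum.cong refl arg_cong2[of _ _ _ _ "(*)"]) (use assms(3) carrier_matD[OF
        sigma_carrier(1)] in auto)
  then have "s * h_inv n s (\<sigma> \<alpha>) z \<xi> $$ (n,j) = (\<Sum>k<Suc n. (s * ?M $$ (n,k)) * \<sigma> \<alpha> $$ (j,k))"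
    by (simp only: sum_distrib_left mult.assoc)
  also have "\<dots> = (\<Sum>k<Suc n. cov_vec n s z \<xi> $ k * \<sigma> \<alpha> $$ (j,k))"
    by (intro sum.cong refl arg_cong2[of _ _ _ _ "(*)"] M) simp
  also have "\<dots> = (\<sigma> \<alpha> *\<^sub>v cov_vec n s z \<xi>) $ j"
    using assms(3) by (simp add: mult_mat_vec_index_sum[OF sigma_carrier(1)] mult.commute)
  finally show ?thesis .
qed

text \<open>
  \<open>lam_mat\<close> is \<open>s / (n + 1)\<close> times the identity minus \<open>s\<close> at the corner, so conjugating it by \<open>h\<close>
  leaves the scalar alone and turns the corner into the dyad of the last column of \<open>h\<close> and the last
  row of its inverse.
\<close>

lemma mu_rank_one:
  assumes "z \<in> carrier_vec n" "\<xi> \<in> carrier_vec n"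
  shows "h_mat n s \<sigma> \<alpha> z \<xi> * lam_mat n s * minv (h_mat n s \<sigma> \<alpha> z \<xi>) =
    mat (Suc n) (Suc n) (\<lambda>(i,j). (if i = j then s / (1 + of_nat n) else 0)
       - (\<sigma> \<alpha> *\<^sub>v hom_vec n z) $ i * (\<sigma> \<alpha> *\<^sub>v cov_vec n s z \<xi>) $ j)"
    (is "?H * _ * _ = ?R")
proof (rule eq_matI, goal_cases)
  case (1 i j)
  then have ij: "i < Suc n" "j < Suc n" by auto
  let ?G = "h_inv n s (\<sigma> \<alpha>) z \<xi>"
  note hc = h_carrier[of z \<xi>]
  have HL: "(?H * lam_mat n s) $$ (i,k) = ?H $$ (i,k) * (s / (1 + of_nat n)) - (if k = n then s
      * ?H $$ (i,n) else 0)"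
    if "k < Suc n" for k
  proof -
    have "(?H * lam_mat n s) $$ (i,k) = (\<Sum>l<Suc n. ?H $$ (i,l) * lam_mat n s $$ (l,k))"
      by (rule mult_mat_index_sum[OF hc(1) lam_mat_carrier ij(1) that])
    also have "\<dots> = (\<Sum>l<Suc n. (if l = k then ?H $$ (i,l) * (s / (1 + of_nat n)) else 0) - (if l
        = n then (if k = n then s * ?H $$ (i,n) else 0) else 0))"
      using that by (intro sum.cong) (auto simp: lam_mat_index algebra_simps simp del: of_nat_Suc
          of_nat_add)
    also have "\<dots> = ?H $$ (i,k) * (s / (1 + of_nat n)) - (if k = n then s * ?H $$ (i,n) else 0)"
      using that by (simp add: sum_subtractf del: sum.lessThan_Suc of_nat_Suc of_nat_add)
    finally show ?thesis .
  qed
  have "(?H * lam_mat n s * ?G) $$ (i,j) = (\<Sum>k<Suc n. (?H * lam_mat n s) $$ (i,k) * ?G $$ (k,j))"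
    by (rule mult_mat_index_sum[OF mult_carrier_mat[OF hc(1) lam_mat_carrier] hc(2) ij])
  also have "\<dots> = (\<Sum>k<Suc n. s / (1 + of_nat n) * (?H $$ (i,k) * ?G $$ (k,j)) - (if k = n then s
      * ?H $$ (i,n) * ?G $$ (n,j) else 0))"
    by (intro sum.cong) (auto simp: HL algebra_simps simp del: of_nat_Suc of_nat_add)
  also have "\<dots> = s / (1 + of_nat n) * (?H * ?G) $$ (i,j) - ?H $$ (i,n) * (s * ?G $$ (n,j))"
    unfolding mult_mat_index_sum[OF hc ij] by (simp add: sum_subtractf sum_distrib_left
        sum_divide_distrib add_divide_distrib distrib_left)
  also have "\<dots> = ?R $$ (i,j)"
    using ij assms by (simp add: h_mult_inv h_last_column h_inv_last_row)
  finally show ?case using assms by (simp add: minv_h)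
qed (use h_carrier[of z \<xi>] in \<open>auto simp: minv_h[OF assms]\<close>)

end

section \<open>Signed cyclic permutation matrices\<close>

text \<open>
  The third statement recovers the coordinate that does not vanish on \<open>U\<^sub>\<alpha>\<close>: the last column of
  \<open>\<sigma>\<^sub>\<alpha>\<close> is plus or minus the basis vector with index \<open>\<alpha>\<close>.
\<close>

lemma cyclic_signed_perm:
  assumes "cyclic_signed_perms n \<sigma>" "\<alpha> \<le> n"
  shows "real_orthogonal (Suc n) (\<sigma> \<alpha>)" "Determinant.det (\<sigma> \<alpha>) = 1"
    and "\<exists>\<epsilon>. \<epsilon> \<noteq> 0 \<and> (\<forall>y\<in>carrier_vec (Suc n). (transpose_mat (\<sigma> \<alpha>) *\<^sub>v y) $ n = \<epsilon> * y $ \<alpha>)"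
proof -
  from assms obtain \<epsilon> where e: "\<forall>j\<le>n. \<epsilon> j \<in> {1, -1}"
    and S: "\<sigma> \<alpha> = mat (Suc n) (Suc n) (\<lambda>(i,j). if i = cyc n \<alpha> j then \<epsilon> j else 0)"
    and det: "Determinant.det (\<sigma> \<alpha>) = 1"
    unfolding cyclic_signed_perms_def by auto
  have S': "\<sigma> \<alpha> \<in> carrier_mat (Suc n) (Suc n)" unfolding S by simp
  have T': "transpose_mat (\<sigma> \<alpha>) \<in> carrier_mat (Suc n) (Suc n)" using S' by simp
  have inj: "cyc n \<alpha> i = cyc n \<alpha> j \<longleftrightarrow> i = j" if "i < Suc n" "j < Suc n" for i j
    using that assms(2) by (auto simp: cyc_def split: if_splits)
  have lt: "cyc n \<alpha> i < Suc n" if "i < Suc n" for i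
    using that assms(2) by (auto simp: cyc_def split: if_splits)
  have 1: "transpose_mat (\<sigma> \<alpha>) * \<sigma> \<alpha> = 1\<^sub>m (Suc n)"
  proof (rule eq_matI, goal_cases)
    case (1 i j)
    then have ij: "i < Suc n" "j < Suc n" by auto
    have "(transpose_mat (\<sigma> \<alpha>) * \<sigma> \<alpha>) $$ (i,j) = (\<Sum>k<Suc n. transpose_mat (\<sigma> \<alpha>) $$ (i,k)
        * \<sigma> \<alpha> $$ (k,j))"
      by (rule mult_mat_index_sum[OF T' S' ij])
    also have "\<dots> = (\<Sum>k<Suc n. if k = cyc n \<alpha> i then (if i = j then \<epsilon> i * \<epsilon> i else 0) else 0)"
      using ij inj[OF ij] by (intro sum.cong) (auto simp: S)
    also have "\<dots> = (if i = j then 1 else 0)"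
      using ij lt[OF ij(1)] e[rule_format, of i] by (auto simp del: sum.lessThan_Suc)
    finally show ?case using ij by simp
  qed (use S' in auto)
  moreover have "\<sigma> \<alpha> * transpose_mat (\<sigma> \<alpha>) = 1\<^sub>m (Suc n)"
    by (rule mat_mult_left_right_inverse[OF T' S' 1])
  moreover have "cnj (\<epsilon> j) = \<epsilon> j" if "j < Suc n" for j
    using e that by (auto dest!: spec[of _ j])
  then have "\<forall>i<Suc n. \<forall>j<Suc n. cnj (\<sigma> \<alpha> $$ (i,j)) = \<sigma> \<alpha> $$ (i,j)"
    by (auto simp: S)
  ultimately show "real_orthogonal (Suc n) (\<sigma> \<alpha>)"
    using S' by (simp add: real_orthogonal_def)
  show "Determinant.det (\<sigma> \<alpha>) = 1" by (rule det)
  have "(transpose_mat (\<sigma> \<alpha>) *\<^sub>v y) $ n = \<epsilon> n * y $ \<alpha>" if y: "y \<in> carrier_vec (Suc n)" for y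
  proof -
    have "(transpose_mat (\<sigma> \<alpha>) *\<^sub>v y) $ n = (\<Sum>k<Suc n. transpose_mat (\<sigma> \<alpha>) $$ (n,k) * y $ k)"
      by (rule mult_mat_vec_index_sum[OF T' y]) simp
    also have "\<dots> = (\<Sum>k<Suc n. if k = \<alpha> then \<epsilon> n * y $ \<alpha> else 0)"
      using assms(2) by (intro sum.cong) (auto simp: S cyc_def)
    finally show ?thesis using assms(2) by (simp del: sum.lessThan_Suc)
  qed
  moreover have "\<epsilon> n \<noteq> 0" using e by (auto dest!: spec[of _ n])
  ultimately show "\<exists>\<epsilon>. \<epsilon> \<noteq> 0 \<and> (\<forall>y\<in>carrier_vec (Suc n). (transpose_mat (\<sigma> \<alpha>) *\<^sub>v y) $ n = \<epsilon> * y $ \<alpha>)"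
    by blast
qed

section \<open>Matrix curves with trace-free logarithmic derivative\<close>

text \<open>
  A curve of matrices, invertible and differentiable at 0, whose logarithmic derivative there has
  trace zero.  This is the infinitesimal form of having constant determinant, and it is established for
  products directly from the product rule, without differentiating a determinant.
\<close>

definition unimodular_curve :: "nat \<Rightarrow> (complex \<Rightarrow> complex mat) \<Rightarrow> bool" where
  "unimodular_curve m F \<longleftrightarrow> (\<forall>h. F h \<in> carrier_mat m m) \<and>
    (\<exists>F' G. F' \<in> carrier_mat m m \<and> G \<in> carrier_mat m m \<and> F 0 * G = 1\<^sub>m m \<and> mat_trace (F' * G) = 0 \<and>
      (\<forall>i<m. \<forall>j<m. ((\<lambda>h. F h $$ (i,j)) has_field_derivative F' $$ (i,j)) (at 0)))"

lemma mat_trace_mult_sum: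
  assumes "X \<in> carrier_mat m k" "Y \<in> carrier_mat k m"
  shows "mat_trace (X * Y) = (\<Sum>i<m. \<Sum>j<k. X $$ (i,j) * Y $$ (j,i))"
  using assms unfolding mat_trace_def by (auto intro!: sum.cong simp: mult_mat_index_sum[OF assms]
      simp del: index_mult_mat(1))

lemma mat_trace_mult_commute:
  fixes X Y :: "'a::comm_ring_1 mat"
  assumes "X \<in> carrier_mat m k" "Y \<in> carrier_mat k m"
  shows "mat_trace (X * Y) = mat_trace (Y * X)"
  unfolding mat_trace_mult_sum[OF assms] mat_trace_mult_sum[OF assms(2,1)]
  by (subst sum.swap) (simp add: mult.commute)

lemma mat_trace_add:
  assumes "X \<in> carrier_mat m m" "Y \<in> carrier_mat m m"
  shows "mat_trace (X + Y) = mat_trace X + mat_trace Y"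
  using assms by (simp add: mat_trace_def sum.distrib)

text \<open>
  The trace of \<open>(F' K + F K') (F K)\<^sup>-\<^sup>1\<close> splits into those of \<open>F' F\<^sup>-\<^sup>1\<close> and of
  \<open>F (K' K\<^sup>-\<^sup>1) F\<^sup>-\<^sup>1\<close>, and the latter is invariant under conjugation.
\<close>

lemma unimodular_curve_mult:
  assumes "unimodular_curve m F" "unimodular_curve m K"
  shows "unimodular_curve m (\<lambda>h. F h * K h)"
proof -
  from assms obtain F' G K' J where FK: "\<And>h. F h \<in> carrier_mat m m" "\<And>h. K h \<in> carrier_mat m m"
    and c: "F' \<in> carrier_mat m m" "G \<in> carrier_mat m m" "K' \<in> carrier_mat m m" "J \<in> carrier_mat m m"
    and inv: "F 0 * G = 1\<^sub>m m" "K 0 * J = 1\<^sub>m m"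
    and tr: "mat_trace (F' * G) = 0" "mat_trace (K' * J) = 0"
    and der: "\<And>i j. i < m \<Longrightarrow> j < m \<Longrightarrow> ((\<lambda>h. F h $$ (i,j)) has_field_derivative F' $$ (i,j)) (at 0)"
      "\<And>i j. i < m \<Longrightarrow> j < m \<Longrightarrow> ((\<lambda>h. K h $$ (i,j)) has_field_derivative K' $$ (i,j)) (at 0)"
    unfolding unimodular_curve_def by metis
  note assoc = assoc_mult_mat[of _ m m _ m _ m]
  note [simp] = mult_carrier_mat[of _ m m _ m]
  have GF: "G * F 0 = 1\<^sub>m m" by (rule mat_mult_left_right_inverse[OF FK(1) c(2) inv(1)])
  have "F 0 * K 0 * (J * G) = F 0 * ((K 0 * J) * G)"
    using FK c by (simp add: assoc)
  also have "\<dots> = 1\<^sub>m m" using inv c FK by simp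
  finally have inv': "F 0 * K 0 * (J * G) = 1\<^sub>m m" .
  have "mat_trace ((F' * K 0 + F 0 * K') * (J * G)) = mat_trace (F' * ((K 0 * J) * G))
      + mat_trace (F 0 * (K' * J * G))"
    using FK c by (simp add: add_mult_distrib_mat[of _ m m _ _ m] mat_trace_add[of _ m] assoc)
  also have "mat_trace (F' * ((K 0 * J) * G)) = 0"
    using inv c tr by simp
  also have "mat_trace (F 0 * (K' * J * G)) = mat_trace (K' * J * (G * F 0))"
    using FK c by (subst mat_trace_mult_commute[of _ m m]) (simp_all add: assoc)
  also have "\<dots> = 0" using GF c tr by simp
  finally have tr': "mat_trace ((F' * K 0 + F 0 * K') * (J * G)) = 0" by simp
  have der': "((\<lambda>h. (F h * K h) $$ (i,j)) has_field_derivative (F' * K 0 + F 0 * K') $$ (i,j)) (at 0)"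
    if ij: "i < m" "j < m" for i j
  proof -
    have "((\<lambda>h. \<Sum>k<m. F h $$ (i,k) * K h $$ (k,j)) has_field_derivative
        (\<Sum>k<m. F' $$ (i,k) * K 0 $$ (k,j) + K' $$ (k,j) * F 0 $$ (i,k))) (at 0)"
      using ij by (intro DERIV_sum DERIV_mult der) auto
    also have "(\<Sum>k<m. F' $$ (i,k) * K 0 $$ (k,j) + K' $$ (k,j) * F 0 $$ (i,k)) = (F' * K 0 + F 0
        * K') $$ (i,j)"
    proof -
      have "(F' * K 0 + F 0 * K') $$ (i,j) = (F' * K 0) $$ (i,j) + (F 0 * K') $$ (i,j)"
        using ij FK(1)[of 0] c by (intro index_add_mat) auto
      then show ?thesis
        by (simp only: mult_mat_index_sum[OF c(1) FK(2) ij] mult_mat_index_sum[OF FK(1) c(3) ij]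
            sum.distrib mult.commute[of "K' $$ _"])
    qed
    finally show ?thesis
      by (simp only: mult_mat_index_sum[OF FK ij])
  qed
  show ?thesis
    unfolding unimodular_curve_def
    by (intro conjI allI exI[of _ "F' * K 0 + F 0 * K'"] exI[of _ "J * G"] impI der' inv' tr')
      (use FK c in auto)
qed

lemma unimodular_curve_const:
  assumes "A \<in> carrier_mat m m" "B \<in> carrier_mat m m" "A * B = 1\<^sub>m m"
  shows "unimodular_curve m (\<lambda>h. A)"
  unfolding unimodular_curve_def
  by (intro conjI allI exI[of _ "0\<^sub>m m m"] exI[of _ B] impI)
    (use assms in \<open>auto simp: mat_trace_def\<close>)

text \<open>
  The derivative lives in the last column above the corner, and the last row of the inverse vanishes
  off the corner, so their product is strictly triangular.
\<close>

lemma unimodular_curve_u_upper: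
  assumes "\<And>h. x h \<in> carrier_vec n" "\<And>i. i < n \<Longrightarrow> (\<lambda>h. x h $ i) field_differentiable (at 0)"
  shows "unimodular_curve (Suc n) (\<lambda>h. u_upper n (x h))"
proof -
  from assms(2) obtain x' where x': "\<And>i. i < n \<Longrightarrow> ((\<lambda>h. x h $ i) has_field_derivative x' i) (at 0)"
    unfolding field_differentiable_def by metis
  let ?F' = "mat (Suc n) (Suc n) (\<lambda>(i,j). if j = n \<and> i < n then x' i else 0)"
  have "((\<lambda>h. u_upper n (x h) $$ (i,j)) has_field_derivative ?F' $$ (i,j)) (at 0)"
    if "i < Suc n" "j < Suc n" for i j
    unfolding u_upper_index[OF assms(1) that]
    using that x'[of i] by (cases "i = j"; cases "j = n") (auto simp: less_Suc_eq)
  moreover have "mat_trace (?F' * u_upper n (- x 0)) = 0"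
    using assms(1)[of 0] by (subst mat_trace_mult_sum[of _ "Suc n" "Suc n"])
      (auto simp: u_upper_index intro!: sum.neutral)
  ultimately show ?thesis
    unfolding unimodular_curve_def
    by (intro conjI allI exI[of _ ?F'] exI[of _ "u_upper n (- x 0)"] impI)
      (use assms(1)[of 0] u_upper_inverse in auto)
qed

lemma unimodular_curve_u_lower:
  assumes "\<And>h. x h \<in> carrier_vec n" "\<And>i. i < n \<Longrightarrow> (\<lambda>h. x h $ i) field_differentiable (at 0)"
  shows "unimodular_curve (Suc n) (\<lambda>h. u_lower n (x h))"
proof -
  from assms(2) obtain x' where x': "\<And>i. i < n \<Longrightarrow> ((\<lambda>h. x h $ i) has_field_derivative x' i) (at 0)"
    unfolding field_differentiable_def by metis
  let ?F' = "mat (Suc n) (Suc n) (\<lambda>(i,j). if i = n \<and> j < n then x' j else 0)"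
  have "((\<lambda>h. u_lower n (x h) $$ (i,j)) has_field_derivative ?F' $$ (i,j)) (at 0)"
    if "i < Suc n" "j < Suc n" for i j
    unfolding u_lower_index[OF assms(1) that]
    using that x'[of j] by (cases "i = j"; cases "i = n") (auto simp: less_Suc_eq)
  moreover have "mat_trace (?F' * u_lower n (- x 0)) = 0"
    using assms(1)[of 0] by (subst mat_trace_mult_sum[of _ "Suc n" "Suc n"])
      (auto simp: u_lower_index intro!: sum.neutral)
  ultimately show ?thesis
    unfolding unimodular_curve_def
    by (intro conjI allI exI[of _ ?F'] exI[of _ "u_lower n (- x 0)"] impI)
      (use assms(1)[of 0] u_lower_inverse in auto)
qed

section \<open>Change of patch\<close>

lemma proj_pt_smult:
  assumes "c \<noteq> 0" shows "proj_pt (c \<cdot>\<^sub>v y) = proj_pt y"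
proof -
  have "\<exists>d'. d \<cdot>\<^sub>v (c \<cdot>\<^sub>v y) = d' \<cdot>\<^sub>v y \<and> d' \<noteq> 0" if "d \<noteq> 0" for d
    using that assms by (intro exI[of _ "d * c"]) (auto simp: smult_smult_assoc)
  moreover have "\<exists>d'. d \<cdot>\<^sub>v y = d' \<cdot>\<^sub>v (c \<cdot>\<^sub>v y) \<and> d' \<noteq> 0" if "d \<noteq> 0" for d
    using that assms by (intro exI[of _ "d / c"]) (auto simp: smult_smult_assoc)
  ultimately show ?thesis unfolding proj_pt_def by auto
qed

lemma proj_pt_eqD:
  assumes "proj_pt y = proj_pt y'" shows "\<exists>c. c \<noteq> 0 \<and> y = c \<cdot>\<^sub>v y'"
proof -
  have "y \<in> proj_pt y" unfolding proj_pt_def by (simp, rule exI[of _ 1], simp)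
  then show ?thesis using assms unfolding proj_pt_def by auto
qed

text \<open>
  The tangent vector at \<open>hom_vec n z\<close> of the affine chart in direction \<open>v\<close>.
\<close>

definition tan_vec :: "nat \<Rightarrow> complex vec \<Rightarrow> complex vec" where
  "tan_vec n v = vec (Suc n) (\<lambda>i. if i < n then v $ i else 0)"

lemma tan_vec_carrier [simp]: "tan_vec n v \<in> carrier_vec (Suc n)" "dim_vec (tan_vec n v) = Suc n"
  by (simp_all add: tan_vec_def)

lemma hom_vec_index: "i < n \<Longrightarrow> hom_vec n z $ i = z $ i" "hom_vec n z $ n = 1"
  by (simp_all add: hom_vec_def)

lemma cov_vec_index: "i < n \<Longrightarrow> cov_vec n s z \<xi> $ i = \<xi> $ i"
    "cov_vec n s z \<xi> $ n = s - (\<Sum>k<n. \<xi> $ k * z $ k)"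
  by (simp_all add: cov_vec_def)

lemma tan_vec_index: "i < n \<Longrightarrow> tan_vec n v $ i = v $ i" "tan_vec n v $ n = 0"
  by (simp_all add: tan_vec_def)

lemma hom_vec_line:
  assumes "z \<in> carrier_vec n" "v \<in> carrier_vec n"
  shows "hom_vec n (z + h \<cdot>\<^sub>v v) = hom_vec n z + h \<cdot>\<^sub>v tan_vec n v"
proof (rule eq_vecI)
  fix i assume "i < dim_vec (hom_vec n z + h \<cdot>\<^sub>v tan_vec n v)"
  then show "hom_vec n (z + h \<cdot>\<^sub>v v) $ i = (hom_vec n z + h \<cdot>\<^sub>v tan_vec n v) $ i"
    using assms by (simp add: hom_vec_def tan_vec_def)
qed simp

lemma L_groupI:
  assumes "t \<in> carrier_mat (Suc n) (Suc n)" "\<And>i. i < n \<Longrightarrow> t $$ (i,n) = 0" "\<And>j. j < n \<Longrightarrow> t $$ (n,j) = 0"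
    "Determinant.det t = 1"
  shows "t \<in> L_group n"
proof -
  let ?a = "mat n n (\<lambda>ij. t $$ ij)" and ?d = "mat 1 1 (\<lambda>_. t $$ (n,n))"
  have t: "t = four_block_mat ?a (0\<^sub>m n 1) (0\<^sub>m 1 n) ?d"
  proof (rule eq_matI, goal_cases)
    case (1 i j)
    then have "i < n \<or> i = n" "j < n \<or> j = n" by auto
    then show ?case using assms by auto
  qed (use assms in auto)
  have "Determinant.det (four_block_mat ?a (0\<^sub>m n 1) (0\<^sub>m 1 n) ?d) = 1"
    using assms(4) unfolding t[symmetric] .
  then show ?thesis
    unfolding L_group_def by (intro CollectI exI[of _ ?a] exI[of _ ?d] conjI t mat_carrier)
qed

lemma L_groupD:
  assumes "t \<in> L_group n"
  shows "t \<in> carrier_mat (Suc n) (Suc n)" "\<And>i. i < n \<Longrightarrow> t $$ (i,n) = 0" "\<And>j. j < n \<Longrightarrow> t $$ (n,j) = 0"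
  using assms unfolding L_group_def by auto

lemma DERIV_line_quotient:
  fixes a b c d :: complex
  assumes "c \<noteq> 0"
  shows "((\<lambda>h. (a + h * b) / (c + h * d)) has_field_derivative (b * c - a * d) / c\<^sup>2) (at 0)"
  using assms by (auto intro!: derivative_eq_intros simp: power2_eq_square)

text \<open>
  On trace-free matrices only the corner entry counts, which is what makes the twisting one-form
  computable from a single entry of the transition matrix.
\<close>

lemma lam_eq_trace_corner:
  fixes s :: complex
  assumes "X \<in> carrier_mat (Suc n) (Suc n)"
  shows "lam n s X = s / (1 + of_nat n) * mat_trace X - s * X $$ (n,n)"
proof -
  have "lam n s X = (\<Sum>i<Suc n. \<Sum>j<Suc n. lam_mat n s $$ (i,j) * X $$ (j,i))"
    unfolding lam_def by (rule mat_trace_mult_sum[OF lam_mat_carrier assms])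
  also have "\<dots> = (\<Sum>i<Suc n. s / (1 + of_nat n) * X $$ (i,i) - (if i = n then s * X $$ (n,n) else 0))"
  proof (intro sum.cong refl)
    fix i assume "i \<in> {..<Suc n}"
    then have i: "i < Suc n" by simp
    have "(\<Sum>j<Suc n. lam_mat n s $$ (i,j) * X $$ (j,i))
      = (\<Sum>j<Suc n. if j = i then (s / (1 + of_nat n) * X $$ (i,i) - (if i = n then s
          * X $$ (n,n) else 0)) else 0)"
      using i by (intro sum.cong refl) (auto simp: lam_mat_index algebra_simps)
    then show "(\<Sum>j<Suc n. lam_mat n s $$ (i,j) * X $$ (j,i)) = s / (1 + of_nat n) * X $$ (i,i)
        - (if i = n then s * X $$ (n,n) else 0)"
      using i by (simp del: sum.lessThan_Suc)
  qed
  also have "\<dots> = s / (1 + of_nat n) * mat_trace X - s * X $$ (n,n)"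
    using assms by (simp add: mat_trace_def sum_subtractf sum_distrib_left del: sum.lessThan_Suc)
  finally show ?thesis .
qed

lemma chart_pt_eq:
  assumes "z \<in> carrier_vec n" shows "chart_pt n \<sigma> \<gamma> z = proj_pt (\<sigma> \<gamma> *\<^sub>v hom_vec n z)"
  unfolding chart_pt_def using u_upper_unit[OF assms] by simp

text \<open>
  The following three functions are explicit formulas for the coordinates in the patch over \<open>U\<^sub>\<beta>\<close> of
  the point \<open>(z, \<xi>)\<close> of the patch over \<open>U\<^sub>\<alpha>\<close>, and for the transition matrix.  With
  \<open>M = \<sigma>\<^sub>\<beta>\<^sup>T \<sigma>\<^sub>\<alpha>\<close> and \<open>c\<close> the last entry of \<open>M (z; 1)\<close>, the pair \<open>((z; 1), (\<xi>; s - \<xi> z))\<close> is moved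
  by \<open>M\<close> and rescaled by \<open>(1 / c, c)\<close>, so that the last entry of the first vector is again 1.
\<close>

definition overlap_z :: "nat \<Rightarrow> (nat \<Rightarrow> complex mat) \<Rightarrow> nat \<Rightarrow> nat \<Rightarrow> complex vec \<Rightarrow> complex vec" where
  "overlap_z n \<sigma> \<alpha> \<beta> z = vec n (\<lambda>i.
     ((transpose_mat (\<sigma> \<beta>) * \<sigma> \<alpha>) *\<^sub>v hom_vec n z) $ i /
     ((transpose_mat (\<sigma> \<beta>) * \<sigma> \<alpha>) *\<^sub>v hom_vec n z) $ n)"

definition overlap_xi ::
  "nat \<Rightarrow> complex \<Rightarrow> (nat \<Rightarrow> complex mat) \<Rightarrow> nat \<Rightarrow> nat \<Rightarrow> complex vec \<Rightarrow> complex vec \<Rightarrow> complex vec" where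
  "overlap_xi n s \<sigma> \<alpha> \<beta> z \<xi> = vec n (\<lambda>i.
     ((transpose_mat (\<sigma> \<beta>) * \<sigma> \<alpha>) *\<^sub>v hom_vec n z) $ n *
     ((transpose_mat (\<sigma> \<beta>) * \<sigma> \<alpha>) *\<^sub>v cov_vec n s z \<xi>) $ i)"

definition overlap_t ::
  "nat \<Rightarrow> complex \<Rightarrow> (nat \<Rightarrow> complex mat) \<Rightarrow> nat \<Rightarrow> nat \<Rightarrow> complex vec \<Rightarrow> complex vec \<Rightarrow> complex mat" where
  "overlap_t n s \<sigma> \<alpha> \<beta> z \<xi> = h_inv n s (\<sigma> \<alpha>) z \<xi> *
     h_mat n s \<sigma> \<beta> (overlap_z n \<sigma> \<alpha> \<beta> z) (overlap_xi n s \<sigma> \<alpha> \<beta> z \<xi>)"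

context
  fixes n :: nat and s :: complex and \<sigma> :: "nat \<Rightarrow> complex mat" and \<alpha> \<beta> :: nat
  assumes s: "s \<noteq> 0"
    and ortho: "real_orthogonal (Suc n) (\<sigma> \<alpha>)" "real_orthogonal (Suc n) (\<sigma> \<beta>)"
    and det1: "Determinant.det (\<sigma> \<alpha>) = 1" "Determinant.det (\<sigma> \<beta>) = 1"
begin

private abbreviation (input) "A \<equiv> \<sigma> \<alpha>"
private abbreviation (input) "B \<equiv> \<sigma> \<beta>"
private abbreviation (input) "M \<equiv> transpose_mat B * A"
private abbreviation (input) "new_z \<equiv> overlap_z n \<sigma> \<alpha> \<beta>"
private abbreviation (input) "new_xi \<equiv> overlap_xi n s \<sigma> \<alpha> \<beta>"
private abbreviation (input) "new_t \<equiv> overlap_t n s \<sigma> \<alpha> \<beta>"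

lemma AB_carrier: "A \<in> carrier_mat (Suc n) (Suc n)" "B \<in> carrier_mat (Suc n) (Suc n)"
  "transpose_mat A \<in> carrier_mat (Suc n) (Suc n)" "transpose_mat B \<in> carrier_mat (Suc n) (Suc n)"
  "M \<in> carrier_mat (Suc n) (Suc n)"
proof -
  show c: "A \<in> carrier_mat (Suc n) (Suc n)" "B \<in> carrier_mat (Suc n) (Suc n)"
    using ortho unfolding real_orthogonal_def by blast+
  then show "transpose_mat A \<in> carrier_mat (Suc n) (Suc n)" "transpose_mat B \<in> carrier_mat (Suc n)
      (Suc n)"
    by simp_all
  then show "M \<in> carrier_mat (Suc n) (Suc n)" using c(1) by (intro mult_carrier_mat)
qed

lemma M_dim: "dim_vec (M *\<^sub>v y) = Suc n"
  using carrier_matD(1)[OF AB_carrier(5)] by (simp only: dim_mult_mat_vec)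

lemma AB_inv: "A * transpose_mat A = 1\<^sub>m (Suc n)" "transpose_mat A * A = 1\<^sub>m (Suc n)"
  "B * transpose_mat B = 1\<^sub>m (Suc n)" "transpose_mat B * B = 1\<^sub>m (Suc n)"
  using ortho unfolding real_orthogonal_def by blast+

lemma M_vec:
  assumes "y \<in> carrier_vec (Suc n)"
  shows "M *\<^sub>v y = transpose_mat B *\<^sub>v (A *\<^sub>v y)" "B *\<^sub>v (M *\<^sub>v y)
      = A *\<^sub>v y" "M *\<^sub>v y \<in> carrier_vec (Suc n)"
proof -
  show 1: "M *\<^sub>v y = transpose_mat B *\<^sub>v (A *\<^sub>v y)"
    by (rule assoc_mult_mat_vec[OF AB_carrier(4,1) assms])
  have "A *\<^sub>v y \<in> carrier_vec (Suc n)" using AB_carrier assms by auto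
  then show "B *\<^sub>v (M *\<^sub>v y) = A *\<^sub>v y"
    unfolding 1 using assoc_mult_mat_vec[OF AB_carrier(2,4), of "A *\<^sub>v y"] AB_inv by simp
  show "M *\<^sub>v y \<in> carrier_vec (Suc n)" using AB_carrier(5) assms by auto
qed

lemma B_inv_vec:
  assumes "y \<in> carrier_vec (Suc n)"
  shows "transpose_mat B *\<^sub>v (B *\<^sub>v y) = y"
  using assoc_mult_mat_vec[OF AB_carrier(4,2) assms] AB_inv assms by simp

lemma M_dot:
  assumes "x \<in> carrier_vec (Suc n)" "y \<in> carrier_vec (Suc n)"
  shows "(M *\<^sub>v x) \<bullet> (M *\<^sub>v y) = x \<bullet> y"
proof -
  note c = AB_carrier
  have "transpose_mat M * M = transpose_mat A * ((B * transpose_mat B) * A)"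
    using c by (simp add: transpose_mult[of _ "Suc n" "Suc n" _ "Suc n"] assoc_mult_mat[of _ "Suc n"
        "Suc n" _ "Suc n" _ "Suc n"]
       mult_carrier_mat[of _ "Suc n" "Suc n" _ "Suc n"])
  then have "transpose_mat M * M = 1\<^sub>m (Suc n)" using AB_inv c by simp
  then have "transpose_mat M *\<^sub>v (M *\<^sub>v x) = x"
    using assoc_mult_mat_vec[of "transpose_mat M" "Suc n" "Suc n" M "Suc n" x] c(5) assms(1)
        by (metis one_mult_mat_vec transpose_carrier_mat)
  then show ?thesis
    using transpose_vec_mult_scalar[OF c(5) assms(2) M_vec(3)[OF assms(1)]] by simp
qed

lemma new_index:
  "i < n \<Longrightarrow> new_z z $ i = (M *\<^sub>v hom_vec n z) $ i / (M *\<^sub>v hom_vec n z) $ n"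
  "i < n \<Longrightarrow> new_xi z \<xi> $ i = (M *\<^sub>v hom_vec n z) $ n * (M *\<^sub>v cov_vec n s z \<xi>) $ i"
  by (simp_all add: overlap_z_def overlap_xi_def)

lemma new_carrier [simp]: "new_z z \<in> carrier_vec n" "new_xi z \<xi> \<in> carrier_vec n"
  by (simp_all add: overlap_z_def overlap_xi_def)

lemma hom_vec_new_z:
  assumes "(M *\<^sub>v hom_vec n z) $ n \<noteq> 0"
  shows "hom_vec n (new_z z) = (1 / (M *\<^sub>v hom_vec n z) $ n) \<cdot>\<^sub>v (M *\<^sub>v hom_vec n z)"
proof (rule eq_vecI)
  have d: "dim_vec (M *\<^sub>v hom_vec n z) = Suc n" by (rule M_dim)
  then show "dim_vec (hom_vec n (new_z z)) = dim_vec ((1 / (M *\<^sub>v hom_vec n z) $ n) \<cdot>\<^sub>v (M *\<^sub>v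
      hom_vec n z))"
    by (simp del: dim_mult_mat_vec)
  fix i assume "i < dim_vec ((1 / (M *\<^sub>v hom_vec n z) $ n) \<cdot>\<^sub>v (M *\<^sub>v hom_vec n z))"
  then have "i < Suc n" using d by (simp del: dim_mult_mat_vec)
  then show "hom_vec n (new_z z) $ i = ((1 / (M *\<^sub>v hom_vec n z) $ n) \<cdot>\<^sub>v (M *\<^sub>v hom_vec n z)) $ i"
    using d assms by (auto simp: hom_vec_index new_index less_Suc_eq simp del: index_mult_mat_vec
        dim_mult_mat_vec)
qed

lemma sum_new_cov_hom: "(\<Sum>k<n. (M *\<^sub>v cov_vec n s z \<xi>) $ k * (M *\<^sub>v hom_vec n z) $ k)
   = s - (M *\<^sub>v cov_vec n s z \<xi>) $ n * (M *\<^sub>v hom_vec n z) $ n"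
proof -
  have "(M *\<^sub>v cov_vec n s z \<xi>) \<bullet> (M *\<^sub>v hom_vec n z) = s"
    using M_dot[OF cov_vec_carrier(1) hom_vec_carrier(1)] by (simp add: cov_vec_hom_vec)
  moreover have "dim_vec (M *\<^sub>v hom_vec n z) = Suc n" by (rule M_dim)
  ultimately have "(\<Sum>k<Suc n. (M *\<^sub>v cov_vec n s z \<xi>) $ k * (M *\<^sub>v hom_vec n z) $ k) = s"
    unfolding scalar_prod_def lessThan_atLeast0 by simp
  then show ?thesis unfolding sum.lessThan_Suc by (simp only: eq_diff_eq)
qed

text \<open>
  The last entry needs the pairing to be preserved: \<open>M\<close> is orthogonal, and the two scalings cancel.
\<close>

lemma cov_vec_new:
  assumes "(M *\<^sub>v hom_vec n z) $ n \<noteq> 0"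
  shows "cov_vec n s (new_z z) (new_xi z \<xi>) = (M *\<^sub>v hom_vec n z) $ n \<cdot>\<^sub>v (M *\<^sub>v cov_vec n s z \<xi>)"
proof (rule eq_vecI)
  have d: "dim_vec (M *\<^sub>v cov_vec n s z \<xi>) = Suc n" by (rule M_dim)
  then show "dim_vec (cov_vec n s (new_z z) (new_xi z \<xi>)) = dim_vec ((M *\<^sub>v hom_vec n z) $ n \<cdot>\<^sub>v (M
      *\<^sub>v cov_vec n s z \<xi>))"
    by (simp del: dim_mult_mat_vec)
  fix i assume "i < dim_vec ((M *\<^sub>v hom_vec n z) $ n \<cdot>\<^sub>v (M *\<^sub>v cov_vec n s z \<xi>))"
  then have "i < n \<or> i = n" using d by (auto simp del: dim_mult_mat_vec)
  moreover have "(\<Sum>k<n. new_xi z \<xi> $ k * new_z z $ k) = (\<Sum>k<n. (M *\<^sub>v cov_vec n s z \<xi>) $ k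
      * (M *\<^sub>v hom_vec n z) $ k)"
    using assms by (intro sum.cong) (auto simp: new_index simp del: index_mult_mat_vec dim_mult_mat_vec)
  ultimately show "cov_vec n s (new_z z) (new_xi z \<xi>) $ i = ((M *\<^sub>v hom_vec n z) $ n \<cdot>\<^sub>v (M *\<^sub>v
      cov_vec n s z \<xi>)) $ i"
    using d sum_new_cov_hom[of z \<xi>]
    by (auto simp: cov_vec_index new_index simp del: index_mult_mat_vec dim_mult_mat_vec)
qed

text \<open>
  A matrix of determinant one lies in \<open>L\<close> once its last column and last row vanish off the corner.
  Both hold because the last columns of the two frames, and the last rows of their inverses, are
  proportional, with factors \<open>1 / c\<close> and \<open>c\<close>.
\<close>

lemma overlap_t:
  assumes z: "z \<in> carrier_vec n" "\<xi> \<in> carrier_vec n" and c: "(M *\<^sub>v hom_vec n z) $ n \<noteq> 0"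
  shows "new_t z \<xi> \<in> L_group n" "h_mat n s \<sigma> \<beta> (new_z z) (new_xi z \<xi>) = h_mat n s \<sigma> \<alpha> z \<xi> * new_t z \<xi>"
    "new_t z \<xi> $$ (n,n) = 1 / (M *\<^sub>v hom_vec n z) $ n"
proof -
  let ?c = "(M *\<^sub>v hom_vec n z) $ n"
  let ?H = "h_mat n s \<sigma> \<alpha> z \<xi>" and ?G = "h_inv n s A z \<xi>"
  let ?H' = "h_mat n s \<sigma> \<beta> (new_z z) (new_xi z \<xi>)" and ?G' = "h_inv n s B (new_z z) (new_xi z \<xi>)"
  note hc = h_carrier[where \<sigma> = \<sigma>, OF s ortho(1), of z \<xi>] h_carrier[where \<sigma>
      = \<sigma>, OF s ortho(2), of "new_z z" "new_xi z \<xi>"]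
  note inv = h_mult_inv[where \<sigma> = \<sigma>, OF s ortho(1) z] h_mult_inv[where \<sigma>
      = \<sigma>, OF s ortho(2) new_carrier, of z z \<xi>]
  have col: "?H' $$ (i,n) = ?H $$ (i,n) / ?c" if "i < Suc n" for i
  proof -
    have "?H' $$ (i,n) = (B *\<^sub>v ((1 / ?c) \<cdot>\<^sub>v (M *\<^sub>v hom_vec n z))) $ i"
      unfolding h_last_column[where \<sigma> = \<sigma>, OF s ortho(2) new_carrier that] hom_vec_new_z[OF c] ..
    also have "B *\<^sub>v ((1 / ?c) \<cdot>\<^sub>v (M *\<^sub>v hom_vec n z)) = (1 / ?c) \<cdot>\<^sub>v (A *\<^sub>v hom_vec n z)"
      using mult_mat_vec[OF AB_carrier(2) M_vec(3)[OF hom_vec_carrier(1)]] M_vec(2)[OF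
          hom_vec_carrier(1)] by simp
    finally show ?thesis
      using that AB_carrier(1) h_last_column[where \<sigma> = \<sigma>, OF s ortho(1) z that] by simp
  qed
  have row: "?G' $$ (n,i) = ?c * ?G $$ (n,i)" if "i < Suc n" for i
  proof -
    have "s * ?G' $$ (n,i) = (B *\<^sub>v (?c \<cdot>\<^sub>v (M *\<^sub>v cov_vec n s z \<xi>))) $ i"
      unfolding h_inv_last_row[where \<sigma> = \<sigma>, OF s ortho(2) new_carrier that] cov_vec_new[OF c] ..
    also have "B *\<^sub>v (?c \<cdot>\<^sub>v (M *\<^sub>v cov_vec n s z \<xi>)) = ?c \<cdot>\<^sub>v (A *\<^sub>v cov_vec n s z \<xi>)"
      using mult_mat_vec[OF AB_carrier(2) M_vec(3)[OF cov_vec_carrier(1)]] M_vec(2)[OF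
          cov_vec_carrier(1)] by simp
    finally have "s * ?G' $$ (n,i) = s * (?c * ?G $$ (n,i))"
      using that AB_carrier(1) h_inv_last_row[where \<sigma> = \<sigma>, OF s ortho(1) z that] by simp
    then show ?thesis using s by simp
  qed
  have t: "new_t z \<xi> \<in> carrier_mat (Suc n) (Suc n)" using hc unfolding overlap_t_def by auto
  have tcol: "new_t z \<xi> $$ (i,n) = (if i = n then 1 / ?c else 0)" if i: "i < Suc n" for i
  proof -
    have "new_t z \<xi> $$ (i,n) = (\<Sum>k<Suc n. ?G $$ (i,k) * ?H' $$ (k,n))"
      unfolding overlap_t_def by (rule mult_mat_index_sum[OF hc(2,3) i lessI])
    also have "\<dots> = (\<Sum>k<Suc n. ?G $$ (i,k) * ?H $$ (k,n)) / ?c"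
      unfolding sum_divide_distrib by (intro sum.cong refl) (simp add: col)
    also have "(\<Sum>k<Suc n. ?G $$ (i,k) * ?H $$ (k,n)) = (?G * ?H) $$ (i,n)"
      by (rule mult_mat_index_sum[OF hc(2,1) i lessI, symmetric])
    finally show ?thesis using i inv(2) by simp
  qed
  have trow: "new_t z \<xi> $$ (n,i) = (if i = n then 1 / ?c else 0)" if i: "i < Suc n" for i
  proof -
    have "new_t z \<xi> $$ (n,i) = (\<Sum>k<Suc n. ?G $$ (n,k) * ?H' $$ (k,i))"
      unfolding overlap_t_def by (rule mult_mat_index_sum[OF hc(2,3) lessI i])
    also have "\<dots> = (\<Sum>k<Suc n. ?G' $$ (n,k) * ?H' $$ (k,i)) / ?c"
      unfolding sum_divide_distrib by (intro sum.cong refl) (simp add: row c)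
    also have "(\<Sum>k<Suc n. ?G' $$ (n,k) * ?H' $$ (k,i)) = (?G' * ?H') $$ (n,i)"
      by (rule mult_mat_index_sum[OF hc(4,3) lessI i, symmetric])
    finally show ?thesis using i inv(4) by simp
  qed
  have "Determinant.det ?G = 1" "Determinant.det ?H' = 1"
    unfolding h_inv_def h_mat_def using AB_carrier det1
    by (simp_all add: det_mult[of _ "Suc n"] mult_carrier_mat[of _ "Suc n" "Suc n" _ "Suc n"] det_u
        det_transpose)
  then have det: "Determinant.det (new_t z \<xi>) = 1"
    unfolding overlap_t_def using hc by (simp add: det_mult[of _ "Suc n"])
  show "new_t z \<xi> \<in> L_group n"
    by (rule L_groupI[OF t _ _ det]) (simp_all add: tcol trow)
  show "?H' = ?H * new_t z \<xi>"
  proof -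
    have "?H * new_t z \<xi> = (?H * ?G) * ?H'"
      unfolding overlap_t_def by (rule assoc_mult_mat[OF hc(1,2,3), symmetric])
    then show ?thesis using inv(1) hc by simp
  qed
  show "new_t z \<xi> $$ (n,n) = 1 / ?c" by (simp add: tcol)
qed

text \<open>
  Reading the equation in the last column determines \<open>z'\<close>, and reading its inverse in the last row
  determines \<open>\<xi>'\<close>.  Then \<open>t\<close> is the quotient of two known frames.
\<close>

lemma overlap_t_unique:
  assumes z: "z \<in> carrier_vec n" "\<xi> \<in> carrier_vec n" and z': "z' \<in> carrier_vec n" "\<xi>' \<in> carrier_vec n"
    and t: "t \<in> L_group n" and eq: "h_mat n s \<sigma> \<beta> z' \<xi>' = h_mat n s \<sigma> \<alpha> z \<xi> * t"
  shows "t = new_t z \<xi>"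
proof -
  let ?c = "(M *\<^sub>v hom_vec n z) $ n"
  let ?H = "h_mat n s \<sigma> \<alpha> z \<xi>" and ?G = "h_inv n s A z \<xi>"
  let ?H' = "h_mat n s \<sigma> \<beta> z' \<xi>'" and ?G' = "h_inv n s B z' \<xi>'"
  note hc = h_carrier[where \<sigma> = \<sigma>, OF s ortho(1), of z \<xi>] h_carrier[where \<sigma>
      = \<sigma>, OF s ortho(2), of z' \<xi>']
  note inv = h_mult_inv[where \<sigma> = \<sigma>, OF s ortho(1) z] h_mult_inv[where \<sigma> = \<sigma>, OF s ortho(2) z']
  note tD = L_groupD[OF t]
  define d where "d = t $$ (n,n)"
  have tG: "?G * ?H' = t"
    unfolding eq using assoc_mult_mat[OF hc(2,1) tD(1)] inv(2) tD(1) by simp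
  have Gt: "?G = t * ?G'"
    unfolding tG[symmetric] using assoc_mult_mat[OF hc(2,3,4)] inv(3) hc by simp
  have "B *\<^sub>v hom_vec n z' = d \<cdot>\<^sub>v (A *\<^sub>v hom_vec n z)"
  proof (rule eq_vecI)
    fix i assume "i < dim_vec (d \<cdot>\<^sub>v (A *\<^sub>v hom_vec n z))"
    then have i: "i < Suc n" using AB_carrier(1) by simp
    have "?H' $$ (i,n) = (\<Sum>k<Suc n. ?H $$ (i,k) * t $$ (k,n))"
      unfolding eq by (rule mult_mat_index_sum[OF hc(1) tD(1) i lessI])
    also have "\<dots> = ?H $$ (i,n) * d" using tD by (simp add: d_def)
    finally show "(B *\<^sub>v hom_vec n z') $ i = (d \<cdot>\<^sub>v (A *\<^sub>v hom_vec n z)) $ i"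
      using i AB_carrier(1) h_last_column[where \<sigma> = \<sigma>, OF s ortho(2) z' i] h_last_column[where \<sigma>
          = \<sigma>, OF s ortho(1) z i]
      by (simp del: index_mult_mat_vec add: mult.commute)
  qed (use AB_carrier in simp)
  then have "transpose_mat B *\<^sub>v (B *\<^sub>v hom_vec n z') = d \<cdot>\<^sub>v (M *\<^sub>v hom_vec n z)"
    using AB_carrier by (simp add: mult_mat_vec[of _ "Suc n" "Suc n"] M_vec(1))
  then have hom: "hom_vec n z' = d \<cdot>\<^sub>v (M *\<^sub>v hom_vec n z)"
    by (simp add: B_inv_vec)
  note dimM = M_dim
  have homi: "hom_vec n z' $ i = d * (M *\<^sub>v hom_vec n z) $ i" if "i < Suc n" for i
    unfolding hom using that dimM by (simp del: index_mult_mat_vec dim_mult_mat_vec)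
  have dc: "d * ?c = 1" using homi[of n] by (simp add: hom_vec_index)
  then have d: "d = 1 / ?c" and c: "?c \<noteq> 0" by (auto simp: eq_divide_eq)
  have z_eq: "z' = new_z z"
  proof (rule eq_vecI)
    fix i assume "i < dim_vec (new_z z)"
    then have "i < n" by (simp add: overlap_z_def)
    then show "z' $ i = new_z z $ i"
      using homi[of i] d by (simp add: hom_vec_index new_index del: index_mult_mat_vec)
  qed (use z' in \<open>simp add: overlap_z_def\<close>)
  have "d \<cdot>\<^sub>v (B *\<^sub>v cov_vec n s z' \<xi>') = A *\<^sub>v cov_vec n s z \<xi>"
  proof (rule eq_vecI)
    fix i assume "i < dim_vec (A *\<^sub>v cov_vec n s z \<xi>)"
    then have i: "i < Suc n" using AB_carrier(1) by simp
    have "?G $$ (n,i) = (\<Sum>k<Suc n. t $$ (n,k) * ?G' $$ (k,i))"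
      by (subst Gt, rule mult_mat_index_sum[OF tD(1) hc(4) lessI i])
    also have "\<dots> = d * ?G' $$ (n,i)" using tD by (simp add: d_def)
    finally have "s * ?G $$ (n,i) = d * (s * ?G' $$ (n,i))" by simp
    then show "(d \<cdot>\<^sub>v (B *\<^sub>v cov_vec n s z' \<xi>')) $ i = (A *\<^sub>v cov_vec n s z \<xi>) $ i"
      using i AB_carrier(2) unfolding h_inv_last_row[where \<sigma> = \<sigma>, OF s ortho(2) z' i]
          h_inv_last_row[where \<sigma> = \<sigma>, OF s ortho(1) z i]
      by (simp del: index_mult_mat_vec)
  qed (use AB_carrier in simp)
  then have "transpose_mat B *\<^sub>v (d \<cdot>\<^sub>v (B *\<^sub>v cov_vec n s z' \<xi>')) = M *\<^sub>v cov_vec n s z \<xi>"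
    by (simp add: M_vec(1))
  then have cov: "d \<cdot>\<^sub>v cov_vec n s z' \<xi>' = M *\<^sub>v cov_vec n s z \<xi>"
    using AB_carrier by (simp add: mult_mat_vec[of _ "Suc n" "Suc n"] B_inv_vec)
  have "\<xi>' = new_xi z \<xi>"
  proof (rule eq_vecI)
    fix i assume "i < dim_vec (new_xi z \<xi>)"
    then have "i < n" by (simp add: overlap_xi_def)
    then have "d * \<xi>' $ i = (M *\<^sub>v cov_vec n s z \<xi>) $ i" "i < n"
      unfolding cov[symmetric] by (simp_all add: cov_vec_index)
    then show "\<xi>' $ i = new_xi z \<xi> $ i"
      using d c by (simp add: new_index field_simps del: index_mult_mat_vec)
  qed (use z' in \<open>simp add: overlap_xi_def\<close>)
  then show ?thesis using tG z_eq by (simp add: overlap_t_def)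
qed

lemma t_mat_eq:
  assumes "z \<in> carrier_vec n" "\<xi> \<in> carrier_vec n" "(M *\<^sub>v hom_vec n z) $ n \<noteq> 0"
  shows "t_mat n s \<sigma> \<alpha> \<beta> z \<xi> = new_t z \<xi>"
  unfolding t_mat_def
proof (rule the_equality, intro conjI exI)
  show "new_t z \<xi> \<in> L_group n" by (rule overlap_t(1)[OF assms])
  show "h_mat n s \<sigma> \<beta> (new_z z) (new_xi z \<xi>) = h_mat n s \<sigma> \<alpha> z \<xi> * new_t z \<xi>"
      by (rule overlap_t(2)[OF assms])
qed (use assms overlap_t_unique in \<open>auto\<close>)

lemma transition_eq:
  assumes z: "z \<in> carrier_vec n" and c: "(M *\<^sub>v hom_vec n z) $ n \<noteq> 0"
  shows "transition n \<sigma> \<alpha> \<beta> z = new_z z"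
  unfolding transition_def chart_def
proof (rule the_equality)
  have "B *\<^sub>v hom_vec n (new_z z) = (1 / (M *\<^sub>v hom_vec n z) $ n) \<cdot>\<^sub>v (A *\<^sub>v hom_vec n z)"
    unfolding hom_vec_new_z[OF c]
    using mult_mat_vec[OF AB_carrier(2) M_vec(3)[OF hom_vec_carrier(1)]] M_vec(2)[OF
        hom_vec_carrier(1)] by simp
  then show "new_z z \<in> carrier_vec n \<and> chart_pt n \<sigma> \<alpha> z = chart_pt n \<sigma> \<beta> (new_z z)"
    using c by (simp add: chart_pt_eq z proj_pt_smult)
next
  fix z' assume z': "z' \<in> carrier_vec n \<and> chart_pt n \<sigma> \<alpha> z = chart_pt n \<sigma> \<beta> z'"
  then have "proj_pt (A *\<^sub>v hom_vec n z) = proj_pt (B *\<^sub>v hom_vec n z')"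
    using z by (simp add: chart_pt_eq)
  from proj_pt_eqD[OF this] obtain d where "A *\<^sub>v hom_vec n z = d \<cdot>\<^sub>v (B *\<^sub>v hom_vec n z')" by blast
  then have "M *\<^sub>v hom_vec n z = d \<cdot>\<^sub>v hom_vec n z'"
    using AB_carrier by (simp add: M_vec(1) mult_mat_vec[of _ "Suc n" "Suc n"] B_inv_vec)
  then have *: "(M *\<^sub>v hom_vec n z) $ i = d * hom_vec n z' $ i" if "i < Suc n" for i
    using that by (simp del: index_mult_mat_vec dim_mult_mat_vec)
  have d: "(M *\<^sub>v hom_vec n z) $ n = d" using *[of n] by (simp add: hom_vec_index)
  show "z' = new_z z"
  proof (rule eq_vecI)
    fix i assume "i < dim_vec (new_z z)"
    then have "i < n" by (simp add: overlap_z_def)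
    then show "z' $ i = new_z z $ i"
      using *[of i] d c by (simp add: hom_vec_index new_index del: index_mult_mat_vec)
  qed (use z' in \<open>simp add: overlap_z_def\<close>)
qed

lemma M_line:
  assumes "z \<in> carrier_vec n" "v \<in> carrier_vec n" "i < Suc n"
  shows "(M *\<^sub>v hom_vec n (z + h \<cdot>\<^sub>v v)) $ i = (M *\<^sub>v hom_vec n z) $ i + h * (M *\<^sub>v tan_vec n v) $ i"
proof -
  have "M *\<^sub>v hom_vec n (z + h \<cdot>\<^sub>v v) = M *\<^sub>v hom_vec n z + h \<cdot>\<^sub>v (M *\<^sub>v tan_vec n v)"
    unfolding hom_vec_line[OF assms(1,2)]
    using mult_add_distrib_mat_vec[OF AB_carrier(5) hom_vec_carrier(1)] mult_mat_vec[OF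
        AB_carrier(5) tan_vec_carrier(1)]
    by simp
  then show ?thesis using assms(3) M_dim by (simp del: index_mult_mat_vec dim_mult_mat_vec)
qed

text \<open>
  The transition functions are defined by a unique choice, which is meaningful on the overlap only;
  their derivatives at a point of the overlap can nevertheless be taken from the explicit formulas.
\<close>

lemma eventually_in_overlap:
  assumes "z \<in> carrier_vec n" "v \<in> carrier_vec n" "(M *\<^sub>v hom_vec n z) $ n \<noteq> 0"
  shows "\<forall>\<^sub>F h in nhds 0. (M *\<^sub>v hom_vec n (z + h \<cdot>\<^sub>v v)) $ n \<noteq> 0"
proof -
  have "((\<lambda>h. (M *\<^sub>v hom_vec n z) $ n + h * (M *\<^sub>v tan_vec n v) $ n) \<longlongrightarrow> (M *\<^sub>v hom_vec n z) $ n + 0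
      * (M *\<^sub>v tan_vec n v) $ n) (nhds 0)"
    by (intro tendsto_intros filterlim_ident)
  from tendsto_imp_eventually_ne[OF this, of 0] show ?thesis
    using assms by (simp add: M_line del: index_mult_mat_vec)
qed

lemma d_transition_eq:
  assumes z: "z \<in> carrier_vec n" "v \<in> carrier_vec n" and c: "(M *\<^sub>v hom_vec n z) $ n \<noteq> 0"
  shows "d_transition n \<sigma> \<alpha> \<beta> z v = vec n (\<lambda>i. ((M *\<^sub>v tan_vec n v) $ i * (M *\<^sub>v hom_vec n z) $ n
    - (M *\<^sub>v hom_vec n z) $ i * (M *\<^sub>v tan_vec n v) $ n) / ((M *\<^sub>v hom_vec n z) $ n)\<^sup>2)"
  unfolding d_transition_def
proof (rule eq_vecI, goal_cases)
  case (1 i)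
  then have i: "i < n" by simp
  have "\<forall>\<^sub>F h in nhds 0. transition n \<sigma> \<alpha> \<beta> (z + h \<cdot>\<^sub>v v) $ i =
     ((M *\<^sub>v hom_vec n z) $ i + h * (M *\<^sub>v tan_vec n v) $ i) / ((M *\<^sub>v hom_vec n z) $ n + h
         * (M *\<^sub>v tan_vec n v) $ n)"
    using eventually_in_overlap[OF z c]
  proof eventually_elim
    case (elim h)
    have "z + h \<cdot>\<^sub>v v \<in> carrier_vec n" using z by simp
    then show ?case
      using i z elim by (simp add: transition_eq new_index M_line del: index_mult_mat_vec)
  qed
  from deriv_cong_ev[OF this refl] DERIV_imp_deriv[OF DERIV_line_quotient[OF c]] i
  show ?case by simp
qed simp

text \<open>
  Written out, the transition matrix is a product of unipotent matrices and of constant orthogonal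
  ones, with rational coordinate functions as entries.
\<close>

lemma new_t_curve:
  assumes z: "z \<in> carrier_vec n" "\<xi> \<in> carrier_vec n" "v \<in> carrier_vec n" "\<eta> \<in> carrier_vec n"
    and c: "(M *\<^sub>v hom_vec n z) $ n \<noteq> 0"
  shows "unimodular_curve (Suc n) (\<lambda>h. new_t (z + h \<cdot>\<^sub>v v) (\<xi> + h \<cdot>\<^sub>v \<eta>))"
proof -
  let ?z = "\<lambda>h. z + h \<cdot>\<^sub>v v" and ?x = "\<lambda>h. \<xi> + h \<cdot>\<^sub>v \<eta>"
  have zc: "?z h \<in> carrier_vec n" "?x h \<in> carrier_vec n" for h using z by auto
  note fd = field_differentiable_const field_differentiable_ident field_differentiable_add
    field_differentiable_mult field_differentiable_sum field_differentiable_diff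
        field_differentiable_minus
  have fz: "(\<lambda>h. ?z h $ i) field_differentiable (at 0)" if "i < n" for i
    using that z by simp (intro fd)
  have fx: "(\<lambda>h. ?x h $ i) field_differentiable (at 0)" if "i < n" for i
    using that z by simp (intro fd)
  have fcov: "(\<lambda>h. cov_vec n s (?z h) (?x h) $ k) field_differentiable (at 0)" if "k < Suc n" for k
    using that by (cases "k < n") (auto simp: less_Suc_eq cov_vec_index simp del: index_add_vec
        index_smult_vec intro!: fd fz fx)
  have fMcov: "(\<lambda>h. (M *\<^sub>v cov_vec n s (?z h) (?x h)) $ i) field_differentiable (at 0)" if "i < Suc
      n" for i
    unfolding mult_mat_vec_index_sum[OF AB_carrier(5) cov_vec_carrier(1) that]
    by (intro fd fcov) simp
  have fMhom: "(\<lambda>h. (M *\<^sub>v hom_vec n (?z h)) $ i) field_differentiable (at 0)" if "i < Suc n" for i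
    unfolding M_line[OF z(1,3) that] by (intro fd)
  have fnz: "(\<lambda>h. new_z (?z h) $ i) field_differentiable (at 0)" if "i < n" for i
  proof -
    have "z + 0 \<cdot>\<^sub>v v = z" using z by auto
    then show ?thesis
      unfolding new_index(1)[OF that] using that c
      by (intro field_differentiable_divide fMhom) auto
  qed
  have fnx: "(\<lambda>h. new_xi (?z h) (?x h) $ i) field_differentiable (at 0)" if "i < n" for i
    unfolding new_index(2)[OF that] using that by (intro fd fMhom fMcov) auto
  have "unimodular_curve (Suc n) (\<lambda>h. u_lower n (- w_of s (?x h)) * (u_upper n (- ?z h)
      * (transpose_mat A * B * (u_upper n (new_z (?z h)) *
      u_lower n (w_of s (new_xi (?z h) (?x h)))))))"
  proof (intro unimodular_curve_mult unimodular_curve_u_upper unimodular_curve_u_lower)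
    show "- w_of s (?x h) \<in> carrier_vec n" "- ?z h \<in> carrier_vec n" "new_z (?z h) \<in> carrier_vec n"
      "w_of s (new_xi (?z h) (?x h)) \<in> carrier_vec n" for h
      using z by auto
    have minus: "(- w_of s y) $ i = (1 / s) * y $ i" "w_of s y $ i = (- 1 / s) * y $ i"
      if "y \<in> carrier_vec n" "i < n" for y i
      using that by (auto simp: w_of_def)
    show "(\<lambda>h. (- w_of s (?x h)) $ i) field_differentiable (at 0)" if "i < n" for i
      unfolding minus(1)[OF zc(2) that] using that by (intro fd fx)
    show "(\<lambda>h. w_of s (new_xi (?z h) (?x h)) $ i) field_differentiable (at 0)" if "i < n" for i
      unfolding minus(2)[OF new_carrier(2) that] using that by (intro fd fnx)
    have "(- ?z h) $ i = - (?z h $ i)" if "i < n" for h i using that z by simp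
    then show "(\<lambda>h. (- ?z h) $ i) field_differentiable (at 0)" if "i < n" for i
      using that fd(7)[OF fz[OF that]] by simp
    show "unimodular_curve (Suc n) (\<lambda>h. transpose_mat A)" "unimodular_curve (Suc n) (\<lambda>h. B)"
      by (rule unimodular_curve_const[OF AB_carrier(3,1) AB_inv(2)] unimodular_curve_const[OF
          AB_carrier(2,4) AB_inv(3)])+
  qed (use fnz in auto)
  also have "(\<lambda>h. u_lower n (- w_of s (?x h)) * (u_upper n (- ?z h) * (transpose_mat A * B
      * (u_upper n (new_z (?z h)) *
      u_lower n (w_of s (new_xi (?z h) (?x h))))))) = (\<lambda>h. new_t (?z h) (?x h))"
    unfolding overlap_t_def h_inv_def h_mat_def
    using AB_carrier by (simp add: assoc_mult_mat[of _ "Suc n" "Suc n" _ "Suc n" _ "Suc n"]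
        mult_carrier_mat[of _ "Suc n" "Suc n" _ "Suc n"])
  finally show ?thesis .
qed

text \<open>
  The logarithmic derivative has trace zero, so only its corner entry contributes.  In the last row of
  \<open>dt\<close> only the corner survives, as \<open>t\<close> remains in \<open>L\<close>, and it is the derivative of \<open>1 / c\<close>.
\<close>

lemma lam_log_deriv_t:
  assumes z: "z \<in> carrier_vec n" "\<xi> \<in> carrier_vec n" "v \<in> carrier_vec n" "\<eta> \<in> carrier_vec n"
    and c: "(M *\<^sub>v hom_vec n z) $ n \<noteq> 0"
  shows "lam n s (dt_mat n s \<sigma> \<alpha> \<beta> z \<xi> v \<eta> * minv (t_mat n s \<sigma> \<alpha> \<beta> z \<xi>))
    = s * (M *\<^sub>v tan_vec n v) $ n / (M *\<^sub>v hom_vec n z) $ n"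
proof -
  let ?c = "(M *\<^sub>v hom_vec n z) $ n" and ?d = "(M *\<^sub>v tan_vec n v) $ n"
  let ?z = "\<lambda>h. z + h \<cdot>\<^sub>v v" and ?x = "\<lambda>h. \<xi> + h \<cdot>\<^sub>v \<eta>"
  let ?t = "\<lambda>h. new_t (?z h) (?x h)"
  have z0: "?z 0 = z" "?x 0 = \<xi>" using z by auto
  have zc: "?z h \<in> carrier_vec n" "?x h \<in> carrier_vec n" for h using z by auto
  from new_t_curve[OF z c] obtain F' G where tc: "\<And>h. ?t h \<in> carrier_mat (Suc n) (Suc n)"
    and F': "F' \<in> carrier_mat (Suc n) (Suc n)" and G: "G \<in> carrier_mat (Suc n) (Suc n)"
    and inv: "?t 0 * G = 1\<^sub>m (Suc n)" and tr: "mat_trace (F' * G) = 0"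
    and der: "\<And>i j. i < Suc n \<Longrightarrow> j < Suc n \<Longrightarrow> ((\<lambda>h. ?t h $$ (i,j)) has_field_derivative F' $$ (i,j))
        (at 0)"
    unfolding unimodular_curve_def by blast
  have ev: "\<forall>\<^sub>F h in nhds 0. t_mat n s \<sigma> \<alpha> \<beta> (?z h) (?x h) = ?t h"
    using eventually_in_overlap[OF z(1,3) c] by eventually_elim (rule t_mat_eq[OF zc])
  have dt: "dt_mat n s \<sigma> \<alpha> \<beta> z \<xi> v \<eta> = F'"
  proof (rule eq_matI, goal_cases)
    case (1 i j)
    then have ij: "i < Suc n" "j < Suc n" using F' by auto
    have "deriv (\<lambda>h. t_mat n s \<sigma> \<alpha> \<beta> (?z h) (?x h) $$ (i,j)) 0 = deriv (\<lambda>h. ?t h $$ (i,j)) 0"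
      by (rule deriv_cong_ev) (use ev in \<open>auto elim: eventually_mono\<close>)
    also have "\<dots> = F' $$ (i,j)" by (rule DERIV_imp_deriv[OF der[OF ij]])
    finally show ?case using ij by (simp add: dt_mat_def)
  qed (use F' in \<open>auto simp: dt_mat_def\<close>)
  have t0: "t_mat n s \<sigma> \<alpha> \<beta> z \<xi> = ?t 0"
    unfolding z0 by (rule t_mat_eq[OF z(1,2) c])
  have mi: "minv (t_mat n s \<sigma> \<alpha> \<beta> z \<xi>) = G"
    unfolding t0 by (rule minv_eqI[OF tc G inv])
  have row: "F' $$ (n,k) = 0" if "k < n" for k
  proof -
    have "\<forall>\<^sub>F h in nhds 0. ?t h $$ (n,k) = 0"
      using eventually_in_overlap[OF z(1,3) c]
      by eventually_elim (rule L_groupD(3)[OF overlap_t(1)[OF zc] that])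
    then have "((\<lambda>h. 0) has_field_derivative F' $$ (n,k)) (at 0)"
      using der[of n k] that DERIV_cong_ev[of 0 0 "\<lambda>h. ?t h $$ (n,k)" "\<lambda>h. 0" "F' $$ (n,k)"] by simp
    then show ?thesis using DERIV_unique DERIV_const by blast
  qed
  have corner: "F' $$ (n,n) = - ?d / ?c\<^sup>2"
  proof -
    have "\<forall>\<^sub>F h in nhds 0. ?t h $$ (n,n) = (1 + h * 0) / (?c + h * ?d)"
      using eventually_in_overlap[OF z(1,3) c]
      by eventually_elim (simp add: overlap_t(3)[OF zc] M_line[OF z(1,3)] del: index_mult_mat_vec)
    then have "((\<lambda>h. (1 + h * 0) / (?c + h * ?d)) has_field_derivative F' $$ (n,n)) (at 0)"
      using der[of n n] DERIV_cong_ev[of 0 0 "\<lambda>h. ?t h $$ (n,n)" "\<lambda>h. (1 + h * 0) / (?c + h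
          * ?d)" "F' $$ (n,n)"] by simp
    from DERIV_unique[OF this DERIV_line_quotient[OF c]] show ?thesis by simp
  qed
  have "(\<Sum>k<Suc n. ?t 0 $$ (n,k) * G $$ (k,n)) = 1"
    unfolding mult_mat_index_sum[OF tc G lessI lessI, symmetric] inv by simp
  moreover have "?t 0 $$ (n,k) = 0" if "k < n" for k
    unfolding z0 by (rule L_groupD(3)[OF overlap_t(1)[OF z(1,2) c] that])
  ultimately have "?t 0 $$ (n,n) * G $$ (n,n) = 1" by simp
  then have Gn: "G $$ (n,n) = ?c"
    unfolding z0 overlap_t(3)[OF z(1,2) c] using c by (simp add: field_simps del: index_mult_mat_vec)
  have "(F' * G) $$ (n,n) = F' $$ (n,n) * G $$ (n,n)"
    unfolding mult_mat_index_sum[OF F' G lessI lessI] by (simp add: row)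
  then have "(F' * G) $$ (n,n) = - ?d / ?c"
    unfolding corner Gn using c by (simp add: power2_eq_square del: index_mult_mat_vec)
  then show ?thesis
    unfolding dt mi using lam_eq_trace_corner[of "F' * G"] F' G tr
        by (simp del: index_mult_mat_vec index_mult_mat(1))
qed

text \<open>
  The pairing of \<open>c \<rho>\<close> with the derivative of the quotient \<open>C\<^sub>i / c\<close> produces the full pairing of
  covector and tangent vector, invariant under \<open>M\<close>, except for the last entries; those combine with
  the invariance of the pairing of covector and point to \<open>- s dc / c\<close>.
\<close>

lemma new_xi_pairing:
  assumes z: "z \<in> carrier_vec n" "\<xi> \<in> carrier_vec n" "v \<in> carrier_vec n"
    and c: "(M *\<^sub>v hom_vec n z) $ n \<noteq> 0"
  shows "new_xi z \<xi> \<bullet> d_transition n \<sigma> \<alpha> \<beta> z v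
    = \<xi> \<bullet> v - s * (M *\<^sub>v tan_vec n v) $ n / (M *\<^sub>v hom_vec n z) $ n"
proof -
  let ?C = "\<lambda>i. (M *\<^sub>v hom_vec n z) $ i" and ?D = "\<lambda>i. (M *\<^sub>v tan_vec n v) $ i" and ?R
      = "\<lambda>i. (M *\<^sub>v cov_vec n s z \<xi>) $ i"
  have RD: "(\<Sum>k<n. ?R k * ?D k) = \<xi> \<bullet> v - ?R n * ?D n"
  proof -
    have "(\<Sum>k<Suc n. ?R k * ?D k) = (M *\<^sub>v cov_vec n s z \<xi>) \<bullet> (M *\<^sub>v tan_vec n v)"
      unfolding scalar_prod_def lessThan_atLeast0 M_dim ..
    also have "\<dots> = (\<Sum>k<Suc n. cov_vec n s z \<xi> $ k * tan_vec n v $ k)"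
      by (subst M_dot[OF cov_vec_carrier(1) tan_vec_carrier(1)]) (simp add: scalar_prod_def
          lessThan_atLeast0)
    also have "\<dots> = \<xi> \<bullet> v"
      using z unfolding scalar_prod_def by (simp add: cov_vec_index tan_vec_index lessThan_atLeast0)
    finally show ?thesis by (simp add: eq_diff_eq del: index_mult_mat_vec)
  qed
  have "new_xi z \<xi> \<bullet> d_transition n \<sigma> \<alpha> \<beta> z v = (\<Sum>k<n. ?C n * ?R k * ((?D k * ?C n - ?C k * ?D n)
      / (?C n)\<^sup>2))"
    unfolding d_transition_eq[OF z(1,3) c] scalar_prod_def
    by (simp add: new_index lessThan_atLeast0 del: index_mult_mat_vec)
  also have "\<dots> = (\<Sum>k<n. ?R k * ?D k - ?D n / ?C n * (?R k * ?C k))"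
    using c by (intro sum.cong refl) (simp add: field_simps power2_eq_square del: index_mult_mat_vec)
  also have "\<dots> = (\<Sum>k<n. ?R k * ?D k) - ?D n / ?C n * (\<Sum>k<n. ?R k * ?C k)"
    by (simp only: sum_subtractf sum_distrib_left)
  also have "\<dots> = \<xi> \<bullet> v - s * ?D n / ?C n"
    unfolding RD sum_new_cov_hom using c by (simp add: field_simps del: index_mult_mat_vec)
  finally show ?thesis .
qed

text \<open>
  A preimage of \<open>y\<close> is found by carrying \<open>(y; 0)\<close> back with the inverse of \<open>M\<close> and projecting along
  the line through \<open>(z; 1)\<close> to the vectors with last entry 0.
\<close>

lemma d_transition_surj:
  assumes z: "z \<in> carrier_vec n" and y: "y \<in> carrier_vec n" and c: "(M *\<^sub>v hom_vec n z) $ n \<noteq> 0"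
  shows "\<exists>v \<in> carrier_vec n. d_transition n \<sigma> \<alpha> \<beta> z v = y"
proof -
  let ?C = "M *\<^sub>v hom_vec n z"
  let ?c = "?C $ n"
  define X where "X = transpose_mat A *\<^sub>v (B *\<^sub>v tan_vec n y)"
  have X: "X \<in> carrier_vec (Suc n)" unfolding X_def using AB_carrier by auto
  have MX: "M *\<^sub>v X = tan_vec n y"
  proof -
    have By: "B *\<^sub>v tan_vec n y \<in> carrier_vec (Suc n)" using AB_carrier by auto
    have "A *\<^sub>v X = B *\<^sub>v tan_vec n y"
      unfolding X_def using assoc_mult_mat_vec[OF AB_carrier(1,3) By] AB_inv By by simp
    then show ?thesis using X by (simp add: M_vec(1) B_inv_vec)
  qed
  (* Subtracting X n times (z; 1) kills the last entry; the factor c undoes the division by c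
     in the chart. *)
  define v where "v = vec n (\<lambda>i. ?c * (X $ i - X $ n * z $ i))"
  have v: "v \<in> carrier_vec n" by (simp add: v_def)
  have tan: "tan_vec n v = ?c \<cdot>\<^sub>v X + (- (?c * X $ n)) \<cdot>\<^sub>v hom_vec n z"
  proof (rule eq_vecI)
    fix i assume "i < dim_vec (?c \<cdot>\<^sub>v X + (- (?c * X $ n)) \<cdot>\<^sub>v hom_vec n z)"
    then have "i < n \<or> i = n" by auto
    then show "tan_vec n v $ i = (?c \<cdot>\<^sub>v X + (- (?c * X $ n)) \<cdot>\<^sub>v hom_vec n z) $ i"
      using X by (auto simp: tan_vec_index hom_vec_index v_def algebra_simps simp del:
          index_mult_mat_vec)
  qed (use X in auto)
  have "M *\<^sub>v tan_vec n v = ?c \<cdot>\<^sub>v tan_vec n y + (- (?c * X $ n)) \<cdot>\<^sub>v ?C"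
    unfolding tan using mult_add_distrib_mat_vec[OF AB_carrier(5), of "?c \<cdot>\<^sub>v X" "(- (?c
        * X $ n)) \<cdot>\<^sub>v hom_vec n z"]
      mult_mat_vec[OF AB_carrier(5) X] mult_mat_vec[OF AB_carrier(5) hom_vec_carrier(1)] X MX
    by (simp del: index_mult_mat_vec)
  then have D: "(M *\<^sub>v tan_vec n v) $ i = ?c * tan_vec n y $ i - ?c * X $ n
      * ?C $ i" if "i < Suc n" for i
    using that M_dim by (simp del: index_mult_mat_vec dim_mult_mat_vec)
  have "d_transition n \<sigma> \<alpha> \<beta> z v = y"
    unfolding d_transition_eq[OF z v c]
  proof (rule eq_vecI)
    fix i assume "i < dim_vec y"
    then have i: "i < n" using y by simp
    have "((?c * y $ i - ?c * X $ n * ?C $ i) * ?c - ?C $ i * (0 - ?c * X $ n * ?c)) / ?c\<^sup>2 = y $ i"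
      using c by (simp add: field_simps power2_eq_square del: index_mult_mat_vec)
    then show "vec n (\<lambda>i. ((M *\<^sub>v tan_vec n v) $ i * ?c - ?C $ i * (M *\<^sub>v tan_vec n v) $ n)
        / ?c\<^sup>2) $ i = y $ i"
      using i D[of i] D[of n] by (simp add: tan_vec_index del: index_mult_mat_vec)
  qed (use y in simp)
  then show ?thesis using v by blast
qed

text \<open>
  Both covectors satisfy the same equation against all values of the differential of the coordinate
  change, and these values exhaust the whole space.
\<close>

lemma glue_condition_iff:
  assumes z: "z \<in> carrier_vec n" "\<xi> \<in> carrier_vec n" "\<xi>' \<in> carrier_vec n"
    and c: "(M *\<^sub>v hom_vec n z) $ n \<noteq> 0"
  shows "(\<forall>v \<in> carrier_vec n. \<forall>\<eta> \<in> carrier_vec n.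
        \<xi>' \<bullet> d_transition n \<sigma> \<alpha> \<beta> z v =
        \<xi> \<bullet> v - lam n s (dt_mat n s \<sigma> \<alpha> \<beta> z \<xi> v \<eta> * minv (t_mat n s \<sigma> \<alpha> \<beta> z \<xi>)))
    \<longleftrightarrow> \<xi>' = new_xi z \<xi>" (is "?L \<longleftrightarrow> _")
proof
  assume L: ?L
  have same: "\<xi>' \<bullet> y = new_xi z \<xi> \<bullet> y" if y: "y \<in> carrier_vec n" for y
  proof -
    from d_transition_surj[OF z(1) y c] obtain v where v: "v \<in> carrier_vec n" "d_transition n \<sigma> \<alpha> \<beta>
        z v = y" by blast
    have "\<xi>' \<bullet> d_transition n \<sigma> \<alpha> \<beta> z v = new_xi z \<xi> \<bullet> d_transition n \<sigma> \<alpha> \<beta> z v"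
      using L v(1) by (simp add: lam_log_deriv_t[OF z(1,2) v(1) v(1) c] new_xi_pairing[OF z(1,2)
          v(1) c] del: index_mult_mat_vec)
    then show ?thesis unfolding v(2) .
  qed
  show "\<xi>' = new_xi z \<xi>"
  proof (rule eq_vecI)
    fix i assume "i < dim_vec (new_xi z \<xi>)"
    then have "i < n" by (simp add: overlap_xi_def)
    then show "\<xi>' $ i = new_xi z \<xi> $ i" using same[of "unit_vec n i"] z(3) new_carrier(2)[of z \<xi>]
        by simp
  qed (use z in \<open>simp add: overlap_xi_def\<close>)
next
  assume "\<xi>' = new_xi z \<xi>"
  then show ?L
    using z c by (simp add: lam_log_deriv_t new_xi_pairing del: index_mult_mat_vec)
qed

lemma dyad_overlap:
  assumes z: "z \<in> carrier_vec n" "\<xi> \<in> carrier_vec n" and c: "(M *\<^sub>v hom_vec n z) $ n \<noteq> 0" and i: "i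
      < Suc n" "j < Suc n"
  shows "(B *\<^sub>v hom_vec n (new_z z)) $ i * (B *\<^sub>v cov_vec n s (new_z z) (new_xi z \<xi>)) $ j
    = (A *\<^sub>v hom_vec n z) $ i * (A *\<^sub>v cov_vec n s z \<xi>) $ j"
  unfolding hom_vec_new_z[OF c] cov_vec_new[OF c]
    mult_mat_vec[OF AB_carrier(2) M_vec(3)[OF hom_vec_carrier(1)]]
    mult_mat_vec[OF AB_carrier(2) M_vec(3)[OF cov_vec_carrier(1)]]
    M_vec(2)[OF hom_vec_carrier(1)] M_vec(2)[OF cov_vec_carrier(1)]
  using i c carrier_matD[OF AB_carrier(1)] by (simp del: index_mult_mat_vec(1))

end

section \<open>The moment map and tau in a patch\<close>

lemma orthogonal_norm_sum:
  assumes A: "real_orthogonal (Suc n) A" and y: "y \<in> carrier_vec (Suc n)"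
  shows "(\<Sum>i<Suc n. (A *\<^sub>v y) $ i * cnj ((A *\<^sub>v y) $ i)) = (\<Sum>i<Suc n. y $ i * cnj (y $ i))"
proof -
  have Ac: "A \<in> carrier_mat (Suc n) (Suc n)" and AA: "transpose_mat A * A = 1\<^sub>m (Suc n)"
    and real: "\<And>i j. i < Suc n \<Longrightarrow> j < Suc n \<Longrightarrow> cnj (A $$ (i,j)) = A $$ (i,j)"
    using A unfolding real_orthogonal_def by auto
  have orth: "(\<Sum>i<Suc n. A $$ (i,k) * A $$ (i,l)) = (if k = l then 1 else 0)" if "k < Suc n" "l <
      Suc n" for k l
  proof -
    have "(\<Sum>i<Suc n. A $$ (i,k) * A $$ (i,l)) = (transpose_mat A * A) $$ (k,l)"
      unfolding mult_mat_index_sum[OF transpose_carrier_mat[THEN iffD2, OF Ac] Ac that]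
      using that carrier_matD[OF Ac] by (intro sum.cong) auto
    then show ?thesis unfolding AA using that by simp
  qed
  have "(\<Sum>i<Suc n. (A *\<^sub>v y) $ i * cnj ((A *\<^sub>v y) $ i))
     = (\<Sum>i<Suc n. (\<Sum>k<Suc n. A $$ (i,k) * y $ k) * (\<Sum>l<Suc n. A $$ (i,l) * cnj (y $ l)))"
    by (intro sum.cong refl) (simp add: mult_mat_vec_index_sum[OF Ac y] real del: index_mult_mat_vec
        sum.lessThan_Suc)
  also have "\<dots> = (\<Sum>i<Suc n. \<Sum>k<Suc n. \<Sum>l<Suc n. (A $$ (i,k) * A $$ (i,l)) * (y $ k * cnj (y $ l)))"
    unfolding sum_product by (intro sum.cong refl) (simp add: mult_ac)
  also have "\<dots> = (\<Sum>k<Suc n. \<Sum>l<Suc n. \<Sum>i<Suc n. (A $$ (i,k) * A $$ (i,l)) * (y $ k * cnj (y $ l)))"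
    by (rule trans[OF sum.swap]) (intro sum.cong refl sum.swap)
  also have "\<dots> = (\<Sum>k<Suc n. \<Sum>l<Suc n. if l = k then y $ k * cnj (y $ k) else 0)"
    unfolding sum_distrib_right[symmetric] by (intro sum.cong refl) (auto simp: orth simp del:
        sum.lessThan_Suc)
  also have "\<dots> = (\<Sum>k<Suc n. y $ k * cnj (y $ k))"
    by (simp del: sum.lessThan_Suc)
  finally show ?thesis .
qed

lemma orthogonal_dot:
  assumes A: "real_orthogonal (Suc n) A" and "x \<in> carrier_vec (Suc n)" "y \<in> carrier_vec (Suc n)"
  shows "(\<Sum>i<Suc n. (A *\<^sub>v x) $ i * (A *\<^sub>v y) $ i) = x \<bullet> y"
proof -
  have Ac: "A \<in> carrier_mat (Suc n) (Suc n)" and AA: "transpose_mat A * A = 1\<^sub>m (Suc n)"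
    using A unfolding real_orthogonal_def by auto
  have Ax: "A *\<^sub>v x \<in> carrier_vec (Suc n)" "A *\<^sub>v y \<in> carrier_vec (Suc n)"
    using Ac assms by (auto intro!: mult_mat_vec_carrier[of _ "Suc n" "Suc n"])
  have "(\<Sum>i<Suc n. (A *\<^sub>v x) $ i * (A *\<^sub>v y) $ i) = (A *\<^sub>v x) \<bullet> (A *\<^sub>v y)"
    unfolding scalar_prod_def lessThan_atLeast0 carrier_vecD[OF Ax(2)] ..
  also have "\<dots> = (transpose_mat A *\<^sub>v (A *\<^sub>v x)) \<bullet> y"
    by (rule transpose_vec_mult_scalar[OF Ac assms(3) Ax(1), symmetric])
  also have "transpose_mat A *\<^sub>v (A *\<^sub>v x) = x"
    using assoc_mult_mat_vec[of "transpose_mat A" "Suc n" "Suc n" A "Suc n" x] Ac AA assms(2) by simp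
  finally show ?thesis .
qed

lemma mat_trace_mult_adjoint:
  assumes "X \<in> carrier_mat m m"
  shows "mat_trace (X * mat_adjoint X) = (\<Sum>i<m. \<Sum>j<m. X $$ (i,j) * cnj (X $$ (i,j)))"
proof -
  have adj: "mat_adjoint X \<in> carrier_mat m m" "\<And>i j. i < m \<Longrightarrow> j < m \<Longrightarrow> mat_adjoint X $$ (i,j)
      = cnj (X $$ (j,i))"
    using assms by (auto simp: mat_adjoint_def mat_of_rows_def)
  show ?thesis
    unfolding mat_trace_mult_sum[OF assms adj(1)] by (simp add: adj(2))
qed

context
  fixes n :: nat and s :: complex and \<sigma> :: "nat \<Rightarrow> complex mat" and \<alpha> :: nat
  assumes s: "s \<noteq> 0" and csp: "cyclic_signed_perms n \<sigma>" and \<alpha>: "\<alpha> \<le> n"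
begin

lemma last_coord_nonzero_iff:
  assumes "\<beta> \<le> n" "z \<in> carrier_vec n"
  shows "((transpose_mat (\<sigma> \<beta>) * \<sigma> \<alpha>) *\<^sub>v hom_vec n z) $ n \<noteq> 0 \<longleftrightarrow> (\<sigma> \<alpha> *\<^sub>v hom_vec n z) $ \<beta> \<noteq> 0"
proof -
  note o = cyclic_signed_perm(1)[OF csp \<alpha>] cyclic_signed_perm(1)[OF csp assms(1)]
  note d = cyclic_signed_perm(2)[OF csp \<alpha>] cyclic_signed_perm(2)[OF csp assms(1)]
  from cyclic_signed_perm(3)[OF csp assms(1)] obtain \<epsilon> where e: "\<epsilon> \<noteq> 0"
    "\<And>y. y \<in> carrier_vec (Suc n) \<Longrightarrow> (transpose_mat (\<sigma> \<beta>) *\<^sub>v y) $ n = \<epsilon> * y $ \<beta>" by blast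
  have "\<sigma> \<alpha> *\<^sub>v hom_vec n z \<in> carrier_vec (Suc n)"
    using AB_carrier(1)[where \<sigma> = \<sigma>, OF s o d] by auto
  then show ?thesis
    unfolding M_vec(1)[where \<sigma> = \<sigma>, OF s o d hom_vec_carrier(1)] using e by simp
qed

lemma chart_pt_in_U_patch_iff:
  assumes "\<beta> \<le> n" "z \<in> carrier_vec n"
  shows "chart_pt n \<sigma> \<alpha> z \<in> U_patch n \<beta> \<longleftrightarrow> (\<sigma> \<alpha> *\<^sub>v hom_vec n z) $ \<beta> \<noteq> 0"
proof -
  have Ac: "\<sigma> \<alpha> \<in> carrier_mat (Suc n) (Suc n)"
    using cyclic_signed_perm(1)[OF csp \<alpha>] by (simp add: real_orthogonal_def)
  then have c: "\<sigma> \<alpha> *\<^sub>v hom_vec n z \<in> carrier_vec (Suc n)" by auto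
  note eq = chart_pt_eq[OF assms(2), of \<sigma> \<alpha>]
  show ?thesis
  proof
    assume "chart_pt n \<sigma> \<alpha> z \<in> U_patch n \<beta>"
    then obtain y where y: "proj_pt (\<sigma> \<alpha> *\<^sub>v hom_vec n z) = proj_pt y" "y \<in> carrier_vec (Suc n)" "y
        $ \<beta> \<noteq> 0"
      unfolding U_patch_def eq by auto
    from proj_pt_eqD[OF y(1)] obtain c where "c \<noteq> 0" "\<sigma> \<alpha> *\<^sub>v hom_vec n z = c \<cdot>\<^sub>v y" by blast
    then show "(\<sigma> \<alpha> *\<^sub>v hom_vec n z) $ \<beta> \<noteq> 0" using y assms(1) by (simp del: index_mult_mat_vec)
  next
    assume "(\<sigma> \<alpha> *\<^sub>v hom_vec n z) $ \<beta> \<noteq> 0"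
    then show "chart_pt n \<sigma> \<alpha> z \<in> U_patch n \<beta>"
      unfolding U_patch_def eq using c by (intro CollectI exI[of _ "\<sigma> \<alpha> *\<^sub>v hom_vec n z"]) simp
  qed
qed

lemma glue_mu_eq:
  assumes g: "((\<alpha>, z, \<xi>), (\<beta>, z', \<xi>')) \<in> glue n s \<sigma>"
  shows "h_mat n s \<sigma> \<beta> z' \<xi>' * lam_mat n s * minv (h_mat n s \<sigma> \<beta> z' \<xi>')
    = h_mat n s \<sigma> \<alpha> z \<xi> * lam_mat n s * minv (h_mat n s \<sigma> \<alpha> z \<xi>)"
proof -
  from g have z: "z \<in> carrier_vec n" "\<xi> \<in> carrier_vec n" and z': "\<xi>' \<in> carrier_vec n" and \<beta>: "\<beta> \<le> n"
    and patch: "chart_pt n \<sigma> \<alpha> z \<in> U_patch n \<beta>" and zt: "z' = transition n \<sigma> \<alpha> \<beta> z"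
    unfolding glue_def cotangent_union_def by auto
  note o = cyclic_signed_perm(1)[OF csp \<alpha>] cyclic_signed_perm(1)[OF csp \<beta>]
  note d = cyclic_signed_perm(2)[OF csp \<alpha>] cyclic_signed_perm(2)[OF csp \<beta>]
  have c: "((transpose_mat (\<sigma> \<beta>) * \<sigma> \<alpha>) *\<^sub>v hom_vec n z) $ n \<noteq> 0"
    using patch by (simp only: last_coord_nonzero_iff[OF \<beta> z(1)] chart_pt_in_U_patch_iff[OF \<beta> z(1)]
        simp_thms)
  have z_eq: "z' = overlap_z n \<sigma> \<alpha> \<beta> z"
    unfolding zt by (rule transition_eq[where \<sigma> = \<sigma>, OF s o d z(1) c])
  have xi_eq: "\<xi>' = overlap_xi n s \<sigma> \<alpha> \<beta> z \<xi>"
    using g glue_condition_iff[where \<sigma> = \<sigma>, OF s o d z z' c] unfolding glue_def by blast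
  have nc: "z' \<in> carrier_vec n" unfolding z_eq by (rule new_carrier(1)[where \<sigma> = \<sigma>, OF s o d])
  show ?thesis
    unfolding mu_rank_one[where \<sigma> = \<sigma>, OF s o(2) nc z'] mu_rank_one[where \<sigma>
        = \<sigma>, OF s o(1) z] unfolding z_eq xi_eq
    by (rule eq_matI) (simp_all add: dyad_overlap[where \<sigma> = \<sigma>, OF s o d z c] del: index_mult_mat_vec)
qed

text \<open>
  Needed so that a class contains the point it is named after: \<open>mu_plus\<close> takes the common value over
  a class, which must not be empty.
\<close>

lemma glue_refl:
  assumes z: "z \<in> carrier_vec n" "\<xi> \<in> carrier_vec n"
  shows "((\<alpha>, z, \<xi>), (\<alpha>, z, \<xi>)) \<in> glue n s \<sigma>"
proof -
  note o = cyclic_signed_perm(1)[OF csp \<alpha>] cyclic_signed_perm(1)[OF csp \<alpha>]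
  note d = cyclic_signed_perm(2)[OF csp \<alpha>] cyclic_signed_perm(2)[OF csp \<alpha>]
  have M1: "transpose_mat (\<sigma> \<alpha>) * \<sigma> \<alpha> = 1\<^sub>m (Suc n)"
    using o(1) unfolding real_orthogonal_def by blast
  have c1: "((transpose_mat (\<sigma> \<alpha>) * \<sigma> \<alpha>) *\<^sub>v hom_vec n z) $ n = 1"
    unfolding M1 by (simp add: hom_vec_index)
  then have c: "((transpose_mat (\<sigma> \<alpha>) * \<sigma> \<alpha>) *\<^sub>v hom_vec n z) $ n \<noteq> 0" by simp
  have z_eq: "overlap_z n \<sigma> \<alpha> \<alpha> z = z"
    by (rule eq_vecI) (use z in \<open>simp_all add: overlap_z_def M1 hom_vec_index\<close>)
  have xi_eq: "overlap_xi n s \<sigma> \<alpha> \<alpha> z \<xi> = \<xi>"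
    by (rule eq_vecI) (use z in \<open>simp_all add: overlap_xi_def M1 hom_vec_index cov_vec_index\<close>)
  have "chart_pt n \<sigma> \<alpha> z \<in> U_patch n \<alpha>"
    using c by (simp only: last_coord_nonzero_iff[OF \<alpha> z(1)] chart_pt_in_U_patch_iff[OF \<alpha> z(1)]
        simp_thms)
  moreover have "z = transition n \<sigma> \<alpha> \<alpha> z"
    using transition_eq[where \<sigma> = \<sigma>, OF s o d z(1) c] z_eq by simp
  moreover note glue_condition_iff[where \<sigma> = \<sigma>, OF s o d z z(2) c, THEN iffD2, OF xi_eq[symmetric]]
  ultimately show ?thesis
    unfolding glue_def cotangent_union_def using z \<alpha> by simp
qed

lemma mu_plus_Z_pt:
  assumes p: "p \<in> carrier_vec (2*n)"
  shows "mu_plus n s \<sigma> (Z_pt n s \<sigma> \<alpha> p) = mat (Suc n) (Suc n) (\<lambda>(i,j). (if i = j then s / (1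
      + of_nat n) else 0)
       - (\<sigma> \<alpha> *\<^sub>v hom_vec n (vec_first p n)) $ i * (\<sigma> \<alpha> *\<^sub>v cov_vec n s (vec_first p n) (vec_last p
           n)) $ j)"
    (is "_ = ?R")
proof -
  let ?z = "vec_first p n" and ?x = "vec_last p n"
  have z: "?z \<in> carrier_vec n" "?x \<in> carrier_vec n" by simp_all
  let ?mu = "\<lambda>(\<alpha>, z, \<xi>). h_mat n s \<sigma> \<alpha> z \<xi> * lam_mat n s * minv (h_mat n s \<sigma> \<alpha> z \<xi>)"
  have base: "?mu (\<alpha>, ?z, ?x) = ?R"
    using mu_rank_one[where \<sigma> = \<sigma>, OF s cyclic_signed_perm(1)[OF csp \<alpha>] z] by simp
  have const: "?mu y = ?R" if "y \<in> Z_pt n s \<sigma> \<alpha> p" for y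
  proof -
    obtain \<beta> z' \<xi>' where y: "y = (\<beta>, z', \<xi>')" by (cases y)
    then have "((\<alpha>, ?z, ?x), (\<beta>, z', \<xi>')) \<in> glue n s \<sigma>" using that by (simp add: Z_pt_def)
    from glue_mu_eq[OF this] show ?thesis using base y by simp
  qed
  have mem: "(\<alpha>, ?z, ?x) \<in> Z_pt n s \<sigma> \<alpha> p" using glue_refl[OF z] by (simp add: Z_pt_def)
  have "?mu ` Z_pt n s \<sigma> \<alpha> p = (\<lambda>_. ?R) ` Z_pt n s \<sigma> \<alpha> p"
    by (rule image_cong[OF refl const])
  also have "\<dots> = {?R}" by (rule image_constant[OF mem])
  finally have "?mu ` Z_pt n s \<sigma> \<alpha> p = {?R}" .
  then show ?thesis unfolding mu_plus_def by simp
qed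

text \<open>
  For \<open>k = s / (n + 1)\<close> and vectors that pair to \<open>s\<close>, the square norm of \<open>k 1 - \<zeta> \<rho>\<^sup>T\<close> is
  \<open>|\<zeta>|\<^sup>2 |\<rho>|\<^sup>2 - |s|\<^sup>2 / (n + 1)\<close>, and orthogonal matrices with real entries preserve the norms.
\<close>

lemma tau_chart_eq:
  assumes p: "p \<in> carrier_vec (2*n)"
  shows "tau_chart n s \<sigma> \<alpha> p = (1 + (\<Sum>k<n. (cmod (p $ k))\<^sup>2)) *
    ((\<Sum>k<n. (cmod (p $ (n+k)))\<^sup>2) + (cmod (s - (\<Sum>k<n. p $ (n+k) * p $ k)))\<^sup>2)"
proof -
  let ?A = "\<sigma> \<alpha>" and ?z = "vec_first p n" and ?x = "vec_last p n"
  note o = cyclic_signed_perm(1)[OF csp \<alpha>]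
  define \<zeta> where "\<zeta> = (\<lambda>i. (?A *\<^sub>v hom_vec n ?z) $ i)"
  define \<rho> where "\<rho> = (\<lambda>i. (?A *\<^sub>v cov_vec n s ?z ?x) $ i)"
  define c where "c = s / (1 + of_nat n)"
  have n0: "(1 + of_nat n :: complex) \<noteq> 0" by (metis of_nat_Suc of_nat_neq_0)
  have mu: "mu_plus n s \<sigma> (Z_pt n s \<sigma> \<alpha> p) = mat (Suc n) (Suc n) (\<lambda>(i,j). (if i = j then c else 0)
      - \<zeta> i * \<rho> j)"
    unfolding mu_plus_Z_pt[OF p] \<zeta>_def \<rho>_def c_def ..
  have zp: "?z $ i = p $ i" "?x $ i = p $ (n+i)" if "i < n" for i
    using that p by (auto simp: vec_first_def vec_last_def)
  have zr: "(\<Sum>i<Suc n. \<zeta> i * \<rho> i) = s"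
    unfolding \<zeta>_def \<rho>_def orthogonal_dot[OF o hom_vec_carrier(1) cov_vec_carrier(1)]
    using comm_scalar_prod[OF hom_vec_carrier(1) cov_vec_carrier(1)] cov_vec_hom_vec by metis
  have zz: "(\<Sum>i<Suc n. \<zeta> i * cnj (\<zeta> i)) = 1 + (\<Sum>k<n. p $ k * cnj (p $ k))"
    unfolding \<zeta>_def orthogonal_norm_sum[OF o hom_vec_carrier(1)] by (simp add: hom_vec_index zp)
  have rr: "(\<Sum>i<Suc n. \<rho> i * cnj (\<rho> i)) = (\<Sum>k<n. p $ (n+k) * cnj (p $ (n+k)))
       + (s - (\<Sum>k<n. p $ (n+k) * p $ k)) * cnj (s - (\<Sum>k<n. p $ (n+k) * p $ k))"
    unfolding \<rho>_def orthogonal_norm_sum[OF o cov_vec_carrier(1)] by (simp add: cov_vec_index zp)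
  have "mat_trace (mu_plus n s \<sigma> (Z_pt n s \<sigma> \<alpha> p) * mat_adjoint (mu_plus n s \<sigma> (Z_pt n s \<sigma> \<alpha> p)))
    = (\<Sum>i<Suc n. \<Sum>j<Suc n. ((if i = j then c else 0) - \<zeta> i * \<rho> j) * cnj ((if i = j then c else 0)
        - \<zeta> i * \<rho> j))"
    unfolding mu by (subst mat_trace_mult_adjoint[of _ "Suc n"]) (simp_all del: sum.lessThan_Suc)
  also have "\<dots> = (\<Sum>i<Suc n. \<Sum>j<Suc n. (if j = i then c * cnj c - cnj c * (\<zeta> i * \<rho> i) - c * cnj (\<zeta> i
      * \<rho> i) else 0)
        + (\<zeta> i * cnj (\<zeta> i)) * (\<rho> j * cnj (\<rho> j)))"
    by (intro sum.cong refl) (auto simp: algebra_simps)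
  also have "\<dots> = (\<Sum>i<Suc n. c * cnj c - cnj c * (\<zeta> i * \<rho> i) - c * cnj (\<zeta> i * \<rho> i))
        + (\<Sum>i<Suc n. \<zeta> i * cnj (\<zeta> i)) * (\<Sum>j<Suc n. \<rho> j * cnj (\<rho> j))"
    by (simp add: sum.distrib sum_product del: sum.lessThan_Suc)
  also have "(\<Sum>i<Suc n. c * cnj c - cnj c * (\<zeta> i * \<rho> i) - c * cnj (\<zeta> i * \<rho> i))
     = (1 + of_nat n) * (c * cnj c) - cnj c * (\<Sum>i<Suc n. \<zeta> i * \<rho> i) - c * cnj (\<Sum>i<Suc n. \<zeta> i * \<rho> i)"
    by (simp add: sum_subtractf sum_distrib_left del: sum.lessThan_Suc)
  also have "\<dots> = - (s * cnj s / (1 + of_nat n))"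
  proof -
    have "(1 + of_nat n) * c = s" using n0 by (simp add: c_def)
    moreover have "cnj c = cnj s / (1 + of_nat n)" by (simp add: c_def)
    ultimately show ?thesis
      unfolding zr by (simp add: mult.assoc[symmetric]) (simp add: c_def)
  qed
  finally have tr: "mat_trace (mu_plus n s \<sigma> (Z_pt n s \<sigma> \<alpha> p)
      * mat_adjoint (mu_plus n s \<sigma> (Z_pt n s \<sigma> \<alpha> p)))
     = of_real (- ((cmod s)\<^sup>2 / (1 + real n)) + (1 + (\<Sum>k<n. (cmod (p $ k))\<^sup>2)) *
      ((\<Sum>k<n. (cmod (p $ (n+k)))\<^sup>2) + (cmod (s - (\<Sum>k<n. p $ (n+k) * p $ k)))\<^sup>2))"
    unfolding zz rr unfolding complex_norm_square[symmetric] by simp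
  show ?thesis
    unfolding tau_chart_def tau_def tr Re_complex_of_real by simp
qed

end

section \<open>Determinants of low-rank updates\<close>

text \<open>
  Sylvester's determinant identity: multiply the block matrix \<open>[1, -A; B, 1]\<close> from the right by
  unipotent block matrices that clear either of the off-diagonal blocks.
\<close>

lemma det_one_plus_mult_commute:
  fixes A B :: "'a::idom mat"
  assumes A: "A \<in> carrier_mat m k" and B: "B \<in> carrier_mat k m"
  shows "Determinant.det (1\<^sub>m m + A * B) = Determinant.det (1\<^sub>m k + B * A)"
proof -
  let ?X = "four_block_mat (1\<^sub>m m) (- A) B (1\<^sub>m k)"
  let ?Y = "four_block_mat (1\<^sub>m m) A (0\<^sub>m k m) (1\<^sub>m k)"
  let ?W = "four_block_mat (1\<^sub>m m) (0\<^sub>m m k) (- B) (1\<^sub>m k)"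
  have carr: "?X \<in> carrier_mat (m + k) (m + k)" "?Y \<in> carrier_mat (m + k) (m + k)"
    "?W \<in> carrier_mat (m + k) (m + k)"
    using A B by auto
  have det1: "Determinant.det ?Y = 1" "Determinant.det ?W = 1"
    by (subst det_four_block_mat_lower_left_zero det_four_block_mat_upper_right_zero;
        use A B in auto)+
  have XY: "?X * ?Y = four_block_mat (1\<^sub>m m) (0\<^sub>m m k) B (1\<^sub>m k + B * A)"
    using A B by (subst mult_four_block_mat[of _ m m _ k _ k _ _ m _ k]) (auto simp: comm_add_mat)
  then have "Determinant.det ?X = Determinant.det (1\<^sub>m k + B * A)"
    using det_mult[OF carr(1,2)] det1 A B
    by (simp add: det_four_block_mat_upper_right_zero[of _ m _ k])
  moreover have "?X * ?W = four_block_mat (1\<^sub>m m + A * B) (- A) (0\<^sub>m k m) (1\<^sub>m k)"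
    using A B by (subst mult_four_block_mat[of _ m m _ k _ k _ _ m _ k]) auto
  then have "Determinant.det ?X = Determinant.det (1\<^sub>m m + A * B)"
    using det_mult[OF carr(1,3)] det1 A B
    by (simp add: det_four_block_mat_lower_left_zero[of _ m _ k])
  ultimately show ?thesis by simp
qed

lemma det_2_by_2:
  fixes A :: "'a::idom mat"
  assumes "A \<in> carrier_mat 2 2"
  shows "Determinant.det A = A $$ (0,0) * A $$ (1,1) - A $$ (0,1) * A $$ (1,0)"
proof -
  let ?e = "\<lambda>x::'a. mat 1 1 (\<lambda>_. x)"
  let ?B = "four_block_mat (?e (A $$ (0,0))) (?e (A $$ (0,1))) (?e (A $$ (1,0))) (?e (A $$ (1,1)))"
  have "A = ?B"
  proof (rule eq_matI)
    fix i j assume "i < dim_row ?B" "j < dim_col ?B"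
    then have "i = 0 \<or> i = 1" "j = 0 \<or> j = 1" by auto
    then show "A $$ (i,j) = ?B $$ (i,j)" by auto
  qed (use assms in auto)
  then have "Determinant.det A = Determinant.det ?B"
    by (rule arg_cong)
  also have "\<dots> = Determinant.det
      (?e (A $$ (0,0)) * ?e (A $$ (1,1)) - ?e (A $$ (0,1)) * ?e (A $$ (1,0)))"
  proof (rule det_four_block_mat[of _ 1])
    show "?e (A $$ (1,0)) * ?e (A $$ (1,1)) = ?e (A $$ (1,1)) * ?e (A $$ (1,0))"
      by (rule eq_matI) (simp_all add: scalar_prod_def mult.commute)
  qed simp_all
  also have "\<dots> = A $$ (0,0) * A $$ (1,1) - A $$ (0,1) * A $$ (1,0)"
    by (subst det_single) (auto simp: scalar_prod_def)
  finally show ?thesis .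
qed

text \<open>
  The factor \<open>c\<close> in front of one of the two dyads is what keeps the formula polynomial: for \<open>c \<noteq> 0\<close>
  it is Sylvester's identity for rank two, and for \<open>c = 0\<close> the remaining dyad is singular in dimension
  at least two.
\<close>

lemma det_smult_one_plus_two_dyads:
  fixes c :: "'a::field"
  assumes m: "m \<ge> 2" and u: "u1 \<in> carrier_vec m" "u2 \<in> carrier_vec m"
    and v: "v1 \<in> carrier_vec m" "v2 \<in> carrier_vec m"
  shows "Determinant.det (mat m m (\<lambda>(i,j). (if i = j then c else 0) + c * (u1 $ i * v1 $ j) + u2 $ i
      * v2 $ j))
    = c ^ (m - 1) * ((1 + v1 \<bullet> u1) * (c + v2 \<bullet> u2) - (v1 \<bullet> u2) * (v2 \<bullet> u1))"
    (is "Determinant.det ?A = _")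
proof (cases "c = 0")
  case True
  have "\<exists>v \<in> carrier_vec m. v \<noteq> 0\<^sub>v m \<and> v2 \<bullet> v = 0"
  proof (cases "v2 $ 0 = 0")
    case True
    have "unit_vec m 0 \<noteq> (0\<^sub>v m :: 'a vec)"
      using m by (metis index_unit_vec(1) index_zero_vec(1) less_le_trans pos2 zero_neq_one)
    then show ?thesis using True m v by (intro bexI[of _ "unit_vec m 0"]) auto
  next
    case False
    let ?v = "v2 $ 1 \<cdot>\<^sub>v unit_vec m 0 - v2 $ 0 \<cdot>\<^sub>v unit_vec m 1"
    have "?v $ 1 \<noteq> 0\<^sub>v m $ 1" using False m by simp
    then have "?v \<noteq> 0\<^sub>v m" by metis
    moreover have "v2 \<bullet> ?v = 0"
      using m v by (subst scalar_prod_minus_distrib[of _ m]) auto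
    ultimately show ?thesis by (intro bexI[of _ ?v]) auto
  qed
  then obtain v where v': "v \<in> carrier_vec m" "v \<noteq> 0\<^sub>v m" "v2 \<bullet> v = 0" by blast
  have "?A *\<^sub>v v = 0\<^sub>v m"
  proof (rule eq_vecI)
    fix i assume i: "i < dim_vec (0\<^sub>v m :: 'a vec)"
    have "(?A *\<^sub>v v) $ i = (\<Sum>j = 0..<m. u2 $ i * (v2 $ j * v $ j))"
      using i v' v True by (auto simp: scalar_prod_def intro!: sum.cong)
    also have "\<dots> = u2 $ i * (v2 \<bullet> v)"
      using v' by (simp add: scalar_prod_def sum_distrib_left[symmetric])
    finally have "(?A *\<^sub>v v) $ i = u2 $ i * (v2 \<bullet> v)" .
    then show "(?A *\<^sub>v v) $ i = 0\<^sub>v m $ i" using i v' by simp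
  qed auto
  then have "Determinant.det ?A = 0"
    using v' by (subst det_0_iff_vec_prod_zero[of _ m]) auto
  then show ?thesis using True m by (simp add: zero_power)
next
  case False
  let ?U = "mat m 2 (\<lambda>(i,j). if j = 0 then u1 $ i else u2 $ i)"
  let ?V = "mat 2 m (\<lambda>(i,j). if i = 0 then v1 $ j else v2 $ j / c)"
  have "?A = c \<cdot>\<^sub>m (1\<^sub>m m + ?U * ?V)"
    using False by (intro eq_matI) (auto simp: scalar_prod_def numeral_2_eq_2 distrib_left)
  then have "Determinant.det ?A = c ^ m * Determinant.det (1\<^sub>m 2 + ?V * ?U)"
    by (simp add: det_one_plus_mult_commute[of _ m 2])
  also have "Determinant.det (1\<^sub>m 2 + ?V * ?U) =
      (1 + v1 \<bullet> u1) * (1 + v2 \<bullet> u2 / c) - (v1 \<bullet> u2) * (v2 \<bullet> u1 / c)"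
    using u v by (subst det_2_by_2) (auto simp: scalar_prod_def sum_divide_distrib)
  also have "c ^ m * \<dots> = c ^ (m - 1) * ((1 + v1 \<bullet> u1) * (c + v2 \<bullet> u2) - (v1 \<bullet> u2) * (v2 \<bullet> u1))"
  proof -
    have "c ^ m = c ^ (m - 1) * c"
      using m by (metis One_nat_def Suc_pred less_le_trans pos2 power_Suc2)
    then show ?thesis using False by (simp add: field_simps)
  qed
  finally show ?thesis .
qed

lemma det_one_plus_dyad:
  fixes u v :: "'a::idom vec"
  assumes u: "u \<in> carrier_vec m" and v: "v \<in> carrier_vec m"
  shows "Determinant.det (mat m m (\<lambda>(i,j). (if i = j then 1 else 0) + u $ i * v $ j)) = 1 + v \<bullet> u"
proof -
  let ?U = "mat m 1 (\<lambda>(i,j). u $ i)" and ?V = "mat 1 m (\<lambda>(i,j). v $ j)"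
  have "mat m m (\<lambda>(i,j). (if i = j then 1 else 0) + u $ i * v $ j) = 1\<^sub>m m + ?U * ?V"
    by (intro eq_matI) (auto simp: scalar_prod_def)
  moreover have "Determinant.det (1\<^sub>m 1 + ?V * ?U) = 1 + v \<bullet> u"
    using u by (subst det_single) (auto simp: scalar_prod_def)
  ultimately show ?thesis
    using det_one_plus_mult_commute[of ?U m 1 ?V] by simp
qed

text \<open>
  The form in which the determinant of the metric is evaluated: there \<open>Q\<close> is the matrix of a
  shear and \<open>P\<close> its conjugate transpose, and \<open>D\<close> is the part of the Levi form that is easy to invert.
  The left factors of the dyads are written as \<open>P D u\<close>, so that dividing by \<open>D\<close> has already been done.
\<close>

lemma det_congruent_two_dyads:
  fixes c :: "'a::field"
  assumes m: "m \<ge> 2"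
    and carr: "P \<in> carrier_mat m m" "D \<in> carrier_mat m m" "Q \<in> carrier_mat m m"
    and det1: "Determinant.det P = 1" "Determinant.det Q = 1"
    and u: "u1 \<in> carrier_vec m" "u2 \<in> carrier_vec m"
    and v: "v1 \<in> carrier_vec m" "v2 \<in> carrier_vec m"
    and A: "A = c \<cdot>\<^sub>m (P * D * Q)
      + c \<cdot>\<^sub>m mat m m (\<lambda>(i,j). (P *\<^sub>v (D *\<^sub>v u1)) $ i * (transpose_mat Q *\<^sub>v v1) $ j)
      + mat m m (\<lambda>(i,j). (P *\<^sub>v (D *\<^sub>v u2)) $ i * (transpose_mat Q *\<^sub>v v2) $ j)"
  shows "Determinant.det A = Determinant.det D * c ^ (m - 1) *
    ((1 + v1 \<bullet> u1) * (c + v2 \<bullet> u2) - (v1 \<bullet> u2) * (v2 \<bullet> u1))"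
proof -
  let ?B = "mat m m (\<lambda>(i,j). (if i = j then c else 0) + c * (u1 $ i * v1 $ j) + u2 $ i * v2 $ j)"
  let ?dy = "\<lambda>u v. mat m m (\<lambda>(i,j). u $ i * v $ j :: 'a)"
  have dyad_left: "X * ?dy a b = ?dy (X *\<^sub>v a) b"
    if "X \<in> carrier_mat m m" "a \<in> carrier_vec m" for X :: "'a mat" and a b
    using that by (intro eq_matI) (auto simp: scalar_prod_def sum_distrib_right mult.assoc)
  have dyad_right: "?dy a b * X = ?dy a (transpose_mat X *\<^sub>v b)"
    if "X \<in> carrier_mat m m" "b \<in> carrier_vec m" for X :: "'a mat" and a b
    using that by (intro eq_matI)
      (auto simp: scalar_prod_def sum_distrib_left mult.assoc mult.commute intro!: sum.cong)
  have distr: "(c \<cdot>\<^sub>m X + c \<cdot>\<^sub>m Y + Z) * Q = c \<cdot>\<^sub>m (X * Q) + c \<cdot>\<^sub>m (Y * Q) + Z * Q"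
    if "X \<in> carrier_mat m m" "Y \<in> carrier_mat m m" "Z \<in> carrier_mat m m" for X Y Z
    using that carr(3) by (simp add: add_mult_distrib_mat[of _ m m _ _ m] mult_smult_assoc_mat[of _
        m m _ m])
  have B: "?B = c \<cdot>\<^sub>m 1\<^sub>m m + c \<cdot>\<^sub>m ?dy u1 v1 + ?dy u2 v2"
    by (rule eq_matI) auto
  have Bc: "?B \<in> carrier_mat m m" by simp
  have "P * D * ?B = c \<cdot>\<^sub>m (P * D) + c \<cdot>\<^sub>m (P * D * ?dy u1 v1) + P * D * ?dy u2 v2"
    unfolding B using carr
    by (simp add: mult_add_distrib_mat[of _ m m _ m] mult_smult_distrib[of _ m m _ m])
  also have "\<dots> * Q = c \<cdot>\<^sub>m (P * D * Q) + c \<cdot>\<^sub>m (P * D * ?dy u1 v1 * Q) + P * D * ?dy u2 v2 * Q"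
    by (rule distr) (use carr in auto)
  also have "\<dots> = A"
    unfolding A using carr u v by (simp add: dyad_left dyad_right assoc_mult_mat_vec[of _ m m])
  finally have "A = P * D * ?B * Q" by simp
  then have "Determinant.det A = Determinant.det D * Determinant.det ?B"
    using det1 det_mult[OF mult_carrier_mat[OF mult_carrier_mat[OF carr(1,2)] Bc] carr(3)]
      det_mult[OF mult_carrier_mat[OF carr(1,2)] Bc] det_mult[OF carr(1,2)]
    by simp
  then show ?thesis
    using det_smult_one_plus_two_dyads[OF m u v, of c] by simp
qed

section \<open>The determinant of the metric\<close>

lemma sum_delta_plus_times:
  fixes b :: "nat \<Rightarrow> 'a::comm_ring_1"
  assumes "i < n"
  shows "(\<Sum>k<n. ((if i = k then c else 0) + a * b k) * h k) = c * h i + a * (\<Sum>k<n. b k * h k)"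
    and "(\<Sum>k<n. h k * ((if k = i then c else 0) + b k * a)) = h i * c + (\<Sum>k<n. h k * b k) * a"
proof -
  have "(\<Sum>k<n. ((if i = k then c else 0) + a * b k) * h k)
      = (\<Sum>k<n. (if i = k then c * h k else 0) + a * (b k * h k))"
    by (intro sum.cong) (auto simp: algebra_simps)
  then show "(\<Sum>k<n. ((if i = k then c else 0) + a * b k) * h k) = c * h i + a * (\<Sum>k<n. b k * h k)"
    using assms by (simp add: sum.distrib sum_distrib_left)
  have "(\<Sum>k<n. h k * ((if k = i then c else 0) + b k * a))
      = (\<Sum>k<n. (if k = i then h k * c else 0) + h k * b k * a)"
    by (intro sum.cong) (auto simp: algebra_simps)
  then show "(\<Sum>k<n. h k * ((if k = i then c else 0) + b k * a)) = h i * c + (\<Sum>k<n. h k * b k) * a"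
    using assms by (simp add: sum.distrib sum_distrib_right)
qed

text \<open>
  This identity and the next one are the entries of the congruence below, with the sums over the
  coordinates replaced by the scalars \<open>P = \<xi> z\<close>, \<open>Q = |\<xi>|\<^sup>2\<close>, \<open>R = |z|\<^sup>2\<close>.
  Quantities and their conjugates enter as independent variables.
\<close>

lemma shear_identity_mixed:
  fixes xb xi zi zb l e s N R P :: "'a::field"
  assumes N: "N = 1 + R" "N \<noteq> 0" and s: "s = e + P" and l: "l = xi - s * zi / N"
  shows "N * ((xb * zi + zb * l) / N + (P * zi + R * l) / N * zb) = xb * zi + N * xi * zb - e * zi * zb"
proof -
  have nl: "N * l = N * xi - s * zi" using N(2) by (simp add: l field_simps)
  have "N * ((xb * zi + zb * l) / N + (P * zi + R * l) / N * zb)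
      = xb * zi + P * zi * zb + (1 + R) * l * zb"
    using N(2) by (simp add: field_simps)
  also have "\<dots> = xb * zi + P * zi * zb + (N * xi - s * zi) * zb"
    using nl N(1) by simp
  also have "\<dots> = xb * zi + N * xi * zb - e * zi * zb"
    by (simp add: s algebra_simps)
  finally show ?thesis .
qed

lemma shear_identity_base:
  fixes xi xj zi zj li lj e ec s sc N R P Pc Q M d :: "'a::field"
  assumes N: "N = 1 + R" "N \<noteq> 0" and s: "s = e + P" "sc = ec + Pc" and M: "M = Q + e * ec"
    and l: "li = xi - s * zi / N" "lj = xj - sc * zj / N"
  shows "M * (d - zi * zj / N)
      + (zj * (zi * Q + N * xi * Pc - e * zi * Pc) + lj * (P * zi + N * xi * R - e * zi * R)) / N
      + li * lj = M * d + N * xi * xj - zi * xj * e - xi * zj * ec"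
proof -
  have "N * (N * (M * (d - zi * zj / N)
      + (zj * (zi * Q + N * xi * Pc - e * zi * Pc) + lj * (P * zi + N * xi * R - e * zi * R)) / N
      + li * lj)) = N * (N * (M * d + N * xi * xj - zi * xj * e - xi * zj * ec))"
  proof -
    have nl: "N * li = N * xi - s * zi" "N * lj = N * xj - sc * zj"
      using N(2) by (simp_all add: l field_simps)
    have "N * (N * (M * (d - zi * zj / N)
        + (zj * (zi * Q + N * xi * Pc - e * zi * Pc) + lj * (P * zi + N * xi * R - e * zi * R)) / N
        + li * lj))
      = N * M * (N * d - zi * zj)
        + N * zj * (zi * Q + N * xi * Pc - e * zi * Pc) + (N * lj) * (P * zi + N * xi * R - e * zi * R)
        + (N * li) * (N * lj)"
      using N(2) by (simp add: field_simps)
    also have "\<dots> = N * (N * (M * d + N * xi * xj - zi * xj * e - xi * zj * ec))"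
      unfolding nl unfolding s M N(1) by (simp add: algebra_simps)
    finally show ?thesis .
  qed
  then show ?thesis using N(2) by simp
qed

text \<open>
  Here \<open>x\<close> stands for \<open>\<xi>\<close>, \<open>F\<close> and \<open>G\<close> for \<open>f(\<tau>)\<close> and \<open>f'(\<tau>)\<close>, and \<open>(g, h)\<close> for the gradient \<open>\<partial>\<tau>\<close>; the
  coefficients of \<open>F\<close> are the blocks of the Levi form.  In the sheared frame the gradient is
  \<open>(- cnj s l, h)\<close>, so that the dyads of \<open>l\<close> and of the gradient overlap; with
  \<open>q = (\<tau> - \<tau>\<^sub>0) / \<tau>\<close> the four pairings of these vectors with respect to the inverse of \<open>D\<close> are all
  expressed by \<open>q\<close>, except for a summand \<open>\<tau> - \<tau>\<^sub>0\<close> that comes from the fibre component \<open>h\<close>.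
\<close>

lemma det_levi_form:
  fixes z x :: "nat \<Rightarrow> complex" and F G s :: complex and n :: nat
  defines "N \<equiv> 1 + (\<Sum>k<n. z k * cnj (z k))" and "e \<equiv> s - (\<Sum>k<n. x k * z k)"
  defines "M \<equiv> (\<Sum>k<n. x k * cnj (x k)) + e * cnj e"
  defines "g \<equiv> \<lambda>i. M * cnj (z i) - N * x i * cnj e"
    and "h \<equiv> \<lambda>i. N * (cnj (x i) - z i * cnj e)"
  assumes n: "n \<ge> 1" and N0: "N \<noteq> 0" and M0: "M \<noteq> 0"
    and A: "A \<in> carrier_mat (2*n) (2*n)"
    and A11: "\<And>i j. i < n \<Longrightarrow> j < n \<Longrightarrow> A $$ (i,j) =
      F * (M * (if i = j then 1 else 0) + N * x i * cnj (x j) - cnj (z i) * cnj (x j) * e - x i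
          * z j * cnj e)
      + G * g i * cnj (g j)"
    and A12: "\<And>i j. i < n \<Longrightarrow> j < n \<Longrightarrow> A $$ (i,n+j) =
      F * (x j * cnj (z i) + N * x i * cnj (z j) - e * cnj (z i) * cnj (z j)) + G * g i * cnj (h j)"
    and A21: "\<And>i j. i < n \<Longrightarrow> j < n \<Longrightarrow> A $$ (n+i,j) =
      F * (cnj (x i) * z j + N * z i * cnj (x j) - cnj e * z i * z j) + G * h i * cnj (g j)"
    and A22: "\<And>i j. i < n \<Longrightarrow> j < n \<Longrightarrow> A $$ (n+i,n+j) =
      F * (N * ((if i = j then 1 else 0) + z i * cnj (z j))) + G * h i * cnj (h j)"
  shows "Determinant.det A = F ^ (2*n) * (N*M) ^ (n-1) * (2 * (N*M) - s * cnj s)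
    + 2 * G * F ^ (2*n-1) * (N*M) ^ n * (N*M - s * cnj s)"
proof -
  define P where "P = (\<Sum>k<n. x k * z k)"
  define Q where "Q = (\<Sum>k<n. x k * cnj (x k))"
  define R where "R = (\<Sum>k<n. z k * cnj (z k))"
  (* l is the covector of the first dyad, and T the matrix of the shear: it sends v to
     (z* v / N) x + (l v / N) z*, the quantity added to the fibre component. *)
  define l where "l = (\<lambda>i. x i - s * cnj (z i) / N)"
  define T where "T = (\<lambda>j k. (x j * cnj (z k) + cnj (z j) * l k) / N)"
  define \<omega> where "\<omega> = cnj P - R * cnj e"
  define lz where "lz = P - s * R / N"
  define q where "q = (N*M - s * cnj s) / (N*M)"
  have N: "N = 1 + R" by (simp add: N_def R_def)
  have s: "s = e + P" by (simp add: e_def P_def)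
  have M: "M = Q + e * cnj e" by (simp add: M_def Q_def)
  have real: "cnj N = N" "cnj R = R" "cnj Q = Q" "cnj M = M"
    by (simp_all add: N_def R_def Q_def M_def mult.commute)
  have RN: "R = N - 1" by (simp add: N)
  have sums: "(\<Sum>k<n. z k * x k) = P" "(\<Sum>k<n. cnj (z k) * cnj (x k)) = cnj P"
     "(\<Sum>k<n. cnj (x k) * cnj (z k)) = cnj P" "(\<Sum>k<n. cnj (x k) * x k) = Q" "(\<Sum>k<n. cnj (z k) * z k) = R"
     "(\<Sum>k<n. x k * z k) = P" "(\<Sum>k<n. x k * cnj (x k)) = Q" "(\<Sum>k<n. z k * cnj (z k)) = R"
    by (simp_all add: P_def Q_def R_def mult.commute)

  let ?I = "1\<^sub>m n :: complex mat" and ?O = "0\<^sub>m n n :: complex mat"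
  let ?D1 = "mat n n (\<lambda>(i,j). M * ((if i = j then 1 else 0) - cnj (z i) * z j / N))"
  let ?K = "mat n n (\<lambda>(i,j). N * ((if i = j then 1 else 0) + z i * cnj (z j)))"
  let ?T = "mat n n (\<lambda>(i,j). T j i)" and ?Tc = "mat n n (\<lambda>(i,j). cnj (T i j))"
  let ?P = "four_block_mat ?I ?T ?O ?I" and ?Q = "four_block_mat ?I ?O ?Tc ?I"
  let ?D = "four_block_mat ?D1 ?O ?O ?K"
  have two: "2 * n = n + n" by simp
  have carr: "?P \<in> carrier_mat (2*n) (2*n)" "?D \<in> carrier_mat (2*n) (2*n)" "?Q \<in> carrier_mat (2*n)
      (2*n)"
    unfolding two by auto
  have det1: "Determinant.det ?P = 1" "Determinant.det ?Q = 1"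
    by (simp_all add: det_four_block_mat_lower_left_zero[of _ n _ n]
        det_four_block_mat_upper_right_zero[of _ n _ n])

  have detD: "Determinant.det ?D = (N*M)^n"
  proof -
    have "?D1 = M \<cdot>\<^sub>m mat n n (\<lambda>(i,j). (if i = j then 1 else 0) + vec n (\<lambda>i. - cnj (z i) / N) $ i
        * vec n z $ j)"
      by (rule eq_matI) auto
    then have "Determinant.det ?D1 = M ^ n * (1 + vec n z \<bullet> vec n (\<lambda>i. - cnj (z i) / N))"
      by (simp only: det_smult dim_col_mat det_one_plus_dyad[OF vec_carrier vec_carrier])
    also have "vec n z \<bullet> vec n (\<lambda>i. - cnj (z i) / N) = - R / N"
      by (simp add: scalar_prod_def R_def sum_divide_distrib sum_negf lessThan_atLeast0)
    also have "M ^ n * (1 + - R / N) = M ^ n / N"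
      using N0 by (simp add: RN field_simps)
    finally have d1: "Determinant.det ?D1 = M ^ n / N" .
    have "?K = N \<cdot>\<^sub>m mat n n (\<lambda>(i,j). (if i = j then 1 else 0) + vec n z $ i
        * vec n (\<lambda>i. cnj (z i)) $ j)"
      by (rule eq_matI) auto
    then have "Determinant.det ?K = N ^ n * (1 + vec n (\<lambda>i. cnj (z i)) \<bullet> vec n z)"
      by (simp only: det_smult dim_col_mat det_one_plus_dyad[OF vec_carrier vec_carrier])
    also have "vec n (\<lambda>i. cnj (z i)) \<bullet> vec n z = R"
      by (simp add: scalar_prod_def R_def lessThan_atLeast0 mult.commute)
    finally have d2: "Determinant.det ?K = N ^ n * N"
      by (simp add: N)
    have "Determinant.det ?D = Determinant.det ?D1 * Determinant.det ?K"
      by (rule det_four_block_mat_lower_left_zero) auto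
    then show ?thesis
      using N0 by (simp only: d1 d2) (simp add: power_mult_distrib)
  qed

  (* (a, 0) is D applied inversely to (l, 0), and b is the same for the lower block and h; they use that
     1 + z z* and 1 - z z* / N are inverse to each other. *)
  define a where "a = (\<lambda>i. (l i + cnj (z i) * lz) / M)"
  define b where "b = (\<lambda>i. cnj (x i) - z i * cnj e - z i * \<omega> / N)"
  define u1 where "u1 = vec n a @\<^sub>v 0\<^sub>v n"
  define u2 where "u2 = vec n (\<lambda>i. - G * cnj s * a i) @\<^sub>v vec n (\<lambda>i. G * b i)"
  define v1 where "v1 = vec n (\<lambda>i. cnj (l i)) @\<^sub>v 0\<^sub>v n"
  define v2 where "v2 = vec n (\<lambda>i. - s * cnj (l i)) @\<^sub>v vec n (\<lambda>i. cnj (h i))"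
  have vecs: "u1 \<in> carrier_vec (2*n)" "u2 \<in> carrier_vec (2*n)" "v1 \<in> carrier_vec (2*n)" "v2 \<in>
      carrier_vec (2*n)"
    unfolding two u1_def u2_def v1_def v2_def by auto

  have zl: "(\<Sum>k<n. z k * l k) = lz"
    by (simp add: l_def lz_def right_diff_distrib sum_subtractf P_def R_def sum_distrib_left
        sum_divide_distrib mult_ac)
  have D1a: "(\<Sum>k<n. M * ((if i = k then 1 else 0) - cnj (z i) * z k / N) * a k) = l i" if "i < n" for i
  proof -
    have "(\<Sum>k<n. z k * a k) = N * lz / M"
    proof -
      have "(\<Sum>k<n. z k * a k) = ((\<Sum>k<n. z k * l k) + (\<Sum>k<n. z k * cnj (z k)) * lz) / M"
        by (simp add: a_def sum_divide_distrib sum_distrib_right sum_distrib_left sum.distrib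
            ring_distribs add_divide_distrib mult_ac)
      then show ?thesis unfolding zl sums by (simp add: N algebra_simps)
    qed
    moreover have "(\<Sum>k<n. M * ((if i = k then 1 else 0) - cnj (z i) * z k / N) * a k)
      = (\<Sum>k<n. ((if i = k then M else 0) + (- (M * cnj (z i) / N)) * z k) * a k)"
      by (intro sum.cong) (auto simp: algebra_simps)
    ultimately have "(\<Sum>k<n. M * ((if i = k then 1 else 0) - cnj (z i) * z k / N) * a k)
      = M * a i + (- (M * cnj (z i) / N)) * (N * lz / M)"
      by (simp only: sum_delta_plus_times(1)[OF that])
    then show ?thesis using N0 M0 by (simp add: a_def)
  qed
  have zw: "(\<Sum>k<n. cnj (z k) * (cnj (x k) - z k * cnj e)) = \<omega>"
    by (simp add: \<omega>_def right_diff_distrib sum_subtractf sums sum_distrib_right[symmetric]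
        mult.assoc[symmetric])
  have Kb: "(\<Sum>k<n. N * ((if i = k then 1 else 0) + z i * cnj (z k)) * b k) = h i" if "i < n" for i
  proof -
    have "(\<Sum>k<n. cnj (z k) * b k) = (\<Sum>k<n. cnj (z k) * (cnj (x k) - z k * cnj e)) - (\<Sum>k<n. cnj (z k)
        * z k) * \<omega> / N"
      by (simp add: b_def sum_subtractf[symmetric] sum_distrib_right sum_distrib_left
          sum_divide_distrib right_diff_distrib mult_ac)
    also have "\<dots> = \<omega> / N"
      unfolding zw sums using N0 by (simp add: RN field_simps)
    finally have "(\<Sum>k<n. cnj (z k) * b k) = \<omega> / N" .
    moreover have "(\<Sum>k<n. N * ((if i = k then 1 else 0) + z i * cnj (z k)) * b k)
      = (\<Sum>k<n. ((if i = k then N else 0) + (N * z i) * cnj (z k)) * b k)"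
      by (intro sum.cong) (auto simp: algebra_simps)
    ultimately have "(\<Sum>k<n. N * ((if i = k then 1 else 0) + z i * cnj (z k)) * b k)
      = N * b i + N * z i * (\<omega> / N)"
      by (simp only: sum_delta_plus_times(1)[OF that])
    then show ?thesis using N0 by (simp add: b_def h_def algebra_simps)
  qed
  have Tm: "- (cnj s) * l i + (\<Sum>k<n. T k i * h k) = g i" if "i < n" for i
  proof -
    have "(\<Sum>k<n. T k i * h k) = cnj (z i) * (\<Sum>k<n. x k * cnj (x k) - x k * z k * cnj e)
        + l i * (\<Sum>k<n. cnj (z k) * (cnj (x k) - z k * cnj e))"
    proof -
      have "T k i * h k = cnj (z i) * (x k * cnj (x k) - x k * z k * cnj e)
          + l i * (cnj (z k) * (cnj (x k) - z k * cnj e))" for k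
        using N0 by (simp add: T_def h_def) (simp add: algebra_simps)
      then show ?thesis by (simp only: sum.distrib sum_distrib_left)
    qed
    also have "\<dots> = cnj (z i) * (Q - P * cnj e) + l i * \<omega>"
      by (simp only: zw sum_subtractf sums sum_distrib_right[symmetric])
    also have "- (cnj s) * l i + \<dots> = cnj (z i) * (Q - P * cnj e) - N * l i * cnj e"
      by (simp add: \<omega>_def s N algebra_simps)
    also have "N * l i = N * x i - s * cnj (z i)"
      using N0 by (simp add: l_def field_simps)
    finally show ?thesis by (simp add: g_def M s algebra_simps)
  qed

  have Dv: "?D *\<^sub>v u1 = vec n l @\<^sub>v 0\<^sub>v n"
    "?D *\<^sub>v u2 = vec n (\<lambda>i. - G * cnj s * l i) @\<^sub>v vec n (\<lambda>i. G * h i)"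
  proof -
    have smult: "vec n (\<lambda>i. c * f i) = c \<cdot>\<^sub>v vec n f" for c and f :: "nat \<Rightarrow> complex" by auto
    have D1: "?D1 *\<^sub>v vec n a = vec n l" and K: "?K *\<^sub>v vec n b = vec n h"
      by (rule eq_vecI; simp add: scalar_prod_def D1a Kb lessThan_atLeast0[symmetric])+
    have scaled: "?D1 *\<^sub>v vec n (\<lambda>i. c * a i) = vec n (\<lambda>i. c * l i)" "?K *\<^sub>v vec n (\<lambda>i. c * b i)
        = vec n (\<lambda>i. c * h i)" for c
      unfolding smult by (simp_all add: mult_mat_vec[of _ n n] D1 K)
    have zero: "?O *\<^sub>v vec n f = 0\<^sub>v n" "0\<^sub>v n + vec n f = vec n f" "vec n f + 0\<^sub>v n = vec n f" for f
      by auto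
    show "?D *\<^sub>v u1 = vec n l @\<^sub>v 0\<^sub>v n"
      unfolding u1_def by (subst four_block_mat_mult_vec[of _ n n _ n _ n]) (auto simp: D1)
    have "?D *\<^sub>v u2 = (?D1 *\<^sub>v vec n (\<lambda>i. - G * cnj s * a i) + ?O *\<^sub>v vec n (\<lambda>i. G * b i))
      @\<^sub>v (?O *\<^sub>v vec n (\<lambda>i. - G * cnj s * a i) + ?K *\<^sub>v vec n (\<lambda>i. G * b i))"
      unfolding u2_def by (rule four_block_mat_mult_vec) auto
    then show "?D *\<^sub>v u2 = vec n (\<lambda>i. - G * cnj s * l i) @\<^sub>v vec n (\<lambda>i. G * h i)"
      by (simp only: scaled zero)
  qed
  have PDv: "?P *\<^sub>v (?D *\<^sub>v u1) = vec n l @\<^sub>v 0\<^sub>v n"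
    "?P *\<^sub>v (?D *\<^sub>v u2) = vec n (\<lambda>i. G * g i) @\<^sub>v vec n (\<lambda>i. G * h i)"
  proof -
    show "?P *\<^sub>v (?D *\<^sub>v u1) = vec n l @\<^sub>v 0\<^sub>v n"
      unfolding Dv by (subst four_block_mat_mult_vec[of _ n n _ n _ n]) auto
    have "vec n (\<lambda>i. - G * cnj s * l i) + ?T *\<^sub>v vec n (\<lambda>i. G * h i) = vec n (\<lambda>i. G * g i)"
    proof (rule eq_vecI)
      fix i assume "i < dim_vec (vec n (\<lambda>i. G * g i))"
      then have i: "i < n" by simp
      have "(vec n (\<lambda>i. - G * cnj s * l i) + ?T *\<^sub>v vec n (\<lambda>i. G * h i)) $ i
         = G * (- (cnj s) * l i + (\<Sum>k<n. T k i * h k))"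
        using i by (simp add: scalar_prod_def lessThan_atLeast0 sum_distrib_left algebra_simps)
      then show "(vec n (\<lambda>i. - G * cnj s * l i) + ?T *\<^sub>v vec n (\<lambda>i. G * h i)) $ i = vec n (\<lambda>i. G
          * g i) $ i"
        using i Tm[OF i] by simp
    qed simp
    then show "?P *\<^sub>v (?D *\<^sub>v u2) = vec n (\<lambda>i. G * g i) @\<^sub>v vec n (\<lambda>i. G * h i)"
      unfolding Dv by (subst four_block_mat_mult_vec[of _ n n _ n _ n]) auto
  qed
  have Qt: "transpose_mat ?Q = four_block_mat ?I (mat n n (\<lambda>(i,j). cnj (T j i))) ?O ?I"
    by (subst transpose_four_block_mat[of _ n n _ n _ n]) (auto intro!: cong_four_block_mat)
  have Qv: "transpose_mat ?Q *\<^sub>v v1 = vec n (\<lambda>i. cnj (l i)) @\<^sub>v 0\<^sub>v n"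
    "transpose_mat ?Q *\<^sub>v v2 = vec n (\<lambda>i. cnj (g i)) @\<^sub>v vec n (\<lambda>i. cnj (h i))"
  proof -
    show "transpose_mat ?Q *\<^sub>v v1 = vec n (\<lambda>i. cnj (l i)) @\<^sub>v 0\<^sub>v n"
      unfolding Qt v1_def by (subst four_block_mat_mult_vec[of _ n n _ n _ n]) auto
    have "vec n (\<lambda>i. - s * cnj (l i)) + mat n n (\<lambda>(i,j). cnj (T j i)) *\<^sub>v vec n (\<lambda>i. cnj (h i))
        = vec n (\<lambda>i. cnj (g i))"
    proof (rule eq_vecI)
      fix i assume "i < dim_vec (vec n (\<lambda>i. cnj (g i)))"
      then have i: "i < n" by simp
      then show "(vec n (\<lambda>i. - s * cnj (l i)) + mat n n (\<lambda>(i,j). cnj (T j i)) *\<^sub>v vec n (\<lambda>i. cnj (h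
          i))) $ i
          = vec n (\<lambda>i. cnj (g i)) $ i"
        using arg_cong[OF Tm[OF i], of cnj] by (simp add: scalar_prod_def lessThan_atLeast0)
    qed simp
    then show "transpose_mat ?Q *\<^sub>v v2 = vec n (\<lambda>i. cnj (g i)) @\<^sub>v vec n (\<lambda>i. cnj (h i))"
      unfolding Qt v2_def by (subst four_block_mat_mult_vec[of _ n n _ n _ n]) auto
  qed

  (* U is the mixed block of the Levi form. *)
  define U where "U = (\<lambda>i j. x j * cnj (z i) + N * x i * cnj (z j) - e * cnj (z i) * cnj (z j))"
  have TK: "(\<Sum>k<n. T k i * (N * ((if k = j then 1 else 0) + z k * cnj (z j))))
      = U i j" if "j < n" for i j
  proof -
    have "(\<Sum>k<n. T k i * (N * ((if k = j then 1 else 0) + z k * cnj (z j))))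
       = N * (\<Sum>k<n. T k i * ((if k = j then 1 else 0) + z k * cnj (z j)))"
      by (simp add: sum_distrib_left mult_ac)
    also have "(\<Sum>k<n. T k i * ((if k = j then 1 else 0) + z k * cnj (z j)))
       = T j i + (\<Sum>k<n. T k i * z k) * cnj (z j)"
      using that by (simp add: sum_delta_plus_times(2))
    also have "(\<Sum>k<n. T k i * z k) = (P * cnj (z i) + R * l i) / N"
      by (simp add: T_def P_def R_def sum_distrib_left sum_distrib_right sum_divide_distrib
          sum.distrib add_divide_distrib ring_distribs mult_ac)
    finally show ?thesis
      unfolding U_def T_def using shear_identity_mixed[OF N N0 s l_def[THEN fun_cong, of i]] by simp
  qed
  have KT: "(\<Sum>k<n. (N * ((if i = k then 1 else 0) + z i * cnj (z k))) * cnj (T k j))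
      = cnj (U j i)" if "i < n" for i j
  proof -
    have "(\<Sum>k<n. (N * ((if i = k then 1 else 0) + z i * cnj (z k))) * cnj (T k j))
       = cnj (\<Sum>k<n. T k j * (N * ((if k = i then 1 else 0) + z k * cnj (z i))))"
      by (simp add: real if_distrib[of cnj] mult_ac) (auto intro!: sum.cong)
    then show ?thesis using TK[OF that] by simp
  qed
  have UT: "M * ((if i = j then 1 else 0) - cnj (z i) * z j / N) + (\<Sum>k<n. U i k * cnj (T k j)) + l i
      * cnj (l j)
     = M * (if i = j then 1 else 0) + N * x i * cnj (x j) - cnj (z i) * cnj (x j) * e - x i * z j
         * cnj e" for i j
  proof -
    have "(\<Sum>k<n. U i k * cnj (T k j)) =
       (z j * (cnj (z i) * (\<Sum>k<n. x k * cnj (x k)) + N * x i * (\<Sum>k<n. cnj (x k) * cnj (z k)) - e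
           * cnj (z i) * (\<Sum>k<n. cnj (x k) * cnj (z k)))
       + cnj (l j) * ((\<Sum>k<n. x k * z k) * cnj (z i) + N * x i * (\<Sum>k<n. z k * cnj (z k)) - e
           * cnj (z i) * (\<Sum>k<n. z k * cnj (z k)))) / N"
      by (simp add: U_def T_def real sum_distrib_left sum_distrib_right sum_divide_distrib
          sum.distrib sum_subtractf
           add_divide_distrib diff_divide_distrib ring_distribs mult_ac)
    then show ?thesis
      unfolding sums
      using shear_identity_base[OF N N0 s, of "cnj s" "cnj e" "cnj P" M Q "l i" "x i" "cnj (z i)"
          "cnj (l j)" "cnj (x j)" "z j" "if i = j then 1 else 0"]
      by (simp add: s M l_def real)
  qed

  have PDQ: "?P * ?D * ?Q = four_block_mat (mat n n (\<lambda>(i,j). M * ((if i = j then 1 else 0)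
      - cnj (z i) * z j / N) + (\<Sum>k<n. U i k * cnj (T k j))))
     (mat n n (\<lambda>(i,j). U i j)) (mat n n (\<lambda>(i,j). cnj (U j i))) ?K"
  proof -
    have TK': "?T * ?K = mat n n (\<lambda>(i,j). U i j)"
      by (rule eq_matI) (simp_all add: scalar_prod_def TK lessThan_atLeast0[symmetric])
    have KT': "?K * ?Tc = mat n n (\<lambda>(i,j). cnj (U j i))"
      by (rule eq_matI) (simp_all add: scalar_prod_def KT lessThan_atLeast0[symmetric])
    have "?P * ?D = four_block_mat ?D1 (?T * ?K) ?O ?K"
      by (subst mult_four_block_mat[of _ n n _ n _ n _ _ n _ n]) auto
    then have "?P * ?D * ?Q = four_block_mat (?D1 + mat n n (\<lambda>(i,j). U i j)
        * ?Tc) (mat n n (\<lambda>(i,j). U i j)) (?K * ?Tc) ?K"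
      unfolding TK' by (simp, subst mult_four_block_mat[of _ n n _ n _ n _ _ n _ n]) auto
    also have "?D1 + mat n n (\<lambda>(i,j). U i j) * ?Tc = mat n n (\<lambda>(i,j). M * ((if i = j then 1 else 0)
        - cnj (z i) * z j / N) + (\<Sum>k<n. U i k * cnj (T k j)))"
      by (rule eq_matI) (simp_all add: scalar_prod_def lessThan_atLeast0[symmetric])
    finally show ?thesis unfolding KT' .
  qed

  have "A = F \<cdot>\<^sub>m (?P * ?D * ?Q)
      + F \<cdot>\<^sub>m mat (2*n) (2*n) (\<lambda>(i,j). (?P *\<^sub>v (?D *\<^sub>v u1)) $ i * (transpose_mat ?Q *\<^sub>v v1) $ j)
      + mat (2*n) (2*n) (\<lambda>(i,j). (?P *\<^sub>v (?D *\<^sub>v u2)) $ i * (transpose_mat ?Q *\<^sub>v v2) $ j)" (is "A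
          = ?B")
    unfolding PDQ PDv Qv
  proof (rule eq_matI, goal_cases)
    case (1 i j)
    then have ij: "i < 2*n" "j < 2*n" by simp_all
    have split: "k < n \<or> (\<exists>k'. k = n + k' \<and> k' < n)" if "k < 2*n" for k
      using that by (metis less_diff_conv2 add_diff_inverse_nat mult_2 not_le)
    from split[OF ij(1)] split[OF ij(2)] show ?case
      apply (elim disjE exE conjE)
      subgoal by (simp add: A11 UT[symmetric]) (simp add: algebra_simps)
      subgoal by (simp add: A12 U_def)
      subgoal by (simp add: A21 U_def real)
      subgoal by (simp add: A22)
      done
  qed (use A in auto)
  from det_congruent_two_dyads[OF _ carr det1 vecs this] n
  have detA: "Determinant.det A = (N*M)^n * F ^ (2*n - 1) * ((1 + v1 \<bullet> u1) * (F + v2 \<bullet> u2)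
      - (v1 \<bullet> u2) * (v2 \<bullet> u1))"
    by (simp add: detD)
  have la: "(\<Sum>i<n. cnj (l i) * a i) = q"
  proof -
    have "(\<Sum>i<n. cnj (l i) * a i) = ((\<Sum>i<n. cnj (l i) * l i) + cnj (\<Sum>i<n. z i * l i) * lz) / M"
      by (simp add: a_def sum_divide_distrib sum_distrib_right sum_distrib_left sum.distrib
          ring_distribs add_divide_distrib mult_ac)
    also have "(\<Sum>i<n. cnj (l i) * l i) = Q - cnj s * P / N - s * cnj P / N + s * cnj s * R / N^2"
      by (simp add: l_def real P_def Q_def R_def sum_divide_distrib sum_distrib_left sum.distrib
          sum_subtractf ring_distribs
        add_divide_distrib diff_divide_distrib mult_ac power2_eq_square)
    also have "(\<dots> + cnj (\<Sum>i<n. z i * l i) * lz) = M - s * cnj s / N"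
    proof -
      have "N^2 * (Q - cnj s * P / N - s * cnj P / N + s * cnj s * R / N^2 + cnj lz * lz)
         = N^2 * Q - N * cnj s * P - N * s * cnj P + s * cnj s * R + (N * cnj P - cnj s * R) * (N
             * P - s * R)"
        using N0 by (simp add: lz_def real field_simps power2_eq_square)
      also have "\<dots> = N^2 * (M - s * cnj s / N)"
      proof -
        have "N^2 * (M - s * cnj s / N) = N^2 * M - N * (s * cnj s)"
          using N0 by (simp add: field_simps power2_eq_square)
        then show ?thesis unfolding M s by (simp add: N power2_eq_square algebra_simps)
      qed
      finally show ?thesis using N0 by (simp add: zl)
    qed
    finally show ?thesis using N0 M0 by (simp add: q_def field_simps)
  qed
  have hb: "(\<Sum>i<n. cnj (h i) * b i) = N*M - s * cnj s"
  proof -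
    have "(\<Sum>i<n. cnj (h i) * b i) = N * ((\<Sum>i<n. x i * cnj (x i)) - (\<Sum>i<n. x i * z i) * cnj e
        - (\<Sum>i<n. cnj (x i) * cnj (z i)) * e + (\<Sum>i<n. z i * cnj (z i)) * e * cnj e)
        - ((\<Sum>i<n. x i * z i) - (\<Sum>i<n. z i * cnj (z i)) * e) * \<omega>"
      using N0 by (simp add: h_def b_def real sum_distrib_left sum_distrib_right sum.distrib
          sum_subtractf ring_distribs
        mult_ac)
    also have "\<dots> = N*M - s * cnj s"
      unfolding sums \<omega>_def M s N by (simp add: real algebra_simps)
    finally show ?thesis .
  qed
  have dots: "v1 \<bullet> u1 = q" "v2 \<bullet> u2 = G * (s * cnj s * q + (N*M - s * cnj s))"
    "v1 \<bullet> u2 = - G * cnj s * q" "v2 \<bullet> u1 = - s * q"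
  proof -
    have sp: "vec n f \<bullet> vec n f' = (\<Sum>i<n. f i * f' i)" for f f' :: "nat \<Rightarrow> complex"
      by (simp add: scalar_prod_def lessThan_atLeast0)
    have pull: "(\<Sum>i<n. (c * f i) * (c' * f' i)) = c * c' * (\<Sum>i<n. f i
        * f' i)" for c c' and f f' :: "nat \<Rightarrow> complex"
      by (simp add: sum_distrib_left mult_ac)
    note app = scalar_prod_append[OF vec_carrier vec_carrier vec_carrier vec_carrier]
    have zero: "0\<^sub>v n = vec n (\<lambda>_. 0::complex)" by auto
    show "v1 \<bullet> u1 = q" "v2 \<bullet> u2 = G * (s * cnj s * q + (N*M - s * cnj s))"
      "v1 \<bullet> u2 = - G * cnj s * q" "v2 \<bullet> u1 = - s * q"
      unfolding v1_def u1_def v2_def u2_def zero app sp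
      using la pull[of "-s" "\<lambda>i. cnj (l i)" "-G*cnj s" a, unfolded la]
        pull[of 1 "\<lambda>i. cnj (h i)" G b, unfolded hb]
        pull[of 1 "\<lambda>i. cnj (l i)" "-G*cnj s" a, unfolded la] pull[of "-s" "\<lambda>i. cnj (l i)" 1 a,
            unfolded la]
      by (simp_all add: algebra_simps)
  qed
  have "Determinant.det A = (N*M)^n * F ^ (2*n - 1) *
    ((1 + q) * (F + G * (s * cnj s * q + (N*M - s * cnj s))) - (- G * cnj s * q) * (- s * q))"
    using detA unfolding dots .
  also have "\<dots> = (N*M)^(n-1) * F ^ (2*n - 1) * ((N*M) * ((1 + q) * (F + G * (s * cnj s * q + (N*M
      - s * cnj s))) - (- G * cnj s * q) * (- s * q)))"
    using n by (cases n) (simp_all add: mult_ac)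
  also have "(N*M) * ((1 + q) * (F + G * (s * cnj s * q + (N*M - s * cnj s))) - (- G * cnj s * q)
      * (- s * q))
     = F * (2 * (N*M) - s * cnj s) + 2 * G * (N*M) * (N*M - s * cnj s)"
  proof -
    define \<tau> where "\<tau> = N*M"
    define \<tau>0 where "\<tau>0 = s * cnj s"
    have q: "\<tau> * q = \<tau> - \<tau>0" using N0 M0 by (simp add: q_def \<tau>_def \<tau>0_def)
    have "\<tau> * ((1 + q) * (F + G * (\<tau>0 * q + (\<tau> - \<tau>0))) - G * \<tau>0 * q * q)
      = F * (\<tau> + \<tau> * q) + G * (\<tau>0 * (\<tau> * q) + (\<tau> - \<tau>0) * (\<tau> + \<tau> * q))"
      by (simp add: algebra_simps)
    also have "\<dots> = F * (2 * \<tau> - \<tau>0) + 2 * G * \<tau> * (\<tau> - \<tau>0)"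
      unfolding q by (simp add: algebra_simps)
    finally show ?thesis unfolding \<tau>_def \<tau>0_def by (simp add: mult_ac)
  qed
  finally have "Determinant.det A = (N*M)^(n-1) * F ^ (2*n - 1) * (F * (2 * (N*M) - s * cnj s) + 2
      * G * (N*M) * (N*M - s * cnj s))" .
  moreover have "F ^ (2*n) = F ^ (2*n-1) * F" "(N*M)^n = (N*M)^(n-1) * (N*M)"
    using n by (cases n; simp)+
  ultimately show ?thesis by (simp add: algebra_simps)
qed

section \<open>The Levi form of tau\<close>

definition eta :: "nat \<Rightarrow> complex \<Rightarrow> complex vec \<Rightarrow> complex" where
  "eta n s p = s - (\<Sum>k<n. p $ (n+k) * p $ k)"

definition base_norm :: "nat \<Rightarrow> complex vec \<Rightarrow> real" where
  "base_norm n p = 1 + (\<Sum>k<n. (cmod (p $ k))\<^sup>2)"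

definition fibre_norm :: "nat \<Rightarrow> complex \<Rightarrow> complex vec \<Rightarrow> real" where
  "fibre_norm n s p = (\<Sum>k<n. (cmod (p $ (n+k)))\<^sup>2) + (cmod (eta n s p))\<^sup>2"

definition tau_fun :: "nat \<Rightarrow> complex \<Rightarrow> complex vec \<Rightarrow> real" where
  "tau_fun n s p = base_norm n p * fibre_norm n s p"

text \<open>
  The complex linear forms that occur are stored by their \<open>2 n\<close> coefficients.  Below, \<open>del_base\<close>,
  \<open>del_eta\<close>, \<open>del_fibre\<close> and \<open>del_tau\<close> are the coefficients of \<open>\<partial>N\<close>, \<open>d\<eta>\<close>, \<open>\<partial>M\<close> and \<open>\<partial>\<tau>\<close>, where
  \<open>\<eta> = s - \<xi> z\<close> is holomorphic.
\<close>

definition lin_form :: "nat \<Rightarrow> (nat \<Rightarrow> complex) \<Rightarrow> complex vec \<Rightarrow> complex" where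
  "lin_form n c v = (\<Sum>i<2*n. c i * v $ i)"

definition del_base :: "nat \<Rightarrow> complex vec \<Rightarrow> nat \<Rightarrow> complex" where
  "del_base n p i = (if i < n then cnj (p $ i) else 0)"

definition del_eta :: "nat \<Rightarrow> complex vec \<Rightarrow> nat \<Rightarrow> complex" where
  "del_eta n p i = (if i < n then - p $ (n+i) else - p $ (i-n))"

definition del_fibre :: "nat \<Rightarrow> complex \<Rightarrow> complex vec \<Rightarrow> nat \<Rightarrow> complex" where
  "del_fibre n s p i = (if i < n then 0 else cnj (p $ i)) + del_eta n p i * cnj (eta n s p)"

definition del_tau :: "nat \<Rightarrow> complex \<Rightarrow> complex vec \<Rightarrow> nat \<Rightarrow> complex" where
  "del_tau n s p i = del_base n p i * fibre_norm n s p + base_norm n p * del_fibre n s p i"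

definition levi_tau :: "nat \<Rightarrow> complex \<Rightarrow> complex vec \<Rightarrow> nat \<Rightarrow> nat \<Rightarrow> complex" where
  "levi_tau n s p i j = (if i = j then of_real (if i < n then fibre_norm n s p else base_norm n p)
      else 0)
     + base_norm n p * del_eta n p i * cnj (del_eta n p j)
     + del_base n p i * cnj (del_fibre n s p j) + del_fibre n s p i * cnj (del_base n p j)"

lemma sum_lessThan_double:
  "(\<Sum>i<2*n. f i) = (\<Sum>i<n. f i) + (\<Sum>i<n. f (n+i))" for f :: "nat \<Rightarrow> 'a::comm_monoid_add"
proof -
  have "(\<Sum>i<n. f (n+i)) = sum f {n..<n+n}"
    using sum.shift_bounds_nat_ivl[of f 0 n n] by (simp add: lessThan_atLeast0 add.commute)
  then show ?thesis
    by (simp add: mult_2 lessThan_atLeast0 sum.atLeastLessThan_concat)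
qed

lemma lin_form_unit:
  assumes "i < 2*n"
  shows "lin_form n c (unit_vec (2*n) i) = c i" "lin_form n c (a \<cdot>\<^sub>v unit_vec (2*n) i) = a * c i"
proof -
  have "lin_form n c (a \<cdot>\<^sub>v unit_vec (2*n) i) = (\<Sum>k<2*n. if k = i then a * c i else 0)" for a
    unfolding lin_form_def using assms by (intro sum.cong) auto
  then have *: "lin_form n c (a \<cdot>\<^sub>v unit_vec (2*n) i) = a * c i" for a using assms by simp
  show "lin_form n c (a \<cdot>\<^sub>v unit_vec (2*n) i) = a * c i" by (rule *)
  show "lin_form n c (unit_vec (2*n) i) = c i" using *[of 1] by simp
qed

lemma has_vector_derivative_cnj:
  assumes "(F has_vector_derivative F') (at t)"
  shows "((\<lambda>t. cnj (F t)) has_vector_derivative cnj F') (at t)"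
  using bounded_linear.has_vector_derivative[OF bounded_linear_cnj assms] .

lemma has_real_derivative_cmod_square:
  assumes "(F has_vector_derivative F') (at t)"
  shows "((\<lambda>t. (cmod (F t))\<^sup>2) has_real_derivative 2 * Re (F' * cnj (F t))) (at t)"
proof -
  have Re: "((\<lambda>t. Re (F t)) has_real_derivative Re F') (at t)"
    using bounded_linear.has_vector_derivative[OF bounded_linear_Re assms]
    by (simp add: has_real_derivative_iff_has_vector_derivative)
  have Im: "((\<lambda>t. Im (F t)) has_real_derivative Im F') (at t)"
    using bounded_linear.has_vector_derivative[OF bounded_linear_Im assms]
    by (simp add: has_real_derivative_iff_has_vector_derivative)
  show ?thesis
    using DERIV_add[OF DERIV_power[OF Re, of 2] DERIV_power[OF Im, of 2]]
    unfolding cmod_power2 by (simp add: algebra_simps)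
qed

lemma has_vector_derivative_complex_of_real:
  "(F has_real_derivative F') (at t) \<Longrightarrow> ((\<lambda>t. complex_of_real (F t)) has_vector_derivative of_real
      F') (at t)"
  by (simp add: has_vector_derivative_of_real has_real_derivative_iff_has_vector_derivative)

lemma lin_form_del_tau: "lin_form n (del_tau n s q) w = lin_form n (del_base n q) w
    * fibre_norm n s q + base_norm n q * lin_form n (del_fibre n s q) w"
  by (simp add: lin_form_def del_tau_def sum_distrib_left sum_distrib_right sum.distrib
      distrib_right distrib_left mult_ac)

definition line :: "complex vec \<Rightarrow> complex vec \<Rightarrow> real \<Rightarrow> complex vec" where
  "line p v t = p + of_real t \<cdot>\<^sub>v v"

text \<open>
  The second derivative of \<open>\<eta>\<close>.  It enters the second derivative of \<open>\<tau>\<close> only through a symmetric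
  term, which drops out of the exterior derivative.
\<close>

definition hess_eta :: "nat \<Rightarrow> complex vec \<Rightarrow> complex vec \<Rightarrow> complex" where
  "hess_eta n v w = - (\<Sum>k<n. v $ (n+k) * w $ k + v $ k * w $ (n+k))"

text \<open>
  The derivative of \<open>\<partial>\<tau>(w)\<close> in the real direction \<open>v\<close>; it mixes the Levi form with terms that are
  complex bilinear and symmetric in \<open>v\<close> and \<open>w\<close>.
\<close>

definition hess_tau :: "nat \<Rightarrow> complex \<Rightarrow> complex vec \<Rightarrow> complex vec \<Rightarrow> complex vec \<Rightarrow> complex" where
  "hess_tau n s p v w = (\<Sum>k<n. w $ k * cnj (v $ k)) * fibre_norm n s p
    + lin_form n (del_base n p) w * (2 * Re (lin_form n (del_fibre n s p) v))
    + (2 * Re (lin_form n (del_base n p) v)) * lin_form n (del_fibre n s p) w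
    + base_norm n p * ((\<Sum>k<n. w $ (n+k) * cnj (v $ (n+k)))
      + lin_form n (del_eta n p) w * cnj (lin_form n (del_eta n p) v) + hess_eta n v w
          * cnj (eta n s p))"

context
  fixes n :: nat and s :: complex and p v :: "complex vec"
  assumes p: "p \<in> carrier_vec (2*n)" and v: "v \<in> carrier_vec (2*n)"
begin

lemma line_0 [simp]: "line p v 0 = p"
  using p v by (auto simp: line_def)

lemma line_carrier [simp]: "line p v t \<in> carrier_vec (2*n)" "dim_vec (line p v t) = 2*n"
  using p v by (auto simp: line_def)

lemma line_deriv:
  assumes "i < 2*n" shows "((\<lambda>t. line p v t $ i) has_vector_derivative v $ i) (at 0)"
proof -
  have "line p v t $ i = p $ i + of_real t * v $ i" for t
    using assms p v by (simp add: line_def)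
  then show ?thesis
    by (auto intro!: derivative_eq_intros has_vector_derivative_of_real)
qed

lemma eta_deriv: "((\<lambda>t. eta n s (line p v t)) has_vector_derivative lin_form n (del_eta n p) v) (at 0)"
proof -
  have "((\<lambda>t. eta n s (line p v t)) has_vector_derivative
      0 - (\<Sum>k<n. line p v 0 $ (n+k) * v $ k + v $ (n+k) * line p v 0 $ k)) (at 0)"
    unfolding eta_def
    by (intro has_vector_derivative_diff has_vector_derivative_const has_vector_derivative_sum
        has_vector_derivative_mult line_deriv) auto
  also have "0 - (\<Sum>k<n. line p v 0 $ (n+k) * v $ k + v $ (n+k) * line p v 0 $ k)
      = lin_form n (del_eta n p) v"
    unfolding lin_form_def sum_lessThan_double by (simp add: del_eta_def sum_negf sum.distrib
        mult.commute)
  finally show ?thesis .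
qed

lemma base_norm_deriv:
  "((\<lambda>t. base_norm n (line p v t)) has_real_derivative 2 * Re (lin_form n (del_base n p) v)) (at 0)"
proof -
  have "((\<lambda>t. base_norm n (line p v t)) has_real_derivative
      0 + (\<Sum>k<n. 2 * Re (v $ k * cnj (line p v 0 $ k)))) (at 0)"
    unfolding base_norm_def
    by (intro DERIV_add DERIV_const DERIV_sum has_real_derivative_cmod_square line_deriv) auto
  also have "0 + (\<Sum>k<n. 2 * Re (v $ k * cnj (line p v 0 $ k))) = 2 * Re (lin_form n (del_base n p) v)"
    unfolding lin_form_def sum_lessThan_double by (simp add: del_base_def sum_distrib_left
        algebra_simps)
  finally show ?thesis .
qed

lemma fibre_norm_deriv:
  "((\<lambda>t. fibre_norm n s (line p v t)) has_real_derivative 2 * Re (lin_form n (del_fibre n s p) v))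
      (at 0)"
proof -
  have "((\<lambda>t. fibre_norm n s (line p v t)) has_real_derivative
      (\<Sum>k<n. 2 * Re (v $ (n+k) * cnj (line p v 0 $ (n+k)))) + 2 * Re (lin_form n (del_eta n p) v
          * cnj (eta n s (line p v 0)))) (at 0)"
    unfolding fibre_norm_def
    by (intro DERIV_add DERIV_sum has_real_derivative_cmod_square line_deriv eta_deriv) auto
  also have "(\<Sum>k<n. 2 * Re (v $ (n+k) * cnj (line p v 0 $ (n+k)))) + 2
      * Re (lin_form n (del_eta n p) v * cnj (eta n s (line p v 0)))
     = 2 * Re ((\<Sum>k<n. v $ (n+k) * cnj (p $ (n+k))) + lin_form n (del_eta n p) v * cnj (eta n s p))"
    by (simp add: sum_distrib_left)
  also have "(\<Sum>k<n. v $ (n+k) * cnj (p $ (n+k))) + lin_form n (del_eta n p) v * cnj (eta n s p)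
      = lin_form n (del_fibre n s p) v"
    unfolding lin_form_def sum_lessThan_double by (simp add: del_fibre_def sum_distrib_right
        sum_distrib_left sum.distrib distrib_right distrib_left mult_ac)
  finally show ?thesis .
qed

lemma tau_fun_deriv:
  "((\<lambda>t. tau_fun n s (line p v t)) has_real_derivative 2 * Re (lin_form n (del_tau n s p) v)) (at 0)"
proof -
  have "((\<lambda>t. tau_fun n s (line p v t)) has_real_derivative
      2 * Re (lin_form n (del_base n p) v) * fibre_norm n s (line p v 0) + 2
          * Re (lin_form n (del_fibre n s p) v) * base_norm n (line p v 0)) (at 0)"
    unfolding tau_fun_def by (intro DERIV_mult base_norm_deriv fibre_norm_deriv)
  then show ?thesis by (simp add: lin_form_del_tau algebra_simps)
qed

lemma del_base_deriv:
  "((\<lambda>t. lin_form n (del_base n (line p v t)) w) has_vector_derivative (\<Sum>k<n. w $ k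
      * cnj (v $ k))) (at 0)"
proof -
  have "((\<lambda>t. \<Sum>k<n. w $ k * cnj (line p v t $ k)) has_vector_derivative (\<Sum>k<n. w $ k
      * cnj (v $ k))) (at 0)"
    by (intro has_vector_derivative_sum has_vector_derivative_mult_right has_vector_derivative_cnj
        line_deriv) auto
  then show ?thesis
    unfolding lin_form_def sum_lessThan_double by (simp add: del_base_def mult.commute)
qed

lemma del_eta_deriv:
  "((\<lambda>t. lin_form n (del_eta n (line p v t)) w) has_vector_derivative hess_eta n v w) (at 0)"
proof -
  have "((\<lambda>t. - (\<Sum>k<n. line p v t $ (n+k) * w $ k + line p v t $ k
      * w $ (n+k))) has_vector_derivative hess_eta n v w) (at 0)"
    unfolding hess_eta_def
    by (intro has_vector_derivative_minus has_vector_derivative_sum has_vector_derivative_add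
        has_vector_derivative_mult_left line_deriv) auto
  then show ?thesis
    unfolding lin_form_def sum_lessThan_double by (simp add: del_eta_def sum_negf sum.distrib)
qed

lemma del_fibre_deriv:
  "((\<lambda>t. lin_form n (del_fibre n s (line p v t)) w) has_vector_derivative
    (\<Sum>k<n. w $ (n+k) * cnj (v $ (n+k))) + (lin_form n (del_eta n p) w
        * cnj (lin_form n (del_eta n p) v) + hess_eta n v w * cnj (eta n s p))) (at 0)"
proof -
  have "((\<lambda>t. (\<Sum>k<n. w $ (n+k) * cnj (line p v t $ (n+k))) + lin_form n (del_eta n (line p v t)) w
      * cnj (eta n s (line p v t)))
    has_vector_derivative (\<Sum>k<n. w $ (n+k) * cnj (v $ (n+k))) +
      (lin_form n (del_eta n (line p v 0)) w * cnj (lin_form n (del_eta n p) v) + hess_eta n v w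
          * cnj (eta n s (line p v 0)))) (at 0)"
    by (intro has_vector_derivative_add has_vector_derivative_sum has_vector_derivative_mult_right
        has_vector_derivative_mult
        has_vector_derivative_cnj line_deriv del_eta_deriv eta_deriv) auto
  moreover have "(\<Sum>k<n. w $ (n+k) * cnj (q $ (n+k))) + lin_form n (del_eta n q) w * cnj (eta n s q)
      = lin_form n (del_fibre n s q) w" for q
    unfolding lin_form_def sum_lessThan_double by (simp add: del_fibre_def sum_distrib_right
        sum_distrib_left sum.distrib distrib_right distrib_left mult_ac)
  ultimately show ?thesis by simp
qed

lemma del_tau_deriv:
  "((\<lambda>t. lin_form n (del_tau n s (line p v t)) w) has_vector_derivative hess_tau n s p v w) (at 0)"
proof -
  have "((\<lambda>t. lin_form n (del_tau n s (line p v t)) w) has_vector_derivative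
     (lin_form n (del_base n (line p v 0)) w * of_real (2 * Re (lin_form n (del_fibre n s p) v))
       + (\<Sum>k<n. w $ k * cnj (v $ k)) * of_real (fibre_norm n s (line p v 0))) +
     (of_real (base_norm n (line p v 0)) * ((\<Sum>k<n. w $ (n+k) * cnj (v $ (n+k)))
        + (lin_form n (del_eta n p) w * cnj (lin_form n (del_eta n p) v) + hess_eta n v w
            * cnj (eta n s p)))
       + of_real (2 * Re (lin_form n (del_base n p) v)) * lin_form n (del_fibre n s (line p v 0))
           w)) (at 0)"
    unfolding lin_form_del_tau
    by (intro has_vector_derivative_add has_vector_derivative_mult del_base_deriv del_fibre_deriv
       has_vector_derivative_complex_of_real base_norm_deriv fibre_norm_deriv)
  then show ?thesis by (simp add: hess_tau_def algebra_simps)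
qed

end

section \<open>The components of the Kaehler form\<close>

definition kaehler_matrix :: "nat \<Rightarrow> complex \<Rightarrow> (real \<Rightarrow> real) \<Rightarrow> complex vec \<Rightarrow> complex mat" where
  "kaehler_matrix n s f p = mat (2*n) (2*n) (\<lambda>(i,j).
     f (tau_fun n s p) * levi_tau n s p i j
     + deriv f (tau_fun n s p) * (del_tau n s p i * cnj (del_tau n s p j)))"

definition sesq :: "nat \<Rightarrow> complex mat \<Rightarrow> complex vec \<Rightarrow> complex vec \<Rightarrow> complex" where
  "sesq m A v w = (\<Sum>i<m. \<Sum>j<m. A $$ (i,j) * (v $ i * cnj (w $ j)))"

lemma lin_form_mult_cnj:
  "lin_form n c v * cnj (lin_form n d w) = (\<Sum>i<2*n. \<Sum>j<2*n. c i * cnj (d j) * (v $ i * cnj (w $ j)))"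
  by (simp add: lin_form_def sum_product mult_ac)

lemma sesq_kaehler_matrix:
  "sesq (2*n) (kaehler_matrix n s f p) v w =
    f (tau_fun n s p) * (fibre_norm n s p * (\<Sum>k<n. v $ k * cnj (w $ k)) + base_norm n p
        * (\<Sum>k<n. v $ (n+k) * cnj (w $ (n+k)))
      + base_norm n p * (lin_form n (del_eta n p) v * cnj (lin_form n (del_eta n p) w))
      + lin_form n (del_base n p) v * cnj (lin_form n (del_fibre n s p) w)
      + lin_form n (del_fibre n s p) v * cnj (lin_form n (del_base n p) w))
    + deriv f (tau_fun n s p) * (lin_form n (del_tau n s p) v * cnj (lin_form n (del_tau n s p) w))"
proof -
  let ?M = "complex_of_real (fibre_norm n s p)" and ?N = "complex_of_real (base_norm n p)"
  have diag: "?M * (\<Sum>k<n. v $ k * cnj (w $ k)) + ?N * (\<Sum>k<n. v $ (n+k) * cnj (w $ (n+k)))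
     = (\<Sum>i<2*n. \<Sum>j<2*n. (if i = j then of_real (if i < n then fibre_norm n s p else base_norm n p)
         else 0) * (v $ i * cnj (w $ j)))"
  proof -
    have "(\<Sum>j<2*n. (if i = j then of_real (if i < n then fibre_norm n s p else base_norm n p) else
        0) * (v $ i * cnj (w $ j)))
      = (if i < n then ?M else ?N) * (v $ i * cnj (w $ i))" if "i < 2*n" for i
    proof -
      have "(\<Sum>j<2*n. (if i = j then of_real (if i < n then fibre_norm n s p else base_norm n p) else
          0) * (v $ i * cnj (w $ j)))
        = (\<Sum>j<2*n. if j = i then (if i < n then ?M else ?N) * (v $ i * cnj (w $ i)) else 0)"
        by (intro sum.cong) auto
      then show ?thesis using that by simp
    qed
    then have "(\<Sum>i<2*n. \<Sum>j<2*n. (if i = j then of_real (if i < n then fibre_norm n s p else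
        base_norm n p) else 0) * (v $ i * cnj (w $ j)))
      = (\<Sum>i<2*n. (if i < n then ?M else ?N) * (v $ i * cnj (w $ i)))"
      by (intro sum.cong) auto
    then show ?thesis
      by (simp only: sum_lessThan_double sum_distrib_left) simp
  qed
  have "sesq (2*n) (kaehler_matrix n s f p) v w = (\<Sum>i<2*n. \<Sum>j<2*n.
      f (tau_fun n s p) * ((if i = j then of_real (if i < n then fibre_norm n s p else base_norm n
          p) else 0) * (v $ i * cnj (w $ j)))
      + f (tau_fun n s p) * ?N * (del_eta n p i * cnj (del_eta n p j) * (v $ i * cnj (w $ j)))
      + f (tau_fun n s p) * (del_base n p i * cnj (del_fibre n s p j) * (v $ i * cnj (w $ j)))
      + f (tau_fun n s p) * (del_fibre n s p i * cnj (del_base n p j) * (v $ i * cnj (w $ j)))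
      + deriv f (tau_fun n s p) * (del_tau n s p i * cnj (del_tau n s p j) * (v $ i * cnj (w $ j))))"
    unfolding sesq_def kaehler_matrix_def levi_tau_def by (intro sum.cong refl) (simp add:
        algebra_simps)
  also have "\<dots> = f (tau_fun n s p) * (?M * (\<Sum>k<n. v $ k * cnj (w $ k)) + ?N * (\<Sum>k<n. v $ (n+k)
      * cnj (w $ (n+k))))
      + f (tau_fun n s p) * ?N * (lin_form n (del_eta n p) v * cnj (lin_form n (del_eta n p) w))
      + f (tau_fun n s p) * (lin_form n (del_base n p) v * cnj (lin_form n (del_fibre n s p) w))
      + f (tau_fun n s p) * (lin_form n (del_fibre n s p) v * cnj (lin_form n (del_base n p) w))
      + deriv f (tau_fun n s p) * (lin_form n (del_tau n s p) v * cnj (lin_form n (del_tau n s p) w))"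
    unfolding diag lin_form_mult_cnj by (simp only: sum.distrib sum_distrib_left)
  finally show ?thesis by (simp add: algebra_simps)
qed

lemma hess_eta_commute: "hess_eta n v w = hess_eta n w v"
  unfolding hess_eta_def by (simp add: algebra_simps)

lemma sesq_antisymmetric_part:
  assumes "\<And>i j. i < m \<Longrightarrow> j < m \<Longrightarrow> A $$ (j,i) = cnj (A $$ (i,j))"
  shows "\<i> / 2 * (\<Sum>i<m. \<Sum>j<m. A $$ (i,j) * (v $ i * cnj (w $ j) - w $ i * cnj (v $ j))) =
      - of_real (Im (sesq m A v w))"
proof -
  have "(\<Sum>i<m. \<Sum>j<m. A $$ (i,j) * (w $ i * cnj (v $ j))) = (\<Sum>j<m. \<Sum>i<m. A $$ (i,j) * (w $ i
      * cnj (v $ j)))"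
    by (rule sum.swap)
  also have "\<dots> = cnj (sesq m A v w)"
  proof -
    have "A $$ (i,j) * (w $ i * cnj (v $ j)) = cnj (A $$ (j,i) * (v $ j
        * cnj (w $ i)))" if "i < m" "j < m" for i j
      unfolding assms[OF that(2,1)] by simp
    then show ?thesis
      unfolding sesq_def cnj_sum by (intro sum.cong refl) auto
  qed
  finally have "(\<Sum>i<m. \<Sum>j<m. A $$ (i,j) * (v $ i * cnj (w $ j) - w $ i * cnj (v $ j)))
      = sesq m A v w - cnj (sesq m A v w)"
    by (simp add: sesq_def right_diff_distrib sum_subtractf)
  then show ?thesis by (simp add: complex_eq_iff)
qed

text \<open>
  Evaluating at a basis vector and at \<open>\<i>\<close> times a basis vector yields the differences and the sums of
  the entries at \<open>(k, l)\<close> and \<open>(l, k)\<close>.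
\<close>

lemma wedge_coefficients_unique:
  assumes A: "A \<in> carrier_mat m m" and B: "B \<in> carrier_mat m m"
    and eq: "\<And>v w. v \<in> carrier_vec m \<Longrightarrow> w \<in> carrier_vec m \<Longrightarrow>
      (\<Sum>i<m. \<Sum>j<m. A $$ (i,j) * (v $ i * cnj (w $ j) - w $ i * cnj (v $ j)))
      = (\<Sum>i<m. \<Sum>j<m. B $$ (i,j) * (v $ i * cnj (w $ j) - w $ i * cnj (v $ j)))"
  shows "A = B"
proof (rule eq_matI, goal_cases)
  case (1 k l)
  then have kl: "k < m" "l < m" using B by auto
  have eval: "(\<Sum>i<m. \<Sum>j<m. X $$ (i,j) * ((c \<cdot>\<^sub>v unit_vec m k) $ i * cnj (unit_vec m l $ j)
      - unit_vec m l $ i * cnj ((c \<cdot>\<^sub>v unit_vec m k) $ j)))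
     = X $$ (k,l) * c - X $$ (l,k) * cnj c" for X :: "complex mat" and c
  proof -
    have "(\<Sum>i<m. \<Sum>j<m. X $$ (i,j) * ((c \<cdot>\<^sub>v unit_vec m k) $ i * cnj (unit_vec m l $ j)
        - unit_vec m l $ i * cnj ((c \<cdot>\<^sub>v unit_vec m k) $ j)))
      = (\<Sum>i<m. \<Sum>j<m. (if j = l then (if i = k then X $$ (k,l) * c else 0) else 0) - (if j
          = k then (if i = l then X $$ (l,k) * cnj c else 0) else 0))"
      using kl by (intro sum.cong refl) (auto simp: right_diff_distrib)
    then show ?thesis using kl by (simp add: sum_subtractf)
  qed
  have "A $$ (k,l) * c - A $$ (l,k) * cnj c = B $$ (k,l) * c - B $$ (l,k) * cnj c" for c
    using eq[of "c \<cdot>\<^sub>v unit_vec m k" "unit_vec m l"] unfolding eval by simp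
  from this[of 1] this[of \<i>] have "A $$ (k,l) - A $$ (l,k) = B $$ (k,l) - B $$ (l,k)"
    "\<i> * (A $$ (k,l) + A $$ (l,k)) = \<i> * (B $$ (k,l) + B $$ (l,k))"
    by (simp_all add: algebra_simps)
  then have "A $$ (k,l) - A $$ (l,k) = B $$ (k,l) - B $$ (l,k)" "A $$ (k,l) + A $$ (l,k)
      = B $$ (k,l) + B $$ (l,k)"
    by simp_all
  then show ?case by (simp add: complex_eq_iff)
qed (use A B in auto)

context
  fixes n :: nat and s :: complex and \<sigma> :: "nat \<Rightarrow> complex mat" and \<alpha> :: nat and f :: "real \<Rightarrow> real"
  assumes s: "s \<noteq> 0" and csp: "cyclic_signed_perms n \<sigma>" and \<alpha>: "\<alpha>
      \<le> n" and f: "\<And>x. f differentiable (at x)"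
begin

lemma tau_chart_tau_fun:
  assumes "q \<in> carrier_vec (2*n)" shows "tau_chart n s \<sigma> \<alpha> q = tau_fun n s q"
  unfolding tau_chart_eq[OF s csp \<alpha> assms] tau_fun_def base_norm_def fibre_norm_def eta_def ..

text \<open>
  A real function has derivative \<open>2 Re \<partial>\<tau>(v)\<close> along a real line.
\<close>

lemma dir_deriv_tau:
  assumes q: "q \<in> carrier_vec (2*n)" and v: "v \<in> carrier_vec (2*n)"
  shows "dir_deriv (\<lambda>q. of_real (tau_chart n s \<sigma> \<alpha> q)) q v = of_real (2
      * Re (lin_form n (del_tau n s q) v))"
proof -
  have "(\<lambda>t. complex_of_real (tau_chart n s \<sigma> \<alpha> (q + of_real t \<cdot>\<^sub>v v)))
      = (\<lambda>t. of_real (tau_fun n s (line q v t)))"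
    using q v by (simp add: line_def tau_chart_tau_fun)
  then show ?thesis
    unfolding dir_deriv_def
    using vector_derivative_at[OF has_vector_derivative_complex_of_real[OF tau_fun_deriv[OF q v, of
        s]]] by simp
qed

lemma wirtinger_tau:
  assumes q: "q \<in> carrier_vec (2*n)" and i: "i < 2*n"
  shows "d_z (\<lambda>q. of_real (tau_chart n s \<sigma> \<alpha> q)) i q = del_tau n s q i"
    "d_zbar (\<lambda>q. of_real (tau_chart n s \<sigma> \<alpha> q)) i q = cnj (del_tau n s q i)"
proof -
  have dq: "dim_vec q = 2*n" using q by simp
  have "dir_deriv (\<lambda>q. of_real (tau_chart n s \<sigma> \<alpha> q)) q (unit_vec (2*n) i) = of_real (2
      * Re (del_tau n s q i))"
    "dir_deriv (\<lambda>q. of_real (tau_chart n s \<sigma> \<alpha> q)) q (\<i> \<cdot>\<^sub>v unit_vec (2*n) i) = of_real (2 * Re (\<i>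
        * del_tau n s q i))"
    by (simp_all only: dir_deriv_tau[OF q] unit_vec_carrier smult_carrier_vec lin_form_unit[OF i])
  then show "d_z (\<lambda>q. of_real (tau_chart n s \<sigma> \<alpha> q)) i q = del_tau n s q i"
    "d_zbar (\<lambda>q. of_real (tau_chart n s \<sigma> \<alpha> q)) i q = cnj (del_tau n s q i)"
    unfolding d_z_def d_zbar_def dq by (simp_all add: complex_eq_iff)
qed

text \<open>
  The form is real, since \<open>\<partial>\<close>-bar of \<open>\<tau>\<close> is the conjugate of \<open>\<partial>\<tau>\<close>.
\<close>

lemma theta_eq:
  assumes q: "q \<in> carrier_vec (2*n)" and v: "v \<in> carrier_vec (2*n)"
  shows "theta n s \<sigma> f \<alpha> q v = of_real (f (tau_fun n s q) * Im (lin_form n (del_tau n s q) v) / 2)"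
proof -
  have dq: "dim_vec q = 2*n" using q by simp
  let ?a = "lin_form n (del_tau n s q) v"
  have "del (\<lambda>q. of_real (tau_chart n s \<sigma> \<alpha> q)) q v = ?a"
    unfolding del_def dq lin_form_def by (intro sum.cong refl) (simp add: wirtinger_tau[OF q])
  moreover have "delbar (\<lambda>q. of_real (tau_chart n s \<sigma> \<alpha> q)) q v = cnj ?a"
    unfolding delbar_def dq lin_form_def cnj_sum by (intro sum.cong refl) (simp add:
        wirtinger_tau[OF q])
  ultimately show ?thesis
    unfolding theta_def tau_chart_tau_fun[OF q] by (simp add: complex_eq_iff)
qed

lemma dir_deriv_theta:
  assumes p: "p \<in> carrier_vec (2*n)" and v: "v \<in> carrier_vec (2*n)" and w: "w \<in> carrier_vec (2*n)"
  shows "dir_deriv (\<lambda>q. theta n s \<sigma> f \<alpha> q w) p v = of_real (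
    deriv f (tau_fun n s p) * Re (lin_form n (del_tau n s p) v) * Im (lin_form n (del_tau n s p) w)
    + f (tau_fun n s p) * Im (hess_tau n s p v w) / 2)"
proof -
  have eq: "theta n s \<sigma> f \<alpha> (p + of_real t \<cdot>\<^sub>v v) w
    = of_real (f (tau_fun n s (line p v t)) * Im (lin_form n (del_tau n s (line p v t)) w) / 2)" for t
    using theta_eq[OF line_carrier(1)[OF p v] w, of t] by (simp add: line_def)
  have line0: "line p v 0 = p" by (rule line_0[OF p v])
  have "(f has_real_derivative deriv f (tau_fun n s p)) (at (tau_fun n s (line p v 0)))"
    using f unfolding line0 by (simp add: DERIV_deriv_iff_real_differentiable)
  from DERIV_chain2[OF this tau_fun_deriv[OF p v, of s]]
  have 1: "((\<lambda>t. f (tau_fun n s (line p v t))) has_real_derivative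
    deriv f (tau_fun n s p) * (2 * Re (lin_form n (del_tau n s p) v))) (at 0)" .
  have 2: "((\<lambda>t. Im (lin_form n (del_tau n s (line p v t)) w)) has_real_derivative Im (hess_tau n s
      p v w)) (at 0)"
    using bounded_linear.has_vector_derivative[OF bounded_linear_Im del_tau_deriv[OF p v, of s w]]
    by (simp add: has_real_derivative_iff_has_vector_derivative)
  have "((\<lambda>t. f (tau_fun n s (line p v t)) * Im (lin_form n (del_tau n s (line p v t)) w)
      / 2) has_real_derivative
     (deriv f (tau_fun n s p) * (2 * Re (lin_form n (del_tau n s p) v))
         * Im (lin_form n (del_tau n s (line p v 0)) w)
      + Im (hess_tau n s p v w) * f (tau_fun n s (line p v 0))) / 2) (at 0)"
    by (intro DERIV_cdivide DERIV_mult 1 2)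
  from vector_derivative_at[OF has_vector_derivative_complex_of_real[OF this]]
  show ?thesis unfolding dir_deriv_def eq line0 by (simp add: field_simps)
qed

text \<open>
  Antisymmetrising the second derivative of \<open>\<tau>\<close> removes its symmetric part and leaves minus twice the
  imaginary part of the Levi form; the derivative of \<open>f(\<tau>)\<close> contributes the imaginary part of the
  dyad of \<open>\<partial>\<tau>\<close>.
\<close>

lemma omega_I_eq:
  assumes p: "p \<in> carrier_vec (2*n)" and v: "v \<in> carrier_vec (2*n)" and w: "w \<in> carrier_vec (2*n)"
  shows "omega_I n s \<sigma> f \<alpha> p v w = - of_real (Im (sesq (2*n) (kaehler_matrix n s f p) v w))"
proof -
  have sym: "hess_eta n w v = hess_eta n v w" by (rule hess_eta_commute)
  have herm: "(\<Sum>k<n. w $ k * cnj (v $ k)) = cnj (\<Sum>k<n. v $ k * cnj (w $ k))"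
    "(\<Sum>k<n. w $ (n+k) * cnj (v $ (n+k))) = cnj (\<Sum>k<n. v $ (n+k) * cnj (w $ (n+k)))"
    by (simp_all add: mult.commute)
  have D: "Im (hess_tau n s p v w) - Im (hess_tau n s p w v) = - 2 * Im (fibre_norm n s p
      * (\<Sum>k<n. v $ k * cnj (w $ k)) + base_norm n p * (\<Sum>k<n. v $ (n+k) * cnj (w $ (n+k)))
      + base_norm n p * (lin_form n (del_eta n p) v * cnj (lin_form n (del_eta n p) w))
      + lin_form n (del_base n p) v * cnj (lin_form n (del_fibre n s p) w)
      + lin_form n (del_fibre n s p) v * cnj (lin_form n (del_base n p) w))"
    unfolding hess_tau_def sym herm by (simp add: algebra_simps del: cnj_sum Im_sum)
  have "omega_I n s \<sigma> f \<alpha> p v w = of_real (deriv f (tau_fun n s p) *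
     (Re (lin_form n (del_tau n s p) v) * Im (lin_form n (del_tau n s p) w)
         - Re (lin_form n (del_tau n s p) w) * Im (lin_form n (del_tau n s p) v))
     + f (tau_fun n s p) / 2 * (Im (hess_tau n s p v w) - Im (hess_tau n s p w v)))"
    unfolding omega_I_def ext_deriv_def dir_deriv_theta[OF p v w] dir_deriv_theta[OF p w v]
    by (simp add: field_simps)
  also have "\<dots> = - of_real (Im (sesq (2*n) (kaehler_matrix n s f p) v w))"
    unfolding D sesq_kaehler_matrix
    by (simp only: plus_complex.sel times_complex.sel Re_complex_of_real Im_complex_of_real cnj.sel
        of_real_minus[symmetric]) (simp add: algebra_simps)
  finally show ?thesis .
qed

lemma g_components_eq:
  assumes p: "p \<in> carrier_vec (2*n)"
  shows "g_components n s \<sigma> f \<alpha> p = kaehler_matrix n s f p"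
proof -
  let ?K = "kaehler_matrix n s f p"
  let ?S = "\<lambda>A v w. (\<Sum>i<2*n. \<Sum>j<2*n. A $$ (i,j) * (v $ i * cnj (w $ j) - w $ i * cnj (v $ j)))"
  have K: "?K \<in> carrier_mat (2*n) (2*n)" by (simp add: kaehler_matrix_def)
  have herm: "?K $$ (j,i) = cnj (?K $$ (i,j))" if "i < 2*n" "j < 2*n" for i j
    using that by (simp add: kaehler_matrix_def levi_tau_def)
  have om: "omega_I n s \<sigma> f \<alpha> p v w = \<i> / 2 * ?S ?K v w" if "v \<in> carrier_vec (2*n)" "w \<in> carrier_vec
      (2*n)" for v w
    unfolding omega_I_eq[OF p that] by (rule sesq_antisymmetric_part[OF herm, symmetric])
  show ?thesis
    unfolding g_components_def
  proof (rule the_equality)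
    show "?K \<in> carrier_mat (2*n) (2*n) \<and> (\<forall>v \<in> carrier_vec (2*n). \<forall>w \<in> carrier_vec (2*n). omega_I n
        s \<sigma> f \<alpha> p v w = \<i> / 2 * ?S ?K v w)"
      using K om by blast
  next
    fix A assume A: "A \<in> carrier_mat (2*n) (2*n) \<and> (\<forall>v \<in> carrier_vec (2*n). \<forall>w \<in> carrier_vec (2*n).
        omega_I n s \<sigma> f \<alpha> p v w = \<i> / 2 * ?S A v w)"
    show "A = ?K"
    proof (rule wedge_coefficients_unique[OF _ K])
      fix v w :: "complex vec" assume vw: "v \<in> carrier_vec (2*n)" "w \<in> carrier_vec (2*n)"
      from A vw have "omega_I n s \<sigma> f \<alpha> p v w = \<i> / 2 * ?S A v w" by blast
      from trans[OF this[symmetric] om[OF vw]] have "\<i> / 2 * ?S A v w = \<i> / 2 * ?S ?K v w" .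
      then show "?S A v w = ?S ?K v w" by simp
    qed (use A in blast)
  qed
qed

end

text \<open>
  Completing squares divides by both factors of \<open>\<tau>\<close>.  They do not vanish: \<open>N \<ge> 1\<close>, and \<open>M = 0\<close> would
  force \<open>\<xi> = 0\<close> and then \<open>s = 0\<close>.
\<close>

lemma det_kaehler_matrix:
  assumes n: "n \<ge> 1" and s: "s \<noteq> 0"
  shows "Determinant.det (kaehler_matrix n s f p) = of_real (
    2 * deriv f (tau_fun n s p) * f (tau_fun n s p) ^ (2 * n - 1) * tau_fun n s p ^ n
        * (tau_fun n s p - (cmod s)\<^sup>2)
    + f (tau_fun n s p) ^ (2 * n) * tau_fun n s p ^ (n - 1) * (2 * tau_fun n s p - (cmod s)\<^sup>2))"
proof -
  let ?z = "\<lambda>k. p $ k" and ?x = "\<lambda>k. p $ (n+k)"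
  let ?F = "complex_of_real (f (tau_fun n s p))" and ?G = "complex_of_real (deriv f (tau_fun n s p))"
  have N: "complex_of_real (base_norm n p) = 1 + (\<Sum>k<n. ?z k * cnj (?z k))"
    unfolding base_norm_def of_real_add of_real_sum complex_norm_square of_real_1 ..
  have M: "complex_of_real (fibre_norm n s p) = (\<Sum>k<n. ?x k * cnj (?x k)) + eta n s p * cnj (eta n s p)"
    unfolding fibre_norm_def of_real_add of_real_sum complex_norm_square ..
  have Npos: "base_norm n p > 0"
    unfolding base_norm_def by (intro add_pos_nonneg sum_nonneg) auto
  have Mpos: "fibre_norm n s p \<noteq> 0"
  proof
    assume "fibre_norm n s p = 0"
    moreover have nn: "(\<Sum>k<n. (cmod (p $ (n+k)))\<^sup>2) \<ge> 0" "(cmod (eta n s p))\<^sup>2 \<ge> 0"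
        by (auto intro: sum_nonneg)
    ultimately have "(\<Sum>k<n. (cmod (p $ (n+k)))\<^sup>2) = 0" "(cmod (eta n s p))\<^sup>2 = 0"
      unfolding fibre_norm_def using add_nonneg_eq_0_iff[OF nn] by auto
    then have "\<forall>k<n. p $ (n+k) = 0" "eta n s p = 0" by (auto simp: sum_nonneg_eq_0_iff)
    then show False using s by (simp add: eta_def)
  qed
  have "Determinant.det (kaehler_matrix n s f p) =
    ?F ^ (2*n) * (complex_of_real (base_norm n p) * complex_of_real (fibre_norm n s p)) ^ (n-1) * (2
        * (complex_of_real (base_norm n p) * complex_of_real (fibre_norm n s p)) - s * cnj s)
    + 2 * ?G * ?F ^ (2*n-1) * (complex_of_real (base_norm n p)
        * complex_of_real (fibre_norm n s p)) ^ n * (complex_of_real (base_norm n p)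
        * complex_of_real (fibre_norm n s p) - s * cnj s)"
    unfolding N M eta_def
  proof (rule det_levi_form[OF n], goal_cases)
    case 1 then show ?case using Npos unfolding N[symmetric] by simp
  next
    case 2 then show ?case using Mpos unfolding eta_def[symmetric] M[symmetric] by simp
  next
    case 3 then show ?case by (simp add: kaehler_matrix_def)
  next
    case (4 i j)
    then show ?case unfolding eta_def[symmetric] M[symmetric] N[symmetric]
      by (simp add: kaehler_matrix_def levi_tau_def del_tau_def del_base_def del_fibre_def
          del_eta_def algebra_simps)
  next
    case (5 i j)
    then show ?case unfolding eta_def[symmetric] M[symmetric] N[symmetric]
      by (simp add: kaehler_matrix_def levi_tau_def del_tau_def del_base_def del_fibre_def
          del_eta_def algebra_simps)
  next
    case (6 i j)
    then show ?case unfolding eta_def[symmetric] M[symmetric] N[symmetric]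
      by (simp add: kaehler_matrix_def levi_tau_def del_tau_def del_base_def del_fibre_def
          del_eta_def algebra_simps)
  next
    case (7 i j)
    then show ?case unfolding eta_def[symmetric] M[symmetric] N[symmetric]
      by (simp add: kaehler_matrix_def levi_tau_def del_tau_def del_base_def del_fibre_def
          del_eta_def algebra_simps)
  qed
  also have "s * cnj s = complex_of_real ((cmod s)\<^sup>2)" by (rule complex_norm_square[symmetric])
  finally show ?thesis
    unfolding tau_fun_def by (simp add: algebra_simps)
qed

section \<open>The values of tau and the theorem\<close>

text \<open>
  \<open>s\<close> is the pairing of \<open>(z; 1)\<close> with \<open>(\<xi>; s - \<xi> z)\<close>, and \<open>\<tau>\<close> is the product of their square norms.
\<close>

lemma tau_fun_ge:
  "tau_fun n s p \<ge> (cmod s)\<^sup>2"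
proof -
  (* The entries of the two vectors of length n + 1, index n being the additional one. *)
  let ?a = "\<lambda>k. if k < n then cmod (p $ (n+k)) else cmod (eta n s p)"
  let ?b = "\<lambda>k. if k < n then cmod (p $ k) else 1"
  have "cmod s = cmod ((\<Sum>k<n. p $ (n+k) * p $ k) + eta n s p)" by (simp add: eta_def)
  also have "\<dots> \<le> cmod (\<Sum>k<n. p $ (n+k) * p $ k) + cmod (eta n s p)" by (rule norm_triangle_ineq)
  also have "cmod (\<Sum>k<n. p $ (n+k) * p $ k) \<le> (\<Sum>k<n. cmod (p $ (n+k)) * cmod (p $ k))"
    by (rule order_trans[OF norm_sum]) (simp add: norm_mult)
  finally have "cmod s \<le> (\<Sum>k<Suc n. ?a k * ?b k)" by simp
  then have "(cmod s)\<^sup>2 \<le> (\<Sum>k<Suc n. ?a k * ?b k)\<^sup>2" by (rule power_mono) simp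
  also have "\<dots> \<le> (\<Sum>k<Suc n. (?a k)\<^sup>2) * (\<Sum>k<Suc n. (?b k)\<^sup>2)" by (rule Cauchy_Schwarz_ineq_sum)
  also have "\<dots> = tau_fun n s p" by (simp add: tau_fun_def base_norm_def fibre_norm_def algebra_simps)
  finally show ?thesis .
qed

text \<open>
  Over \<open>z = 0\<close> the value is \<open>|\<xi>|\<^sup>2 + |s|\<^sup>2\<close>, and \<open>\<xi>\<close> has at least one entry.
\<close>

lemma tau_fun_attains:
  assumes "n \<ge> 1" "\<tau> \<ge> (cmod s)\<^sup>2"
  shows "\<exists>p \<in> carrier_vec (2*n). tau_fun n s p = \<tau>"
proof -
  (* Index n is the first fibre coordinate. *)
  define p where "p = vec (2*n) (\<lambda>i. if i = n then complex_of_real (sqrt (\<tau> - (cmod s)\<^sup>2)) else 0)"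
  have z: "p $ k = 0" if "k < n" for k using that by (simp add: p_def)
  have x: "p $ (n+k) = (if k = 0 then complex_of_real (sqrt (\<tau> - (cmod s)\<^sup>2)) else 0)" if "k < n" for k
    using that by (auto simp: p_def)
  have "(\<Sum>k<n. (cmod (p $ (n+k)))\<^sup>2) = (\<Sum>k<n. if k = 0 then \<tau> - (cmod s)\<^sup>2 else 0)"
    using assms(2) by (intro sum.cong refl) (simp add: x)
  also have "\<dots> = \<tau> - (cmod s)\<^sup>2" using assms(1) by simp
  finally have "tau_fun n s p = \<tau>"
    by (simp add: tau_fun_def base_norm_def fibre_norm_def eta_def z)
  then show ?thesis by (intro bexI[of _ p]) (auto simp: p_def)
qed

theorem theorem3p2:
  fixes n :: nat and s :: complex and \<sigma> :: "nat \<Rightarrow> complex mat" and f :: "real \<Rightarrow> real"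
  assumes "n \<ge> 1" and "s \<noteq> 0"
    and "cyclic_signed_perms n \<sigma>"
    and "smooth_real f"
    and "\<forall>\<alpha>\<le>n. \<forall>p\<in>carrier_vec (2 * n). \<forall>v\<in>carrier_vec (2 * n).
           v \<noteq> 0\<^sub>v (2 * n) \<longrightarrow>
           omega_I n s \<sigma> f \<alpha> p v (\<i> \<cdot>\<^sub>v v) \<in> \<real> \<and> 0 < Re (omega_I n s \<sigma> f \<alpha> p v (\<i> \<cdot>\<^sub>v v))"
  shows "\<forall>\<alpha>\<le>n.
           (\<forall>p\<in>carrier_vec (2 * n). Determinant.det (g_components n s \<sigma> f \<alpha> p) = 1) \<longleftrightarrow>
           (\<forall>\<tau>::real. \<tau> \<ge> (cmod s)\<^sup>2 \<longrightarrow>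
              2 * deriv f \<tau> * f \<tau> ^ (2 * n - 1) * \<tau> ^ n * (\<tau> - (cmod s)\<^sup>2)
              + f \<tau> ^ (2 * n) * \<tau> ^ (n - 1) * (2 * \<tau> - (cmod s)\<^sup>2) = 1)"
proof (intro allI impI)
  fix \<alpha> assume \<alpha>: "\<alpha> \<le> n"
  let ?ode = "\<lambda>\<tau>. 2 * deriv f \<tau> * f \<tau> ^ (2 * n - 1) * \<tau> ^ n * (\<tau> - (cmod s)\<^sup>2)
              + f \<tau> ^ (2 * n) * \<tau> ^ (n - 1) * (2 * \<tau> - (cmod s)\<^sup>2)"
  have f: "f differentiable (at x)" for x
    using assms(4) unfolding smooth_real_def by (metis funpow_0)
  have det: "Determinant.det (g_components n s \<sigma> f \<alpha> p) = of_real (?ode (tau_fun n s p))"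
    if "p \<in> carrier_vec (2*n)" for p
    unfolding g_components_eq[OF assms(2,3) \<alpha> f that] by (rule det_kaehler_matrix[OF assms(1,2)])
  show "(\<forall>p\<in>carrier_vec (2 * n). Determinant.det (g_components n s \<sigma> f \<alpha> p) = 1) \<longleftrightarrow>
    (\<forall>\<tau>. \<tau> \<ge> (cmod s)\<^sup>2 \<longrightarrow> ?ode \<tau> = 1)"
  proof
    assume L: "\<forall>p\<in>carrier_vec (2 * n). Determinant.det (g_components n s \<sigma> f \<alpha> p) = 1"
    show "\<forall>\<tau>. \<tau> \<ge> (cmod s)\<^sup>2 \<longrightarrow> ?ode \<tau> = 1"
    proof (intro allI impI)
      fix \<tau> assume "\<tau> \<ge> (cmod s)\<^sup>2"
      from tau_fun_attains[OF assms(1) this] obtain p where p: "p \<in> carrier_vec (2*n)" "tau_fun n s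
          p = \<tau>" by blast
      with L det[OF p(1)] have "complex_of_real (?ode \<tau>) = 1" by simp
      then show "?ode \<tau> = 1" unfolding of_real_eq_1_iff .
    qed
  next
    assume R: "\<forall>\<tau>. \<tau> \<ge> (cmod s)\<^sup>2 \<longrightarrow> ?ode \<tau> = 1"
    show "\<forall>p\<in>carrier_vec (2 * n). Determinant.det (g_components n s \<sigma> f \<alpha> p) = 1"
    proof
      fix p :: "complex vec" assume p: "p \<in> carrier_vec (2 * n)"
      have "?ode (tau_fun n s p) = 1" using R tau_fun_ge by blast
      then show "Determinant.det (g_components n s \<sigma> f \<alpha> p) = 1"
        unfolding det[OF p] by (simp only: of_real_1)
    qed
  qed
qed

end
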